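(* Let $0<p<\infty$ and let $\mu$ be a positive Borel measure on $\mathbb C_0$. For $s=\sigma+it\in\mathbb C_0$ put $$W(s)=\frac1\sigma\int_{t-\sigma}^{t+\sigma}\frac{d\tau}{1+\tau^2},\qquad c_n=\int_{\mathbb C_0}W(s)\,n^{-p\operatorname{Re}s}\,d\mu(s)\in[0,\infty],\quad n\ge1.$$ (1) The following are equivalent: (i) $\mathbb A_{\mu,p}:\mathscr H^p\to L^p_{\mathrm i}$ is bounded; (ii) $\mathbb A_{\mu,p}:\mathscr H^p\to L^p_{\mathrm i}$ is compact; (iii) $c_1<\infty$. When these conditions hold, $\|\mathbb A_{\mu,p}\|^p_{\mathscr H^p\to L^p_{\mathrm i}}=c_1$. (2) The following are equivalent: (i) $\mathbb A_{\mu,p}:\mathscr H^p_0\to L^p_{\mathrm i}$ is bounded; (ii) $\mathbb A_{\mu,p}:\mathscr H^p_0\to L^p_{\mathrm i}$ is compact; (iii) $c_2<\infty$. When these conditions hold, $\|\mathbb A_{\mu,p}\|^p_{\mathscr H^p_0\to L^p_{\mathrm i}}=c_2$.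
   Context: Half-plane: $\mathbb C_0=\{s\in\mathbb C:\operatorname{Re}s>0\}$, $s=\sigma+it$. Hardy spaces of Dirichlet series: $\mathbb T^\infty$ is the countably infinite torus with normalized Haar measure $m_\infty$. Each $\chi=(\chi_1,\chi_2,\dots)\in\mathbb T^\infty$ is identified with the completely multiplicative function $\chi:\mathbb N\to\mathbb T$ with $\chi(\mathfrak p_j)=\chi_j$, where $\mathfrak p_j$ is the $j$-th prime. For $0<p<\infty$, $\mathscr H^p$ is the completion of the Dirichlet polynomials $P(s)=\sum_{n\le N}a_nn^{-s}$ in the (quasi-)norm $\|P\|_{\mathscr H^p}=\big(\int_{\mathbb T^\infty}|\sum_{n\le N}a_n\chi(n)|^p\,dm_\infty(\chi)\big)^{1/p}$; its elements are identified with Dirichlet series $f(s)=\sum_{n\ge1}a_nn^{-s}$. $\mathscr H^p_0$ is the closed subspace of those $f$ with $f(+\infty):=a_1=0$. The vertical limit of $f$ is $f_\chi(s)=\sum_{n\ge1}a_n\chi(n)n^{-s}$; for $f\in\mathscr H^p$ it is known that for $m_\infty$-almost every $\chi$ it extends analytically to $\mathbb C_0$, and $f_\chi$ denotes this extension. Area operator: for $\tau\in\mathbb R$, $\Gamma_\tau=\{\sigma+it\in\mathbb C_0:|t-\tau|<\sigma\}$. For $0<l<\infty$ and a positive Borel measure $\mu$ on $\mathbb C_0$, $$\mathbb A_{\mu,l}f(\chi,\tau)=\Big(\int_{\Gamma_\tau}|f_\chi(s)|^l\frac{d\mu(s)}{\operatorname{Re}s}\Big)^{1/l},\quad \chi\in\mathbb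 T^\infty,\ \tau\in\mathbb R,$$ with value $+\infty$ allowed; here $l=p$. $L^p_{\mathrm i}$ is the space of measurable $F$ on $\mathbb T^\infty\times\mathbb R$ with $\|F\|_{L^p_{\mathrm i}}^p=\int_{\mathbb T^\infty}\int_{\mathbb R}|F(\chi,\tau)|^p\frac{d\tau}{1+\tau^2}\,dm_\infty(\chi)<\infty$. For $X=\mathscr H^p$ or $\mathscr H^p_0$: $\mathbb A_{\mu,l}:X\to L^p_{\mathrm i}$ is bounded if there is $C<\infty$ with $\|\mathbb A_{\mu,l}f\|_{L^p_{\mathrm i}}\le C\|f\|_{\mathscr H^p}$ for all $f\in X$, and $\|\mathbb A_{\mu,l}\|_{X\to L^p_{\mathrm i}}$ is the least such $C$; it is compact if it maps bounded subsets of $X$ to relatively compact subsets of $L^p_{\mathrm i}$. *)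

theory Defs
  imports
    "HOL-Probability.Probability"
    "HOL-Complex_Analysis.Complex_Analysis"
    "HOL-Computational_Algebra.Primes"
begin

definition half_plane :: "complex set" where
  "half_plane = {s. Re s > 0}"

text \<open>Powers with positive exponent on \<open>[0, \<infinity>]\<close>.\<close>

definition epowr :: "ennreal \<Rightarrow> real \<Rightarrow> ennreal" where
  "epowr x p = (if x = \<infinity> then \<infinity> else ennreal (enn2real x powr p))"


section \<open>The infinite torus\<close>

text \<open>Normalized arc length on the unit circle; Haar measure on the infinite torus is the
  product of countably many copies of it. The space of \<open>torus\<close> consists of all sequences of
  unimodular numbers, and coordinates are numbered from 0.\<close>

definition circle_measure :: "complex measure" where
  "circle_measure =
     distr (uniform_measure lborel {0..1::real}) (restrict_space borel (sphere 0 1))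
       (\<lambda>\<theta>. cis (2 * pi * \<theta>))"

definition torus :: "(nat \<Rightarrow> complex) measure" where
  "torus = (\<Pi>\<^sub>M j\<in>(UNIV::nat set). circle_measure)"

definition nth_prime :: "nat \<Rightarrow> nat" where
  "nth_prime j = enumerate {q. prime q} j"

text \<open>The completely multiplicative function with value \<open>\<omega> j\<close> at the \<open>j\<close>-th prime
  (only used at arguments \<open>n \<ge> 1\<close>).\<close>

definition mult_ext :: "(nat \<Rightarrow> complex) \<Rightarrow> nat \<Rightarrow> complex" where
  "mult_ext \<omega> n = (\<Prod>j\<in>{j. nth_prime j dvd n}. \<omega> j ^ multiplicity (nth_prime j) n)"


section \<open>Hardy spaces of Dirichlet series\<close>

text \<open>A Dirichlet series \<open>\<Sum>n\<ge>1. a n * n powr (-s)\<close> is represented by its coefficient sequence,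
  with the convention \<open>a 0 = 0\<close>.\<close>

definition dirichlet_polys :: "(nat \<Rightarrow> complex) set" where
  "dirichlet_polys = {a. finite {n. a n \<noteq> 0} \<and> a 0 = 0}"

definition poly_norm :: "real \<Rightarrow> (nat \<Rightarrow> complex) \<Rightarrow> real" where
  "poly_norm p a =
     (LINT \<omega>|torus. norm (\<Sum>n | a n \<noteq> 0. a n * mult_ext \<omega> n) powr p) powr (1 / p)"

text \<open>The completion: an element is given by a sequence of Dirichlet polynomials that is Cauchy in
  the (quasi-)norm. Each coefficient is continuous in the (quasi-)norm, so the coefficients of such
  a sequence converge; the element is identified with the Dirichlet series having the limit
  coefficients, and its (quasi-)norm is the limit of the (quasi-)norms.\<close>

definition approximates :: "real \<Rightarrow> (nat \<Rightarrow> nat \<Rightarrow> complex) \<Rightarrow> (nat \<Rightarrow> complex) \<Rightarrow> bool" where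
  "approximates p P a \<longleftrightarrow>
     (\<forall>k. P k \<in> dirichlet_polys) \<and>
     (\<forall>\<epsilon>>0. \<exists>K. \<forall>j\<ge>K. \<forall>k\<ge>K. poly_norm p (\<lambda>n. P j n - P k n) < \<epsilon>) \<and>
     (\<forall>n. (\<lambda>k. P k n) \<longlonglongrightarrow> a n)"

definition hardy :: "real \<Rightarrow> (nat \<Rightarrow> complex) set" where
  "hardy p = {a. \<exists>P. approximates p P a}"

definition hardy_norm :: "real \<Rightarrow> (nat \<Rightarrow> complex) \<Rightarrow> real" where
  "hardy_norm p a = (THE r. \<exists>P. approximates p P a \<and> (\<lambda>k. poly_norm p (P k)) \<longlonglongrightarrow> r)"

definition hardy0 :: "real \<Rightarrow> (nat \<Rightarrow> complex) set" where
  "hardy0 p = {a \<in> hardy p. a 1 = 0}"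

definition analytic_extension :: "(nat \<Rightarrow> complex) \<Rightarrow> (complex \<Rightarrow> complex) \<Rightarrow> bool" where
  "analytic_extension b g \<longleftrightarrow>
     g holomorphic_on half_plane \<and>
     (\<exists>\<sigma>0. \<forall>s. Re s > \<sigma>0 \<longrightarrow> (\<lambda>n. b n * of_nat n powr (- s)) sums g s)"

text \<open>The vertical limit, extended to \<^const>\<open>half_plane\<close>. When an extension exists, its values there
  are unique by the identity theorem; for the null set of \<open>\<omega>\<close> without an extension the
  value is unspecified.\<close>

definition vertical_limit :: "(nat \<Rightarrow> complex) \<Rightarrow> (nat \<Rightarrow> complex) \<Rightarrow> complex \<Rightarrow> complex" where
  "vertical_limit a \<omega> = (SOME g. analytic_extension (\<lambda>n. a n * mult_ext \<omega> n) g)"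


section \<open>The target space\<close>

text \<open>The measure is completed, because vertical limits are only determined for almost every
  \<open>\<omega>\<close>. Functions are extended real valued since the area operator may take the value \<open>\<infinity>\<close>;
  those in \<open>Lpi\<close> are finite almost everywhere, so \<open>\<infinity> - \<infinity>\<close> only occurs on null sets.\<close>

definition strip_measure :: "((nat \<Rightarrow> complex) \<times> real) measure" where
  "strip_measure =
     completion (torus \<Otimes>\<^sub>M density lborel (\<lambda>\<tau>. ennreal (1 / (1 + \<tau>\<^sup>2))))"

definition Lpi_norm :: "real \<Rightarrow> ((nat \<Rightarrow> complex) \<times> real \<Rightarrow> ereal) \<Rightarrow> ennreal" where
  "Lpi_norm p F = epowr (\<integral>\<^sup>+ x. epowr (e2ennreal \<bar>F x\<bar>) p \<partial>strip_measure) (1 / p)"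

definition Lpi :: "real \<Rightarrow> ((nat \<Rightarrow> complex) \<times> real \<Rightarrow> ereal) set" where
  "Lpi p = {F \<in> borel_measurable strip_measure. Lpi_norm p F < \<infinity>}"

text \<open>The topology of the (quasi-)norm distance. Functions that agree almost everywhere are not
  identified but are topologically indistinguishable, so a set is relatively compact here
  iff the corresponding set of equivalence classes is.\<close>

definition Lpi_open :: "real \<Rightarrow> ((nat \<Rightarrow> complex) \<times> real \<Rightarrow> ereal) set \<Rightarrow> bool" where
  "Lpi_open p U \<longleftrightarrow>
     U \<subseteq> Lpi p \<and>
     (\<forall>F\<in>U. \<exists>\<epsilon>>0. \<forall>G\<in>Lpi p. Lpi_norm p (\<lambda>x. G x - F x) < \<epsilon> \<longrightarrow> G \<in> U)"

definition Lpi_topology :: "real \<Rightarrow> ((nat \<Rightarrow> complex) \<times> real \<Rightarrow> ereal) topology" where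
  "Lpi_topology p = topology (Lpi_open p)"

lemma istopology_Lpi_open: "istopology (Lpi_open p)"
  unfolding istopology_def
proof (intro conjI allI impI)
  fix S T assume S: "Lpi_open p S" and T: "Lpi_open p T"
  show "Lpi_open p (S \<inter> T)"
    unfolding Lpi_open_def
  proof (intro conjI ballI)
    show "S \<inter> T \<subseteq> Lpi p" using S by (auto simp: Lpi_open_def)
    fix F assume F: "F \<in> S \<inter> T"
    obtain d where d: "d > 0" "\<forall>G\<in>Lpi p. Lpi_norm p (\<lambda>x. G x - F x) < d \<longrightarrow> G \<in> S"
      using S F unfolding Lpi_open_def by blast
    obtain e where e: "e > 0" "\<forall>G\<in>Lpi p. Lpi_norm p (\<lambda>x. G x - F x) < e \<longrightarrow> G \<in> T"
      using T F unfolding Lpi_open_def by blast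
    show "\<exists>\<epsilon>>0. \<forall>G\<in>Lpi p. Lpi_norm p (\<lambda>x. G x - F x) < \<epsilon> \<longrightarrow> G \<in> S \<inter> T"
      by (rule exI[of _ "min d e"]) (use d e in auto)
  qed
next
  fix \<K> assume K: "\<forall>K\<in>\<K>. Lpi_open p K"
  show "Lpi_open p (\<Union>\<K>)"
    unfolding Lpi_open_def
  proof (intro conjI ballI)
    show "\<Union>\<K> \<subseteq> Lpi p" using K unfolding Lpi_open_def by blast
    fix F assume "F \<in> \<Union>\<K>"
    then obtain K where "K \<in> \<K>" "F \<in> K" by blast
    then obtain d where "d > 0" "\<forall>G\<in>Lpi p. Lpi_norm p (\<lambda>x. G x - F x) < d \<longrightarrow> G \<in> K"
      using K unfolding Lpi_open_def by blast
    then show "\<exists>\<epsilon>>0. \<forall>G\<in>Lpi p. Lpi_norm p (\<lambda>x. G x - F x) < \<epsilon> \<longrightarrow> G \<in> \<Union>\<K>"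
      using \<open>K \<in> \<K>\<close> by blast
  qed
qed

lemma openin_Lpi_topology: "openin (Lpi_topology p) U \<longleftrightarrow> Lpi_open p U"
  by (simp add: Lpi_topology_def topology_inverse'[OF istopology_Lpi_open])

lemma topspace_Lpi_topology: "topspace (Lpi_topology p) = Lpi p"
proof (rule antisym)
  show "topspace (Lpi_topology p) \<subseteq> Lpi p"
    unfolding topspace_def openin_Lpi_topology Lpi_open_def by blast
  have "openin (Lpi_topology p) (Lpi p)"
    unfolding openin_Lpi_topology Lpi_open_def using zero_less_one by blast
  then show "Lpi p \<subseteq> topspace (Lpi_topology p)" by (rule openin_subset)
qed


section \<open>The area operator\<close>

definition stolz_cone :: "real \<Rightarrow> complex set" where
  "stolz_cone \<tau> = {s \<in> half_plane. \<bar>Im s - \<tau>\<bar> < Re s}"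

definition area_op ::
  "complex measure \<Rightarrow> real \<Rightarrow> (nat \<Rightarrow> complex) \<Rightarrow> (nat \<Rightarrow> complex) \<times> real \<Rightarrow> ereal" where
  "area_op \<mu> l a = (\<lambda>(\<omega>, \<tau>). enn2ereal
     (epowr (\<integral>\<^sup>+ s \<in> stolz_cone \<tau>. ennreal (norm (vertical_limit a \<omega> s) powr l / Re s) \<partial>\<mu>) (1 / l)))"

definition area_bound ::
  "complex measure \<Rightarrow> real \<Rightarrow> real \<Rightarrow> (nat \<Rightarrow> complex) set \<Rightarrow> real \<Rightarrow> bool" where
  "area_bound \<mu> l p X C \<longleftrightarrow>
     0 \<le> C \<and>
     (\<forall>a\<in>X. area_op \<mu> l a \<in> Lpi p \<and> Lpi_norm p (area_op \<mu> l a) \<le> ennreal (C * hardy_norm p a))"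

definition area_bounded ::
  "complex measure \<Rightarrow> real \<Rightarrow> real \<Rightarrow> (nat \<Rightarrow> complex) set \<Rightarrow> bool" where
  "area_bounded \<mu> l p X \<longleftrightarrow> (\<exists>C. area_bound \<mu> l p X C)"

definition area_opnorm ::
  "complex measure \<Rightarrow> real \<Rightarrow> real \<Rightarrow> (nat \<Rightarrow> complex) set \<Rightarrow> real" where
  "area_opnorm \<mu> l p X = (LEAST C. area_bound \<mu> l p X C)"

definition area_compact ::
  "complex measure \<Rightarrow> real \<Rightarrow> real \<Rightarrow> (nat \<Rightarrow> complex) set \<Rightarrow> bool" where
  "area_compact \<mu> l p X \<longleftrightarrow>
     (\<forall>B \<subseteq> X. (\<exists>M. \<forall>a\<in>B. hardy_norm p a \<le> M) \<longrightarrow>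
        area_op \<mu> l ` B \<subseteq> Lpi p \<and>
        compactin (Lpi_topology p) (Lpi_topology p closure_of (area_op \<mu> l ` B)))"


section \<open>The quantities in the criterion\<close>

definition weight :: "complex \<Rightarrow> real" where
  "weight s = 1 / Re s * (LBINT \<tau>:{Im s - Re s..Im s + Re s}. 1 / (1 + \<tau>\<^sup>2))"

definition weight_moment :: "complex measure \<Rightarrow> real \<Rightarrow> nat \<Rightarrow> ennreal" where
  "weight_moment \<mu> p n = (\<integral>\<^sup>+ s. ennreal (weight s * real n powr (- p * Re s)) \<partial>\<mu>)"

end

theory Submission
  imports Defs
begin

text \<open>
  For a Dirichlet series \<open>f\<close> starting at \<open>n = m\<close>, Tonelli's theorem turns the \<open>p\<close>-th power of the
  norm of the image of \<open>f\<close> into \<open>\<integral> W(s) M(f, s) d\<mu>(s)\<close>, where \<open>M(f, s)\<close> is the mean of \<open>|f|\<^sup>p\<close> over all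
  vertical limits of \<open>f\<close> at \<open>s\<close>. Rotations of the torus contain the vertical translations, so
  \<open>M(f, s)\<close> only depends on \<open>\<sigma> = Re s\<close>, and everything rests on the bound
  \<open>M(f, \<sigma>) \<le> m powr (- p \<sigma>) * norm f powr p\<close>, with equality for the monomial \<open>m powr (- s)\<close>
  (\<open>hmean_shift_decay\<close>). Integrating it against \<open>W d\<mu>\<close> gives boundedness and the exact norm at once;
  \<open>m = 1\<close> and \<open>m = 2\<close> are the two parts of the theorem, and the proof treats every \<open>m \<ge> 1\<close>
  (\<open>area_bound_iff\<close>). Conversely, if the image of the monomial lies in the target space, then \<open>\<mu>\<close> is
  \<open>\<sigma>\<close>-finite, Tonelli applies, and the \<open>p\<close>-th power of the norm of that image is the moment
  \<open>c\<^sub>m\<close> itself.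

  The decay bound is a convexity statement. Since powers of moduli of holomorphic functions are
  subharmonic, \<open>U \<sigma> = m powr (p \<sigma>) * M(f, \<sigma>)\<close> satisfies \<open>U \<sigma> \<le>\<close> mean of \<open>U\<close> over
  \<open>\<sigma> + r cos \<theta>\<close>, for polynomials it is continuous and bounded on \<open>\<sigma> \<ge> 0\<close>, and a maximum principle
  shows \<open>U \<sigma> \<le> U 0\<close>. Subharmonicity is only used for entire functions, in the form
  \<open>entire_powr_circle_bound\<close>, which also bounds point values and hence the coefficients.

  Compactness holds because translation to the right by \<open>\<sigma> > 0\<close> is compact, for every \<open>p > 0\<close>
  (\<open>hmean_shift_tendsto_zero\<close>): the part of a polynomial that involves a prime \<open>\<ge> q\<close> starts at \<open>n \<ge> q\<close>
  and is damped by \<open>q powr (- p \<sigma>)\<close>, and the part on finitely many primes is controlled by its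
  coefficients. Hence a bounded sequence has a subsequence for which \<open>M(f\<^sub>i - f\<^sub>j, \<sigma>)\<close> tends to \<open>0\<close> for
  every \<open>\<sigma> > 0\<close>, and the decay bound is an integrable majorant with respect to \<open>W d\<mu>\<close>. The target space
  is complete, so the images converge along this subsequence.

  The spaces are only quasi-normed for \<open>p < 1\<close>. In place of the triangle inequality, the proof uses
  \<open>(x + y)\<^sup>p \<le> (1 + d)\<^sup>p x\<^sup>p + (1 + 1/d)\<^sup>p y\<^sup>p\<close> for all \<open>d > 0\<close>: with small \<open>d\<close> it yields continuity of the
  norms, with \<open>d = 1\<close> a quasi-triangle inequality, and it treats all \<open>p > 0\<close> in the same way.
\<close>

section \<open>Subharmonicity of powers of holomorphic functions\<close>

text \<open>
  Cauchy's integral formula with the kernel bounded by \<open>1 / (1 - norm w)\<close>.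
\<close>

lemma holomorphic_circle_bound:
  assumes H: "H holomorphic_on ball 0 R" and R: "1 < R" and w: "norm w < 1"
  shows "norm (H w) \<le> 1 / (1 - norm w) * integral {0..1} (\<lambda>t. norm (H (cis (2 * pi * t))))"
proof -
  have cb: "cball 0 1 \<subseteq> ball (0::complex) R" using R by auto
  have hol: "H holomorphic_on cball 0 1" using H cb holomorphic_on_subset by blast
  have cis_eq: "exp (2 * of_real pi * \<i> * of_real t) = cis (2 * pi * t)" for t
    by (simp add: cis_conv_exp mult_ac)
  have "((\<lambda>u. H u / (u - w)) has_contour_integral (2 * of_real pi * \<i> * H w)) (circlepath 0 1)"
    using Cauchy_integral_circlepath_simple[OF hol] w by simp
  then have "contour_integral (circlepath 0 1) (\<lambda>u. H u / (u - w)) = 2 * of_real pi * \<i> * H w"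
    by (rule contour_integral_unique)
  then have eq: "integral {0..1} (\<lambda>t. H (cis (2*pi*t)) / (cis (2*pi*t) - w) * (2 * pi * \<i> * cis (2*pi*t)))
      = 2 * of_real pi * \<i> * H w"
    unfolding contour_integral_integral vector_derivative_circlepath
    by (simp add: circlepath cis_eq)
  have cH: "continuous_on {0..1} (\<lambda>t. H (cis (2*pi*t)))"
    by (rule continuous_on_compose2[OF holomorphic_on_imp_continuous_on[OF hol]]) (auto intro!: continuous_intros)
  have ne: "cis x - w \<noteq> 0" for x using w by (metis eq_iff_diff_eq_0 less_irrefl norm_cis)
  have "norm (2 * of_real pi * \<i> * H w) \<le>
     integral {0..1} (\<lambda>t. 2 * pi / (1 - norm w) * norm (H (cis (2*pi*t))))"
    unfolding eq[symmetric]
  proof (rule integral_norm_bound_integral)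
    show "(\<lambda>t. H (cis (2*pi*t)) / (cis (2*pi*t) - w) * (2 * pi * \<i> * cis (2*pi*t))) integrable_on {0..1}"
      by (intro integrable_continuous_real continuous_intros cH) (use ne in auto)
    show "(\<lambda>t. 2 * pi / (1 - norm w) * norm (H (cis (2*pi*t)))) integrable_on {0..1}"
      by (intro integrable_continuous_real continuous_intros cH)
    fix t :: real
    have "1 - norm w \<le> norm (cis (2*pi*t) - w)"
      by (metis norm_cis norm_triangle_ineq2)
    then have "norm (H (cis (2*pi*t))) / norm (cis (2*pi*t) - w) \<le> norm (H (cis (2*pi*t))) / (1 - norm w)"
      using w by (intro divide_left_mono) (auto intro!: mult_pos_pos simp: ne)
    then show "norm (H (cis (2*pi*t)) / (cis (2*pi*t) - w) * (2 * pi * \<i> * cis (2*pi*t)))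
         \<le> 2 * pi / (1 - norm w) * norm (H (cis (2*pi*t)))"
      using mult_left_mono[where c = "2*pi"] by (fastforce simp: norm_mult norm_divide mult_ac)
  qed
  also have "\<dots> = 2 * pi * (1 / (1 - norm w) * integral {0..1} (\<lambda>t. norm (H (cis (2*pi*t)))))"
    by simp
  finally have "2 * pi * norm (H w) \<le> \<dots>" by (simp add: norm_mult)
  then show ?thesis by (subst (asm) mult_le_cancel_left_pos) auto
qed

text \<open>
  A zero-free \<open>F\<close> is an exponential, so a branch of \<open>F\<close> to the power \<open>p\<close> is holomorphic and the previous
  bound applies to it. Zeros on the unit circle are allowed; the bound is first proved on
  circles of radius \<open>r < 1\<close>.
\<close>

lemma zero_free_powr_circle_bound:
  assumes F: "F holomorphic_on UNIV" and nz: "\<And>z. z \<in> ball 0 1 \<Longrightarrow> F z \<noteq> 0"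
    and w: "norm w < 1" and p: "0 < p"
  shows "norm (F w) powr p \<le> 1 / (1 - norm w) * integral {0..1} (\<lambda>t. norm (F (cis (2 * pi * t))) powr p)"
proof -
  have contF: "continuous_on S F" for S
    using F holomorphic_on_imp_continuous_on continuous_on_subset by blast
  define \<Phi> where "\<Phi> r = norm (F (of_real r * w)) powr p
      - 1 / (1 - norm w) * integral {0..1} (\<lambda>t. norm (F (of_real r * cis (2 * pi * t))) powr p)" for r :: real
  have nonpos: "\<Phi> r \<le> 0" if r: "r \<in> {0<..<1}" for r
  proof -
    define G where "G z = F (of_real r * z)" for z
    have G: "G holomorphic_on ball 0 (1/r)"
      unfolding G_def using F
      by (intro holomorphic_on_compose_gen[OF _ F, unfolded o_def] holomorphic_intros) auto
    moreover have "G z \<noteq> 0" if "z \<in> ball 0 (1/r)" for z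
      unfolding G_def by (rule nz) (use that r in \<open>auto simp: norm_mult field_simps\<close>)
    ultimately obtain g where g: "g holomorphic_on ball 0 (1/r)" "\<And>z. z \<in> ball 0 (1/r) \<Longrightarrow> G z = exp (g z)"
      using contractible_imp_holomorphic_log[OF G convex_imp_contractible[OF convex_ball]] by metis
    define H where "H z = exp (of_real p * g z)" for z
    have nH: "norm (H z) = norm (G z) powr p" if "z \<in> ball 0 (1/r)" for z
      using g(2)[OF that] by (simp add: H_def exp_powr_real norm_exp_eq_Re mult.commute)
    have R: "1 < 1 / r" using r by simp
    have "H holomorphic_on ball 0 (1/r)" unfolding H_def by (intro holomorphic_intros g)
    from holomorphic_circle_bound[OF this R w]
    have "norm (G w) powr p \<le> 1 / (1 - norm w) * integral {0..1} (\<lambda>t. norm (G (cis (2*pi*t))) powr p)"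
      using R w by (subst (asm) (1 2) nH) (auto simp del: less_divide_eq_1_pos)
    then show ?thesis by (simp add: \<Phi>_def G_def)
  qed
  have "continuous_on {0..1} \<Phi>"
    unfolding \<Phi>_def
  proof (intro continuous_on_diff continuous_on_powr' continuous_on_mult continuous_on_const continuous_on_norm)
    have "continuous_on ({0..1} \<times> cbox 0 1) (\<lambda>(r::real, t). norm (F (of_real r * cis (2 * pi * t))) powr p)"
      unfolding split_beta
      by (intro continuous_on_powr' continuous_intros continuous_on_compose2[OF contF[of UNIV]]) (use p in auto)
    from integral_continuous_on_param[OF this]
    show "continuous_on {0..1} (\<lambda>r::real. integral {0..1} (\<lambda>t. norm (F (of_real r * cis (2 * pi * t))) powr p))"
      by simp
  qed (use p in \<open>auto intro!: continuous_on_compose2[OF contF[of UNIV]] continuous_intros\<close>)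
  then have "continuous_on (closure {0<..<1}) \<Phi>" by simp
  then have "\<Phi> 1 \<le> 0"
    by (rule continuous_le_on_closure) (simp_all add: nonpos)
  then show ?thesis by (simp add: \<Phi>_def)
qed

lemma blaschke_norm:
  fixes a z :: complex
  shows "(norm (1 - cnj a * z))\<^sup>2 - (norm (z - a))\<^sup>2 = (1 - (norm a)\<^sup>2) * (1 - (norm z)\<^sup>2)"
  by (simp only: cmod_power2) (simp add: power2_eq_square algebra_simps)

text \<open>
  Replacing a factor \<open>z - a\<close> with \<open>norm a < 1\<close> by the Blaschke numerator \<open>1 - cnj a * z\<close> keeps the
  modulus on the unit circle and does not decrease it inside. Doing this for the finitely many
  zeros in the disc leaves a zero-free function.
\<close>

theorem entire_powr_circle_bound:
  assumes F: "F holomorphic_on UNIV" and w: "norm w < 1" and p: "0 < p"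
  shows "norm (F w) powr p \<le> 1 / (1 - norm w) * integral {0..1} (\<lambda>t. norm (F (cis (2 * pi * t))) powr p)"
proof (cases "F constant_on UNIV")
  case True
  then obtain c where c: "F z = c" for z by (auto simp: constant_on_def)
  have "1 \<le> 1 / (1 - norm w)" using w by simp
  then have "1 * norm c powr p \<le> 1 / (1 - norm w) * norm c powr p" by (intro mult_right_mono) auto
  then show ?thesis by (simp add: c)
next
  case False
  have "finite {z \<in> cball 0 1. F z = 0}"
    by (rule holomorphic_compact_finite_zeros[OF F]) (use False in auto)
  then have "finite {z \<in> ball 0 1. F z = 0}" by (rule rev_finite_subset) auto
  then show ?thesis using F
  proof (induction "card {z \<in> ball 0 1. F z = 0}" arbitrary: F)
    case 0
    show ?case by (rule zero_free_powr_circle_bound) (use 0 w p in auto)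
  next
    case (Suc n)
    from Suc.hyps(2) have "{z \<in> ball 0 1. F z = 0} \<noteq> {}" by (metis card.empty nat.distinct(1))
    then obtain a where a: "norm a < 1" "F a = 0" by auto
    have "\<not> F constant_on UNIV"
    proof
      assume "F constant_on UNIV"
      then have "{z \<in> ball 0 1. F z = 0} = ball 0 1" using a by (auto simp: constant_on_def)
      with Suc.prems(1) have "finite (ball (0::complex) 1)" by simp
      then show False
        using finite_imp_not_open[of "ball (0::complex) 1"] by simp
    qed
    then obtain g r k where k: "0 < k" and r: "0 < r" and g: "g holomorphic_on ball a r"
       and Fg: "\<And>z. z \<in> ball a r \<Longrightarrow> F z = (z - a)^k * g z"
       and gnz: "\<And>z. z \<in> ball a r \<Longrightarrow> g z \<noteq> 0"
      using holomorphic_factor_zero_nonconstant[OF Suc.prems(2) open_UNIV connected_UNIV UNIV_I a(2)]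
      by metis
    define G where "G z = (if z \<in> ball a r then g z else F z / (z - a)^k)" for z
    have G1: "G holomorphic_on ball a r"
      using g by (rule holomorphic_transform) (auto simp: G_def)
    have "(\<lambda>z. F z / (z - a)^k) holomorphic_on - {a}"
      by (intro holomorphic_intros holomorphic_on_subset[OF Suc.prems(2)]) auto
    then have G2: "G holomorphic_on - {a}"
      by (rule holomorphic_transform) (auto simp: G_def Fg)
    have "G holomorphic_on (ball a r \<union> - {a})"
      by (rule holomorphic_on_Un[OF G1 G2]) auto
    moreover have "ball a r \<union> - {a} = UNIV" using r by auto
    ultimately have G: "G holomorphic_on UNIV" by simp
    have FG: "F z = (z - a)^k * G z" for z
      using r by (cases "z = a") (auto simp: G_def Fg)
    have Ga: "G a \<noteq> 0" using r gnz by (simp add: G_def)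
    define F2 where "F2 z = (1 - cnj a * z)^k * G z" for z
    have F2: "F2 holomorphic_on UNIV" unfolding F2_def by (intro holomorphic_intros G)
    have pos: "0 < 1 - (norm a)\<^sup>2" using a(1) by (simp add: abs_square_less_1)
    have bnz: "1 - cnj a * z \<noteq> 0" if "norm z < 1" for z
    proof -
      have "0 < (1 - (norm a)\<^sup>2) * (1 - (norm z)\<^sup>2)"
        using pos that by (intro mult_pos_pos) (auto simp: abs_square_less_1)
      then have "0 < (norm (1 - cnj a * z))\<^sup>2"
        using blaschke_norm[of a z] zero_le_power2[of "norm (z - a)"] by linarith
      then show ?thesis by auto
    qed
    have zeros: "{z \<in> ball 0 1. F2 z = 0} = {z \<in> ball 0 1. F z = 0} - {a}"
      using bnz Ga k by (auto simp: F2_def FG)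
    have card: "n = card {z \<in> ball 0 1. F2 z = 0}"
      unfolding zeros using Suc.hyps(2) Suc.prems(1) a
      by (subst card_Diff_singleton) auto
    have "norm (F2 w) powr p \<le> 1 / (1 - norm w) * integral {0..1} (\<lambda>t. norm (F2 (cis (2 * pi * t))) powr p)"
      by (rule Suc.hyps(1)[OF card _ F2]) (unfold zeros, rule finite_Diff[OF Suc.prems(1)])
    moreover have "norm (F w) \<le> norm (F2 w)"
    proof -
      have "(norm (w - a))\<^sup>2 \<le> (norm (1 - cnj a * w))\<^sup>2"
        using blaschke_norm[of a w] pos w
        by (smt (verit) abs_square_less_1 mult_nonneg_nonneg norm_ge_zero abs_of_nonneg)
      then have "norm (w - a) \<le> norm (1 - cnj a * w)" by (rule power2_le_imp_le) simp
      then show ?thesis by (simp add: FG F2_def norm_mult norm_power mult_right_mono power_mono)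
    qed
    moreover have "norm (F2 (cis t)) = norm (F (cis t))" for t
    proof -
      have "(norm (cis t - a))\<^sup>2 = (norm (1 - cnj a * cis t))\<^sup>2"
        using blaschke_norm[of a "cis t"] by simp
      then have "norm (cis t - a) = norm (1 - cnj a * cis t)" by simp
      then show ?thesis by (simp add: FG F2_def norm_mult norm_power)
    qed
    ultimately show ?case using p by (auto intro: order_trans[OF powr_mono2])
  qed
qed

section \<open>Rotation invariance of the torus\<close>

lemma space_circle_measure [simp]: "space circle_measure = sphere 0 1"
  and sets_circle_measure [measurable_cong]: "sets circle_measure = sets (restrict_space borel (sphere 0 1))"
  by (simp_all add: circle_measure_def space_restrict_space)

lemma cis_measurable_circle: "(\<lambda>\<theta>. cis (2 * pi * \<theta>)) \<in> borel \<rightarrow>\<^sub>M restrict_space borel (sphere 0 1)"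
proof (rule measurable_restrict_space2)
  show "(\<lambda>\<theta>. cis (2 * pi * \<theta>)) \<in> borel_measurable borel"
    by (intro borel_measurable_continuous_onI continuous_intros)
qed auto

lemma nn_integral_circle_measure:
  assumes "f \<in> borel_measurable (restrict_space borel (sphere 0 1))"
  shows "(\<integral>\<^sup>+z. f z \<partial>circle_measure) = (\<integral>\<^sup>+\<theta>. f (cis (2 * pi * \<theta>)) * indicator {0..1} \<theta> \<partial>lborel)"
proof -
  have [measurable]: "(\<lambda>\<theta>. cis (2 * pi * \<theta>)) \<in> borel \<rightarrow>\<^sub>M restrict_space borel (sphere 0 1)"
    by (rule cis_measurable_circle)
  note [measurable] = assms
  have "(\<integral>\<^sup>+z. f z \<partial>circle_measure) = (\<integral>\<^sup>+\<theta>. f (cis (2 * pi * \<theta>)) \<partial>uniform_measure lborel {0..1::real})"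
    unfolding circle_measure_def by (subst nn_integral_distr) auto
  also have "\<dots> = (\<integral>\<^sup>+\<theta>. f (cis (2 * pi * \<theta>)) * indicator {0..1} \<theta> \<partial>lborel)"
    by (subst nn_integral_uniform_measure) (auto simp: one_ennreal_def[symmetric] divide_ennreal_def)
  finally show ?thesis .
qed

lemma prob_space_circle_measure: "prob_space circle_measure"
  unfolding circle_measure_def
proof (rule prob_space.prob_space_distr)
  show "prob_space (uniform_measure lborel {0..1::real})"
    by (rule prob_space_uniform_measure) auto
  show "(\<lambda>\<theta>. cis (2 * pi * \<theta>)) \<in> uniform_measure lborel {0..1} \<rightarrow>\<^sub>M restrict_space borel (sphere 0 1)"
    using cis_measurable_circle by (subst measurable_cong_sets[of _ borel, OF _ refl]) auto
qed

text \<open>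
  The rotation by \<open>b\<close> cuts the period into two pieces and exchanges them.
\<close>

lemma nn_integral_periodic_shift:
  fixes g :: "real \<Rightarrow> ennreal"
  assumes [measurable]: "g \<in> borel_measurable borel" and per: "\<And>x. g (x + 1) = g x"
    and b: "0 \<le> b" "b \<le> 1"
  shows "(\<integral>\<^sup>+x. g (x + b) * indicator {0..1} x \<partial>lborel) = (\<integral>\<^sup>+x. g x * indicator {0..1} x \<partial>lborel)"
proof -
  have shift: "(\<integral>\<^sup>+x. h x \<partial>lborel) = (\<integral>\<^sup>+x. h (x + c) \<partial>lborel)"
    if [measurable]: "h \<in> borel_measurable borel" for h :: "real \<Rightarrow> ennreal" and c
    using nn_integral_real_affine[of h 1 c] by (simp add: add.commute)
  have split: "(\<integral>\<^sup>+x. h x * indicator {0..1} x \<partial>lborel)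
     = (\<integral>\<^sup>+x. h x * indicator {0..<c} x \<partial>lborel) + (\<integral>\<^sup>+x. h x * indicator {c..<1} x \<partial>lborel)"
    if [measurable]: "h \<in> borel_measurable borel" and c: "0 \<le> c" "c \<le> 1" for h :: "real \<Rightarrow> ennreal" and c
  proof -
    have "(\<integral>\<^sup>+x. h x * indicator {0..1} x \<partial>lborel)
       = (\<integral>\<^sup>+x. h x * indicator {0..<c} x + h x * indicator {c..<1} x \<partial>lborel)"
      by (rule nn_integral_cong_AE, rule AE_mp[OF AE_lborel_singleton[of 1]])
         (use c in \<open>auto simp: indicator_def\<close>)
    then show ?thesis by (simp add: nn_integral_add)
  qed
  have "(\<integral>\<^sup>+x. g (x + b) * indicator {0..1} x \<partial>lborel)
      = (\<integral>\<^sup>+x. g (x + b) * indicator {0..<1-b} x \<partial>lborel) + (\<integral>\<^sup>+x. g (x + b) * indicator {1-b..<1} x \<partial>lborel)"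
    by (rule split) (use b in auto)
  also have "(\<integral>\<^sup>+x. g (x + b) * indicator {0..<1-b} x \<partial>lborel) = (\<integral>\<^sup>+x. g x * indicator {b..<1} x \<partial>lborel)"
    by (subst shift[where c = "-b"]) (auto intro!: nn_integral_cong simp: indicator_def)
  also have "(\<integral>\<^sup>+x. g (x + b) * indicator {1-b..<1} x \<partial>lborel) = (\<integral>\<^sup>+x. g x * indicator {0..<b} x \<partial>lborel)"
    by (subst shift[where c = "1-b"]) (auto intro!: nn_integral_cong simp: indicator_def per)
  also have "(\<integral>\<^sup>+x. g x * indicator {b..<1} x \<partial>lborel) + (\<integral>\<^sup>+x. g x * indicator {0..<b} x \<partial>lborel)
     = (\<integral>\<^sup>+x. g x * indicator {0..1} x \<partial>lborel)"
    using split[of g b] b by (simp add: add.commute)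
  finally show ?thesis .
qed

lemma circle_rotation:
  assumes u: "norm u = 1"
  shows "distr circle_measure circle_measure (\<lambda>z. z * u) = circle_measure"
proof -
  obtain t where "0 \<le> t" "t < 2 * pi" and t: "u = cis t"
    using complex_unit_circle[of u] sincos_total_2pi[of "Re u" "Im u"] u
    by (metis cis.ctr cmod_power2 complex.collapse power_one sincos_total_2pi)
  define b where "b = t / (2 * pi)"
  have b: "0 \<le> b" "b \<le> 1" and u_eq: "u = cis (2 * pi * b)"
    using \<open>0 \<le> t\<close> \<open>t < 2 * pi\<close> by (simp_all add: b_def t)
  have mu [measurable]: "(\<lambda>z. z * u) \<in> circle_measure \<rightarrow>\<^sub>M circle_measure"
  proof -
    have "(\<lambda>z. z * u) \<in> restrict_space borel (sphere 0 1) \<rightarrow>\<^sub>M restrict_space borel (sphere 0 1)"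
      by (rule measurable_restrict_space3) (auto simp: norm_mult u)
    then show ?thesis by (simp add: measurable_cong_sets[OF sets_circle_measure sets_circle_measure])
  qed
  show ?thesis
  proof (rule measure_eqI)
    fix A assume "A \<in> sets (distr circle_measure circle_measure (\<lambda>z. z * u))"
    then have A [measurable]: "A \<in> sets circle_measure" by simp
    then have A': "A \<in> sets (restrict_space borel (sphere 0 1))" by (simp add: sets_circle_measure)
    then have A2: "A \<in> sets borel" by (auto simp: sets_restrict_space)
    define g where "g x = (indicator A (cis (2 * pi * x)) :: ennreal)" for x
    have [measurable]: "(\<lambda>x. cis (2 * pi * x)) \<in> borel_measurable borel"
      by (intro borel_measurable_continuous_onI continuous_intros)
    have g [measurable]: "g \<in> borel_measurable borel" unfolding g_def using A2 by measurable
    have "emeasure (distr circle_measure circle_measure (\<lambda>z. z * u)) A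
        = (\<integral>\<^sup>+z. indicator A z \<partial>distr circle_measure circle_measure (\<lambda>z. z * u))" by simp
    also have "\<dots> = (\<integral>\<^sup>+z. indicator A (z * u) \<partial>circle_measure)"
      by (subst nn_integral_distr) auto
    also have "\<dots> = (\<integral>\<^sup>+x. g (x + b) * indicator {0..1} x \<partial>lborel)"
    proof (subst nn_integral_circle_measure)
      have "(\<lambda>z. indicator A (z * u) :: ennreal) \<in> borel_measurable circle_measure" by measurable
      then show "(\<lambda>z. indicator A (z * u) :: ennreal) \<in> borel_measurable (restrict_space borel (sphere 0 1))"
        by (simp add: measurable_cong_sets[OF sets_circle_measure refl])
      show "(\<integral>\<^sup>+\<theta>. indicator A (cis (2 * pi * \<theta>) * u) * indicator {0..1} \<theta> \<partial>lborel)
         = (\<integral>\<^sup>+x. g (x + b) * indicator {0..1} x \<partial>lborel)"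
        by (intro nn_integral_cong) (simp add: g_def u_eq cis_mult ring_distribs)
    qed
    also have "\<dots> = (\<integral>\<^sup>+x. g x * indicator {0..1} x \<partial>lborel)"
    proof (rule nn_integral_periodic_shift[OF g _ b])
      fix x :: real
      have "cis (2 * pi * (x + 1)) = cis (2 * pi * x) * cis (2 * pi)"
        by (simp add: ring_distribs flip: cis_mult)
      then show "g (x + 1) = g x" by (simp add: g_def)
    qed
    also have "\<dots> = (\<integral>\<^sup>+z. indicator A z \<partial>circle_measure)"
      using A' by (subst nn_integral_circle_measure) (auto simp: g_def)
    also have "\<dots> = emeasure circle_measure A" by simp
    finally show "emeasure (distr circle_measure circle_measure (\<lambda>z. z * u)) A = emeasure circle_measure A" .
  qed simp
qed

lemma product_prob_space_circle: "product_prob_space (\<lambda>_::nat. circle_measure)"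
  by (intro product_prob_spaceI prob_space_circle_measure)

lemma prob_space_torus: "prob_space torus"
  unfolding torus_def by (intro prob_space_PiM prob_space_circle_measure)

lemma space_torus: "space torus = {\<omega>. \<forall>j. norm (\<omega> j) = 1}"
  by (auto simp: torus_def space_PiM PiE_iff)

lemma torus_component_measurable [measurable]: "(\<lambda>\<omega>. \<omega> j) \<in> borel_measurable torus"
proof -
  have 1: "(\<lambda>\<omega>. \<omega> j) \<in> torus \<rightarrow>\<^sub>M circle_measure"
    unfolding torus_def by (rule measurable_component_singleton) simp
  have "(\<lambda>z. z) \<in> borel_measurable (restrict_space borel (sphere (0::complex) 1))"
    by (rule measurable_restrict_space1) simp
  then have "(\<lambda>z. z) \<in> borel_measurable circle_measure"
    by (simp add: measurable_cong_sets[OF sets_circle_measure refl])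
  from measurable_compose[OF 1 this] show ?thesis .
qed

text \<open>
  Coordinatewise rotations fix the measure of cylinder sets, which determine the product measure.
\<close>

lemma torus_rotation:
  assumes u: "\<And>j. norm (u j) = 1"
  shows "distr torus torus (\<lambda>\<omega> j. \<omega> j * u j) = torus"
    and torus_rotation_measurable: "(\<lambda>\<omega> j. \<omega> j * u j) \<in> torus \<rightarrow>\<^sub>M torus"
proof -
  interpret product_prob_space "\<lambda>_::nat. circle_measure" UNIV by (rule product_prob_space_circle)
  have mu [measurable]: "(\<lambda>z. z * u j) \<in> circle_measure \<rightarrow>\<^sub>M circle_measure" for j
  proof -
    have "(\<lambda>z. z * u j) \<in> restrict_space borel (sphere 0 1) \<rightarrow>\<^sub>M restrict_space borel (sphere 0 1)"
      by (rule measurable_restrict_space3) (auto simp: norm_mult u)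
    then show ?thesis by (simp add: measurable_cong_sets[OF sets_circle_measure sets_circle_measure])
  qed
  show m: "(\<lambda>\<omega> j. \<omega> j * u j) \<in> torus \<rightarrow>\<^sub>M torus"
    unfolding torus_def
  proof (rule measurable_PiM_single')
    show "(\<lambda>\<omega>. \<omega> i * u i) \<in> Pi\<^sub>M UNIV (\<lambda>j. circle_measure) \<rightarrow>\<^sub>M circle_measure" for i
      using measurable_compose[OF measurable_component_singleton[of i UNIV "\<lambda>_. circle_measure"], OF _ mu[of i]]
      by simp
  qed (auto simp: space_PiM PiE_iff norm_mult u)
  show "distr torus torus (\<lambda>\<omega> j. \<omega> j * u j) = torus"
    unfolding torus_def
  proof (rule PiM_eq)
    fix J :: "nat set" and F :: "nat \<Rightarrow> complex set"
    assume J: "finite J" "J \<subseteq> UNIV" and F: "\<And>j. j \<in> J \<Longrightarrow> F j \<in> sets circle_measure"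
    let ?T = "Pi\<^sub>M UNIV (\<lambda>_::nat. circle_measure)"
    let ?F = "\<lambda>j. (\<lambda>z. z * u j) -` F j \<inter> space circle_measure"
    have F': "?F j \<in> sets circle_measure" if "j \<in> J" for j
      using measurable_sets[OF mu F[OF that]] .
    have "emeasure (distr ?T ?T (\<lambda>\<omega> j. \<omega> j * u j)) (prod_emb UNIV (\<lambda>_. circle_measure) J (Pi\<^sub>E J F))
       = emeasure ?T ((\<lambda>\<omega> j. \<omega> j * u j) -` prod_emb UNIV (\<lambda>_. circle_measure) J (Pi\<^sub>E J F) \<inter> space ?T)"
      using m J F unfolding torus_def by (intro emeasure_distr sets_PiM_I) auto
    also have "(\<lambda>\<omega> j. \<omega> j * u j) -` prod_emb UNIV (\<lambda>_. circle_measure) J (Pi\<^sub>E J F) \<inter> space ?T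
       = prod_emb UNIV (\<lambda>_. circle_measure) J (Pi\<^sub>E J ?F)"
      by (auto simp: prod_emb_def space_PiM PiE_iff norm_mult u)
    also have "emeasure ?T \<dots> = (\<Prod>j\<in>J. emeasure circle_measure (?F j))"
      using J F' by (intro emeasure_PiM_emb) auto
    also have "\<dots> = (\<Prod>j\<in>J. emeasure circle_measure (F j))"
    proof (rule prod.cong)
      fix j assume "j \<in> J"
      then show "emeasure circle_measure (?F j) = emeasure circle_measure (F j)"
        using emeasure_distr[OF mu F, of j] by (simp add: circle_rotation[OF u])
    qed simp
    finally show "emeasure (distr ?T ?T (\<lambda>\<omega> j. \<omega> j * u j)) (prod_emb UNIV (\<lambda>_. circle_measure) J (Pi\<^sub>E J F))
       = (\<Prod>j\<in>J. emeasure circle_measure (F j))" .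
  qed simp
qed

lemma nn_integral_torus_rotation:
  assumes u: "\<And>j. norm (u j) = 1" and f: "f \<in> borel_measurable torus"
  shows "(\<integral>\<^sup>+\<omega>. f (\<lambda>j. \<omega> j * u j) \<partial>torus) = (\<integral>\<^sup>+\<omega>. f \<omega> \<partial>torus)"
proof -
  have "(\<integral>\<^sup>+\<omega>. f \<omega> \<partial>torus) = (\<integral>\<^sup>+\<omega>. f \<omega> \<partial>distr torus torus (\<lambda>\<omega> j. \<omega> j * u j))"
    by (simp add: torus_rotation(1)[OF u])
  also have "\<dots> = (\<integral>\<^sup>+\<omega>. f (\<lambda>j. \<omega> j * u j) \<partial>torus)"
    by (rule nn_integral_distr) (use torus_rotation(2)[OF u] f in auto)
  finally show ?thesis by simp
qed

section \<open>Primes and completely multiplicative functions\<close>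

lemma infinite_primes_nat: "infinite {q::nat. prime q}"
  using primes_infinite .

lemma prime_nth_prime [simp]: "prime (nth_prime j)"
  unfolding nth_prime_def using enumerate_in_set[OF infinite_primes_nat] by auto

lemma strict_mono_nth_prime: "strict_mono nth_prime"
  unfolding nth_prime_def strict_mono_def
  by (intro allI impI enumerate_mono[OF _ infinite_primes_nat])

lemma nth_prime_surj: "prime q \<Longrightarrow> \<exists>j. nth_prime j = q"
  unfolding nth_prime_def using enumerate_Ex[of "{q. prime q}" q] by (auto simp: infinite_primes_nat)

lemma nth_prime_ge: "j + 2 \<le> nth_prime j"
proof (induction j)
  case 0
  show ?case using prime_ge_2_nat[OF prime_nth_prime[of 0]] by simp
next
  case (Suc j)
  have "nth_prime j < nth_prime (Suc j)" using strict_mono_nth_prime by (auto simp: strict_mono_def)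
  with Suc show ?case by simp
qed

lemma nth_prime_pos: "0 < nth_prime j" using nth_prime_ge[of j] by simp

lemma nth_prime_dvd_less: "0 < n \<Longrightarrow> nth_prime j dvd n \<Longrightarrow> j < n"
  using dvd_imp_le[of "nth_prime j" n] nth_prime_ge[of j] by simp

lemma finite_nth_prime_dvd: "0 < n \<Longrightarrow> finite {j. nth_prime j dvd n}"
  by (rule finite_subset[of _ "{..<n}"]) (auto dest: nth_prime_dvd_less)

lemma mult_ext_eq_prod:
  assumes "0 < n" "\<And>j. nth_prime j dvd n \<Longrightarrow> j < J"
  shows "mult_ext v n = (\<Prod>j<J. v j ^ multiplicity (nth_prime j) n)"
  unfolding mult_ext_def
  by (rule prod.mono_neutral_left) (use assms in \<open>auto simp: not_dvd_imp_multiplicity_0\<close>)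

lemma mult_ext_mult: "mult_ext (\<lambda>j. v j * w j) n = mult_ext v n * mult_ext w n"
  by (simp add: mult_ext_def power_mult_distrib prod.distrib)

lemma norm_mult_ext: "norm (mult_ext v n) = (\<Prod>j\<in>{j. nth_prime j dvd n}. norm (v j) ^ multiplicity (nth_prime j) n)"
  by (simp add: mult_ext_def prod_norm[symmetric] norm_power)

lemma norm_mult_ext_torus: "\<omega> \<in> space torus \<Longrightarrow> norm (mult_ext \<omega> n) = 1"
  by (simp add: norm_mult_ext space_torus)

lemma mult_ext_measurable [measurable]: "(\<lambda>\<omega>. mult_ext \<omega> n) \<in> borel_measurable torus"
  unfolding mult_ext_def
  by (intro borel_measurable_prod borel_measurable_power torus_component_measurable)

lemma prime_factors_eq_nth_prime:
  assumes "0 < (n::nat)" shows "prime_factors n = nth_prime ` {j. nth_prime j dvd n}"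
proof (intro equalityI subsetI)
  fix q assume "q \<in> prime_factors n"
  then have q: "prime q" "q dvd n" by auto
  then obtain j where "nth_prime j = q" using nth_prime_surj by metis
  with q show "q \<in> nth_prime ` {j. nth_prime j dvd n}" by blast
next
  fix q assume "q \<in> nth_prime ` {j. nth_prime j dvd n}"
  then show "q \<in> prime_factors n" using assms by (auto simp: prime_factors_dvd)
qed

lemma nat_eq_prod_nth_prime:
  assumes "0 < (n::nat)"
  shows "n = (\<Prod>j\<in>{j. nth_prime j dvd n}. nth_prime j ^ multiplicity (nth_prime j) n)"
proof -
  have "n = (\<Prod>q\<in>prime_factors n. q ^ multiplicity q n)"
    using prime_factorization_nat[OF assms] .
  also have "\<dots> = (\<Prod>j\<in>{j. nth_prime j dvd n}. nth_prime j ^ multiplicity (nth_prime j) n)"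
    unfolding prime_factors_eq_nth_prime[OF assms]
    by (rule prod.reindex_cong[OF _ refl refl])
       (use strict_mono_nth_prime in \<open>auto simp: inj_on_def strict_mono_eq\<close>)
  finally show ?thesis .
qed

definition prime_powr :: "complex \<Rightarrow> nat \<Rightarrow> complex" where
  "prime_powr s j = of_nat (nth_prime j) powr (- s)"

lemma of_nat_powr_eq_exp: "0 < n \<Longrightarrow> (of_nat n :: complex) powr s = exp (s * of_real (ln (real n)))"
  by (simp add: powr_def Ln_of_nat)

lemma mult_ext_prime_powr:
  assumes n: "0 < n" shows "mult_ext (prime_powr s) n = of_nat n powr (- s)"
proof -
  let ?A = "{j. nth_prime j dvd n}"
  have "real n = (\<Prod>j\<in>?A. real (nth_prime j) ^ multiplicity (nth_prime j) n)"
    by (subst nat_eq_prod_nth_prime[OF n]) simp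
  then have "ln (real n) = (\<Sum>j\<in>?A. ln (real (nth_prime j) ^ multiplicity (nth_prime j) n))"
    by (simp add: ln_prod[OF finite_nth_prime_dvd[OF n]] nth_prime_pos)
  also have "\<dots> = (\<Sum>j\<in>?A. real (multiplicity (nth_prime j) n) * ln (real (nth_prime j)))"
    by (simp add: ln_realpow nth_prime_pos)
  finally have ln: "ln (real n) = \<dots>" .
  show ?thesis
    unfolding mult_ext_def prime_powr_def of_nat_powr_eq_exp[OF n] of_nat_powr_eq_exp[OF nth_prime_pos]
    by (simp add: ln exp_sum[OF finite_nth_prime_dvd[OF n], symmetric] exp_of_nat_mult[symmetric]
        sum_distrib_left mult_ac)
qed

lemma norm_prime_powr: "norm (prime_powr s j) = real (nth_prime j) powr (- Re s)"
  by (simp add: prime_powr_def norm_powr_real_powr)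

section \<open>A substitute for the triangle inequality\<close>

text \<open>
  The substitute for the triangle inequality: compare \<open>y\<close> with \<open>d * x\<close>.
\<close>

lemma powr_add_le:
  fixes x y d p :: real
  assumes "0 \<le> x" "0 \<le> y" "0 < d" "0 < p"
  shows "(x + y) powr p \<le> (1 + d) powr p * x powr p + (1 + 1/d) powr p * y powr p"
proof (cases "y \<le> d * x")
  case True
  then have "(x + y) powr p \<le> ((1 + d) * x) powr p"
    using assms by (intro powr_mono2) (auto simp: algebra_simps)
  also have "\<dots> = (1 + d) powr p * x powr p" using assms by (simp add: powr_mult)
  finally show ?thesis using assms by (smt (verit) mult_nonneg_nonneg powr_ge_zero)
next
  case False
  then have "x \<le> y / d" using assms by (simp add: field_simps)
  then have "(x + y) powr p \<le> ((1 + 1/d) * y) powr p"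
    using assms by (intro powr_mono2) (auto simp: algebra_simps)
  also have "\<dots> = (1 + 1/d) powr p * y powr p" using assms by (simp add: powr_mult)
  finally show ?thesis using assms by (smt (verit) mult_nonneg_nonneg powr_ge_zero)
qed

lemma eventually_powr_factor_close:
  fixes p B e :: real
  assumes "0 < p" "0 \<le> B" "0 < e"
  shows "\<exists>d>0. ((1 + d) powr p - 1) * B < e"
proof -
  have "((\<lambda>d. ((1 + d) powr p - 1) * B) \<longlongrightarrow> ((1 + 0) powr p - 1) * B) (at_right (0::real))"
    by (intro tendsto_intros) auto
  then have "\<forall>\<^sub>F d in at_right 0. ((1 + d) powr p - 1) * B < e"
    using assms by (intro order_tendstoD) auto
  moreover have "\<forall>\<^sub>F d in at_right (0::real). 0 < d" by (simp add: eventually_at_right_less)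
  ultimately have "\<forall>\<^sub>F d in at_right (0::real). 0 < d \<and> ((1 + d) powr p - 1) * B < e"
    by eventually_elim auto
  then show ?thesis
    using eventually_happens'[OF trivial_limit_at_right_real] by blast
qed

text \<open>
  For \<open>x\<close>, \<open>y\<close>, \<open>e\<close> the \<open>p\<close>-th powers of the norms of two vectors and of their difference, this is
  uniform continuity of the norm on bounded sets.
\<close>

lemma quasi_norm_powers_merge:
  fixes x y e :: "'a \<Rightarrow> real"
  assumes p: "0 < p" and y: "\<And>i. 0 \<le> y i \<and> y i \<le> B" and e: "(e \<longlongrightarrow> 0) F"
    and xy: "\<And>i d. 0 < d \<Longrightarrow> x i \<le> (1 + d) powr p * y i + (1 + 1/d) powr p * e i"
    and yx: "\<And>i d. 0 < d \<Longrightarrow> y i \<le> (1 + d) powr p * x i + (1 + 1/d) powr p * e i"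
  shows "((\<lambda>i. x i - y i) \<longlongrightarrow> 0) F"
proof (rule tendstoI)
  fix \<epsilon> :: real assume "0 < \<epsilon>"
  show "\<forall>\<^sub>F i in F. dist (x i - y i) 0 < \<epsilon>"
  proof (cases "F = bot \<or> (\<forall>i. False)")
    case False
    then have B: "0 \<le> B" using y order_trans by blast
    define B' where "B' = 2 powr p * B + 2 powr p * 1"
    have B': "0 \<le> B'" unfolding B'_def using B by simp
    obtain d where d: "0 < d" "((1 + d) powr p - 1) * (B + B') < \<epsilon> / 2"
      using eventually_powr_factor_close[OF p, of "B + B'" "\<epsilon>/2"] B B' \<open>0 < \<epsilon>\<close> by auto
    have "(1 + 0) powr p \<le> (1 + d) powr p" using d p by (intro powr_mono2) auto
    then have q: "0 \<le> (1 + d) powr p - 1" by simp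
    have "((\<lambda>i. (1 + 1/d) powr p * e i) \<longlongrightarrow> (1 + 1/d) powr p * 0) F" by (intro tendsto_intros e)
    then have "\<forall>\<^sub>F i in F. (1 + 1/d) powr p * e i < \<epsilon> / 2"
      using \<open>0 < \<epsilon>\<close> by (intro order_tendstoD) auto
    moreover have "\<forall>\<^sub>F i in F. e i < 1" using e by (intro order_tendstoD) auto
    ultimately show ?thesis
    proof eventually_elim
      case (elim i)
      have "x i \<le> 2 powr p * y i + 2 powr p * e i" using xy[of 1 i] by simp
      also have "\<dots> \<le> B'" unfolding B'_def using y[of i] elim by (intro add_mono mult_left_mono) auto
      finally have xB: "x i \<le> B'" .
      have "x i - y i \<le> ((1 + d) powr p - 1) * y i + (1 + 1/d) powr p * e i"
        using xy[OF d(1), of i] by (simp add: algebra_simps)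
      also have "((1 + d) powr p - 1) * y i \<le> ((1 + d) powr p - 1) * (B + B')"
        using q y[of i] B' by (intro mult_left_mono) auto
      finally have 1: "x i - y i < \<epsilon>" using elim d by linarith
      have "y i - x i \<le> ((1 + d) powr p - 1) * x i + (1 + 1/d) powr p * e i"
        using yx[OF d(1), of i] by (simp add: algebra_simps)
      also have "((1 + d) powr p - 1) * x i \<le> ((1 + d) powr p - 1) * (B + B')"
        using q xB B by (intro mult_left_mono) auto
      finally have 2: "y i - x i < \<epsilon>" using elim d by linarith
      from 1 2 show ?case by (simp add: dist_real_def abs_less_iff)
    qed
  qed auto
qed

section \<open>Dirichlet polynomials\<close>

text \<open>
  The Bohr lift: the polynomial in infinitely many variables with the coefficients \<open>a\<close>, the variable
  with index \<open>j\<close> standing for the \<open>j\<close>-th prime to the power \<open>- s\<close>.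
\<close>

definition bohr_lift :: "(nat \<Rightarrow> complex) \<Rightarrow> (nat \<Rightarrow> complex) \<Rightarrow> complex" where
  "bohr_lift a v = (\<Sum>n | a n \<noteq> 0. a n * mult_ext v n)"

text \<open>
  Multiplying the coefficients by a completely multiplicative function multiplies the variables of
  the Bohr lift; horizontal and vertical translations are the case of powers.
\<close>

definition twist :: "(nat \<Rightarrow> complex) \<Rightarrow> (nat \<Rightarrow> complex) \<Rightarrow> nat \<Rightarrow> complex" where
  "twist v a n = a n * mult_ext v n"

definition shift :: "complex \<Rightarrow> (nat \<Rightarrow> complex) \<Rightarrow> nat \<Rightarrow> complex" where
  "shift s a n = a n * of_nat n powr (- s)"

abbreviation torus_mean :: "real \<Rightarrow> ((nat \<Rightarrow> complex) \<Rightarrow> complex) \<Rightarrow> ennreal" where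
  "torus_mean p f \<equiv> \<integral>\<^sup>+\<omega>. ennreal (norm (f \<omega>) powr p) \<partial>torus"

text \<open>
  The \<open>p\<close>-th power of the norm, which is easier to handle than the norm as it is an integral.
\<close>

definition hmean :: "real \<Rightarrow> (nat \<Rightarrow> complex) \<Rightarrow> real" where
  "hmean p a = (LINT \<omega>|torus. norm (bohr_lift a \<omega>) powr p)"

lemma poly_norm_eq: "poly_norm p a = hmean p a powr (1 / p)"
  by (simp add: poly_norm_def hmean_def bohr_lift_def)

lemma dirichlet_polysD: "a \<in> dirichlet_polys \<Longrightarrow> finite {n. a n \<noteq> 0}" "a \<in> dirichlet_polys \<Longrightarrow> a 0 = 0"
  by (auto simp: dirichlet_polys_def)

lemma bohr_lift_superset:
  assumes "finite A" "{n. a n \<noteq> 0} \<subseteq> A"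
  shows "bohr_lift a v = (\<Sum>n\<in>A. a n * mult_ext v n)"
  unfolding bohr_lift_def by (rule sum.mono_neutral_left) (use assms in auto)

lemma dirichlet_polys_diff: "a \<in> dirichlet_polys \<Longrightarrow> b \<in> dirichlet_polys \<Longrightarrow> (\<lambda>n. a n - b n) \<in> dirichlet_polys"
  unfolding dirichlet_polys_def
  by (auto intro: finite_subset[of _ "{n. a n \<noteq> 0} \<union> {n. b n \<noteq> 0}"])

lemma dirichlet_polys_mult: "a \<in> dirichlet_polys \<Longrightarrow> (\<lambda>n. a n * c n) \<in> dirichlet_polys"
  unfolding dirichlet_polys_def by (auto intro: finite_subset[of _ "{n. a n \<noteq> 0}"])

lemma shift_polys: "a \<in> dirichlet_polys \<Longrightarrow> shift s a \<in> dirichlet_polys"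
  unfolding shift_def[abs_def] by (rule dirichlet_polys_mult)

lemma bohr_lift_add:
  assumes "a \<in> dirichlet_polys" "b \<in> dirichlet_polys"
  shows "bohr_lift (\<lambda>n. a n + b n) v = bohr_lift a v + bohr_lift b v"
proof -
  let ?A = "{n. a n \<noteq> 0} \<union> {n. b n \<noteq> 0}"
  have f: "finite ?A" using assms by (auto simp: dirichlet_polys_def)
  show ?thesis
    by (subst (1 2 3) bohr_lift_superset[OF f]) (auto simp: sum.distrib ring_distribs)
qed

lemma bohr_lift_diff:
  assumes "a \<in> dirichlet_polys" "b \<in> dirichlet_polys"
  shows "bohr_lift (\<lambda>n. a n - b n) v = bohr_lift a v - bohr_lift b v"
proof -
  let ?A = "{n. a n \<noteq> 0} \<union> {n. b n \<noteq> 0}"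
  have f: "finite ?A" using assms by (auto simp: dirichlet_polys_def)
  show ?thesis
    by (subst (1 2 3) bohr_lift_superset[OF f]) (auto simp: sum_subtractf ring_distribs)
qed

lemma bohr_lift_twist:
  assumes "a \<in> dirichlet_polys"
  shows "bohr_lift (twist v a) \<omega> = bohr_lift a (\<lambda>j. \<omega> j * v j)"
  by (subst bohr_lift_superset[of "{n. a n \<noteq> 0}"])
     (use assms in \<open>auto simp: bohr_lift_def twist_def mult_ext_mult mult_ac dirichlet_polys_def\<close>)

lemma shift_eq_twist:
  assumes "a \<in> dirichlet_polys" shows "shift s a = twist (prime_powr s) a"
proof
  fix n show "shift s a n = twist (prime_powr s) a n"
    using dirichlet_polysD(2)[OF assms]
    by (cases "n = 0") (auto simp: shift_def twist_def mult_ext_prime_powr)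
qed

lemma shift_shift: "shift s (shift t a) = shift (s + t) a"
  by (auto simp: shift_def fun_eq_iff powr_add[symmetric] mult_ac)

lemma shift_diff: "shift s (\<lambda>n. a n - b n) = (\<lambda>n. shift s a n - shift s b n)"
  by (auto simp: shift_def fun_eq_iff ring_distribs)

lemma bohr_lift_measurable [measurable]: "bohr_lift a \<in> borel_measurable torus"
  unfolding bohr_lift_def[abs_def]
  by (intro borel_measurable_sum borel_measurable_times mult_ext_measurable) auto

lemma norm_bohr_lift_le:
  assumes "\<omega> \<in> space torus"
  shows "norm (bohr_lift a \<omega>) \<le> (\<Sum>n | a n \<noteq> 0. norm (a n))"
  unfolding bohr_lift_def
  by (rule order_trans[OF norm_sum]) (simp add: norm_mult norm_mult_ext_torus[OF assms])

lemma hmean_integrable: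
  assumes "0 < p" shows "integrable torus (\<lambda>\<omega>. norm (bohr_lift a \<omega>) powr p)"
proof -
  interpret prob_space torus by (rule prob_space_torus)
  show ?thesis
  proof (rule integrable_const_bound[where B = "(\<Sum>n | a n \<noteq> 0. norm (a n)) powr p"])
    show "AE \<omega> in torus. norm (norm (bohr_lift a \<omega>) powr p) \<le> (\<Sum>n | a n \<noteq> 0. norm (a n)) powr p"
      by (rule AE_I2) (use assms norm_bohr_lift_le in \<open>auto intro!: powr_mono2\<close>)
  qed measurable
qed

lemma hmean_nonneg: "0 \<le> hmean p a"
  unfolding hmean_def by (rule integral_nonneg_AE) simp

lemma hmean_le:
  assumes "0 < p" shows "hmean p a \<le> (\<Sum>n | a n \<noteq> 0. norm (a n)) powr p"
proof -
  interpret prob_space torus by (rule prob_space_torus)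
  show ?thesis unfolding hmean_def
    by (rule integral_le_const[OF hmean_integrable[OF assms]])
       (rule AE_I2, use assms norm_bohr_lift_le in \<open>auto intro!: powr_mono2\<close>)
qed

lemma nn_integral_bohr_lift:
  assumes "0 < p" shows "torus_mean p (bohr_lift a) = ennreal (hmean p a)"
  unfolding hmean_def by (rule nn_integral_eq_integral[OF hmean_integrable[OF assms]]) simp

lemma hmean_add_le:
  assumes "0 < p" "0 < d" "a \<in> dirichlet_polys" "b \<in> dirichlet_polys"
  shows "hmean p (\<lambda>n. a n + b n) \<le> (1 + d) powr p * hmean p a + (1 + 1/d) powr p * hmean p b"
proof -
  have "hmean p (\<lambda>n. a n + b n) \<le> (LINT \<omega>|torus. (1 + d) powr p * norm (bohr_lift a \<omega>) powr p
      + (1 + 1/d) powr p * norm (bohr_lift b \<omega>) powr p)"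
    unfolding hmean_def
  proof (rule integral_mono)
    fix \<omega>
    have "norm (bohr_lift (\<lambda>n. a n + b n) \<omega>) powr p \<le> (norm (bohr_lift a \<omega>) + norm (bohr_lift b \<omega>)) powr p"
      using assms by (intro powr_mono2) (auto simp: bohr_lift_add norm_triangle_ineq)
    also have "\<dots> \<le> (1 + d) powr p * norm (bohr_lift a \<omega>) powr p + (1 + 1/d) powr p * norm (bohr_lift b \<omega>) powr p"
      using assms by (intro powr_add_le) auto
    finally show "norm (bohr_lift (\<lambda>n. a n + b n) \<omega>) powr p \<le> \<dots>" .
  qed (auto intro!: integrable_add integrable_mult_right hmean_integrable assms)
  also have "\<dots> = (1 + d) powr p * hmean p a + (1 + 1/d) powr p * hmean p b"
    unfolding hmean_def using assms by (simp add: hmean_integrable)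
  finally show ?thesis .
qed

lemma hmean_uminus: "hmean p (\<lambda>n. - a n) = hmean p a"
  by (simp add: hmean_def bohr_lift_def sum_negf)

lemma hmean_diff_commute: "hmean p (\<lambda>n. a n - b n) = hmean p (\<lambda>n. b n - a n)"
  using hmean_uminus[of p "\<lambda>n. a n - b n"] by simp

lemma hmean_diff_le:
  assumes "0 < p" "0 < d" "a \<in> dirichlet_polys" "b \<in> dirichlet_polys"
  shows "hmean p a \<le> (1 + d) powr p * hmean p b + (1 + 1/d) powr p * hmean p (\<lambda>n. a n - b n)"
  using hmean_add_le[OF assms(1,2,4) dirichlet_polys_diff[OF assms(3,4)]] by simp

lemma hmean_triangle:
  assumes "0 < p" "a \<in> dirichlet_polys" "b \<in> dirichlet_polys" "c \<in> dirichlet_polys"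
  shows "hmean p (\<lambda>n. a n - c n) \<le> 2 powr p * hmean p (\<lambda>n. a n - b n) + 2 powr p * hmean p (\<lambda>n. b n - c n)"
  using hmean_add_le[OF assms(1) zero_less_one dirichlet_polys_diff[OF assms(2,3)] dirichlet_polys_diff[OF assms(3,4)]]
  by simp

lemma hmean_merge:
  assumes p: "0 < p" and P: "\<And>i. P i \<in> dirichlet_polys" "\<And>i. Q i \<in> dirichlet_polys"
    and B: "\<And>i. hmean p (Q i) \<le> B" and e: "((\<lambda>i. hmean p (\<lambda>n. P i n - Q i n)) \<longlongrightarrow> 0) F"
  shows "((\<lambda>i. hmean p (P i) - hmean p (Q i)) \<longlongrightarrow> 0) F"
proof (rule quasi_norm_powers_merge[OF p _ e])
  show "0 \<le> hmean p (Q i) \<and> hmean p (Q i) \<le> B" for i using B hmean_nonneg by blast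
  fix i and d :: real assume d: "0 < d"
  show "hmean p (P i) \<le> (1 + d) powr p * hmean p (Q i) + (1 + 1/d) powr p * hmean p (\<lambda>n. P i n - Q i n)"
    by (rule hmean_diff_le[OF p d P])
  show "hmean p (Q i) \<le> (1 + d) powr p * hmean p (P i) + (1 + 1/d) powr p * hmean p (\<lambda>n. P i n - Q i n)"
    using hmean_diff_le[OF p d P(2) P(1), of i i] by (simp add: hmean_diff_commute[of p "P i"])
qed

lemma hmean_twist:
  assumes "a \<in> dirichlet_polys" "\<And>j. norm (v j) = 1" "0 < p"
  shows "hmean p (twist v a) = hmean p a"
proof -
  have "ennreal (hmean p (twist v a)) = torus_mean p (\<lambda>\<omega>. bohr_lift a (\<lambda>j. \<omega> j * v j))"
    by (simp add: nn_integral_bohr_lift[OF assms(3), symmetric] bohr_lift_twist assms(1))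
  also have "\<dots> = torus_mean p (bohr_lift a)"
    by (rule nn_integral_torus_rotation) (use assms in \<open>auto intro: measurable_compose\<close>)
  finally show ?thesis by (simp add: nn_integral_bohr_lift[OF assms(3)] hmean_nonneg)
qed

text \<open>
  A vertical translation is a rotation of the torus.
\<close>

lemma hmean_shift_Re:
  assumes "a \<in> dirichlet_polys" "0 < p"
  shows "hmean p (shift s a) = hmean p (shift (of_real (Re s)) a)"
proof -
  have "shift s a = shift (\<i> * of_real (Im s)) (shift (of_real (Re s)) a)"
    by (simp add: shift_shift complex_eq[of s, symmetric] add.commute[of "\<i> * _"])
  also have "\<dots> = twist (prime_powr (\<i> * of_real (Im s))) (shift (of_real (Re s)) a)"
    by (rule shift_eq_twist[OF shift_polys[OF assms(1)]])
  finally show ?thesis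
    by (simp add: hmean_twist shift_polys assms norm_prime_powr nth_prime_pos)
qed

lemma bohr_lift_shift: "a \<in> dirichlet_polys \<Longrightarrow> bohr_lift (shift s a) \<omega> = (\<Sum>n | a n \<noteq> 0. a n * mult_ext \<omega> n * of_nat n powr (- s))"
  by (subst bohr_lift_superset[of "{n. a n \<noteq> 0}"]) (auto simp: shift_def dirichlet_polys_def mult_ac)

lemma of_nat_powr_holomorphic:
  assumes "f holomorphic_on A" shows "(\<lambda>s. (of_nat n :: complex) powr (f s)) holomorphic_on A"
proof (cases "n = 0")
  case False
  then have "(\<lambda>s. (of_nat n :: complex) powr (f s)) = (\<lambda>s. exp (f s * of_real (ln (real n))))"
    by (auto simp: of_nat_powr_eq_exp)
  then show ?thesis by (auto intro!: holomorphic_intros assms)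
qed auto

lemma bohr_lift_shift_holomorphic:
  "a \<in> dirichlet_polys \<Longrightarrow> (\<lambda>s. bohr_lift (shift s a) \<omega>) holomorphic_on A"
  unfolding bohr_lift_shift by (intro holomorphic_intros of_nat_powr_holomorphic)

lemma tendsto_hmean_zero:
  assumes p: "0 < p" and A: "finite A" "\<And>i n. n \<notin> A \<Longrightarrow> b i n = 0" and lim: "\<And>n. n \<in> A \<Longrightarrow> ((\<lambda>i. b i n) \<longlongrightarrow> 0) F"
  shows "((\<lambda>i. hmean p (b i)) \<longlongrightarrow> 0) F"
proof (rule tendsto_sandwich[of "\<lambda>_. 0" "\<lambda>i. hmean p (b i)" F "\<lambda>i. (\<Sum>n\<in>A. norm (b i n)) powr p"])
  have "(\<Sum>n | b i n \<noteq> 0. norm (b i n)) = (\<Sum>n\<in>A. norm (b i n))" for i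
    by (rule sum.mono_neutral_left) (use A in auto)
  then have "hmean p (b i) \<le> (\<Sum>n\<in>A. norm (b i n)) powr p" for i
    using hmean_le[OF p, of "b i"] by simp
  then show "\<forall>\<^sub>F i in F. hmean p (b i) \<le> (\<Sum>n\<in>A. norm (b i n)) powr p" by simp
  have "((\<lambda>i. (\<Sum>n\<in>A. norm (b i n)) powr p) \<longlongrightarrow> (\<Sum>n\<in>A. norm (0::complex)) powr p) F"
    by (intro tendsto_powr' tendsto_sum tendsto_norm lim tendsto_const) (use p in \<open>auto intro!: always_eventually sum_nonneg\<close>)
  then show "((\<lambda>i. (\<Sum>n\<in>A. norm (b i n)) powr p) \<longlongrightarrow> 0) F" by simp
qed (use hmean_nonneg in auto)

lemma continuous_on_hmean_shift:
  assumes a: "a \<in> dirichlet_polys" and p: "0 < p"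
  shows "continuous_on A (\<lambda>x::real. hmean p (shift (of_real x) a))"
  unfolding continuous_on_def
proof
  fix x assume "x \<in> A"
  have "((\<lambda>y. hmean p (\<lambda>n. shift (of_real y) a n - shift (of_real x) a n)) \<longlongrightarrow> 0) (at x within A)"
  proof (rule tendsto_hmean_zero[OF p dirichlet_polysD(1)[OF a]])
    fix n assume "n \<in> {n. a n \<noteq> 0}"
    then have n: "0 < n" using dirichlet_polysD(2)[OF a] by (cases "n = 0") auto
    have "((\<lambda>y. shift (of_real y) a n - shift (of_real x) a n) \<longlongrightarrow> shift (of_real x) a n - shift (of_real x) a n) (at x within A)"
      unfolding shift_def of_nat_powr_eq_exp[OF n] by (intro tendsto_intros)
    then show "((\<lambda>y. shift (of_real y) a n - shift (of_real x) a n) \<longlongrightarrow> 0) (at x within A)" by simp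
  qed (simp add: shift_def)
  from hmean_merge[OF p shift_polys[OF a] shift_polys[OF a] order_refl this]
  show "((\<lambda>x::real. hmean p (shift (of_real x) a)) \<longlongrightarrow> hmean p (shift (of_real x) a)) (at x within A)"
    by (simp add: LIM_zero_iff)
qed

section \<open>Decay of horizontal means\<close>

text \<open>
  The maximum principle on a half-line. Subtracting a small linear function, which does not affect
  the mean value property, forces the maximum to be attained; the circle around the maximal point
  that touches the origin then gives a contradiction.
\<close>

lemma bounded_submean_decreasing:
  fixes U :: "real \<Rightarrow> real"
  assumes cont: "continuous_on UNIV U" and bdd: "\<And>x. 0 \<le> x \<Longrightarrow> U x \<le> B" and b: "0 \<le> b"
    and sub: "\<And>x r. 0 < r \<Longrightarrow> U x \<le> integral {0..1} (\<lambda>t. U (x + r * cos (2 * pi * t)))"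
  shows "U b \<le> U 0"
proof (rule ccontr)
  assume "\<not> U b \<le> U 0"
  then have less: "U 0 < U b" and b: "0 < b" using b by (auto simp: not_le less_le)
  \<comment> \<open>Half the slope of the chord from \<open>0\<close> to \<open>b\<close>, so that \<open>V b\<close> remains above \<open>V 0\<close>.\<close>
  define e where "e = (U b - U 0) / (2 * b)"
  have e: "0 < e" using less b by (simp add: e_def)
  define V where "V x = U x - e * x" for x
  have eb: "e * b = (U b - U 0) / 2" using b by (simp add: e_def)
  have Vb: "V 0 < V b" unfolding V_def eb using less by (simp add: field_simps)
  have contU: "continuous_on S U" for S using cont continuous_on_subset by blast
  have contV: "continuous_on S V" for S unfolding V_def by (intro continuous_intros contU)
  define X where "X = max b ((B - U 0) / e)"
  have far: "V x \<le> V 0" if "X \<le> x" for x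
  proof -
    have "(B - U 0) / e \<le> x" "0 \<le> x" using that b by (auto simp: X_def)
    then have "B - U 0 \<le> e * x" using e by (simp add: field_simps)
    then show ?thesis using bdd[OF \<open>0 \<le> x\<close>] by (simp add: V_def)
  qed
  have "0 \<le> X" using b by (simp add: X_def le_max_iff_disj)
  then have Xne: "{0..X} \<noteq> {}" by simp
  obtain x where x: "x \<in> {0..X}" "\<And>y. y \<in> {0..X} \<Longrightarrow> V y \<le> V x"
    using continuous_attains_sup[OF compact_Icc Xne contV] by blast
  have "V b \<le> V x" using x(2)[of b] b by (simp add: X_def)
  then have Vx: "V 0 < V x" using Vb by simp
  then have x0: "0 < x" using x(1) by (cases "x = 0") auto
  have max: "V y \<le> V x" if "0 \<le> y" for y
    using far[of y] x(2)[of y] Vx that by (cases "y \<le> X") auto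
  have nonneg: "0 \<le> x + x * cos u" for u
  proof -
    have "x * (- 1) \<le> x * cos u" using x0 by (intro mult_left_mono) auto
    then show ?thesis by simp
  qed
  let ?g = "\<lambda>t. V x - V (x + x * cos (2 * pi * t))"
  have contUc: "continuous_on {0..1} (\<lambda>t. U (x + x * cos (2 * pi * t)))"
    by (rule continuous_on_compose2[OF cont]) (auto intro!: continuous_intros)
  have cosint: "((\<lambda>t. cos (2 * pi * t)) has_integral 0) {0..1}"
  proof -
    have "((\<lambda>t. cos (2 * pi * t)) has_integral (sin (2 * pi * 1) / (2 * pi) - sin (2 * pi * 0) / (2 * pi))) {0..1}"
      by (rule fundamental_theorem_of_calculus)
         (auto intro!: derivative_eq_intros simp flip: has_real_derivative_iff_has_vector_derivative)
    then show ?thesis by simp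
  qed
  have contg: "continuous_on {0..1} ?g"
    by (intro continuous_on_diff continuous_on_const continuous_on_compose2[OF contV[of UNIV]])
       (auto intro!: continuous_intros)
  have "integral {0..1} ?g = integral {0..1} (\<lambda>t. V x + e * x + e * x * cos (2 * pi * t) - U (x + x * cos (2 * pi * t)))"
    by (rule integral_cong) (simp add: V_def algebra_simps)
  also have "\<dots> = U x + 0 - integral {0..1} (\<lambda>t. U (x + x * cos (2 * pi * t)))"
  proof (rule integral_unique)
    have "((\<lambda>t. V x + e * x + e * x * cos (2 * pi * t)) has_integral (V x + e * x) + e * x * 0) {0..1}"
      using has_integral_add[OF has_integral_const_real[of "V x + e * x" 0 1] has_integral_mult_right[OF cosint, of "e * x"]]
      by simp
    moreover have "((\<lambda>t. U (x + x * cos (2 * pi * t))) has_integral integral {0..1} (\<lambda>t. U (x + x * cos (2 * pi * t)))) {0..1}"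
      by (intro integrable_integral integrable_continuous_real contUc)
    from has_integral_diff[OF calculation this]
    show "((\<lambda>t. V x + e * x + e * x * cos (2 * pi * t) - U (x + x * cos (2 * pi * t)))
        has_integral U x + 0 - integral {0..1} (\<lambda>t. U (x + x * cos (2 * pi * t)))) {0..1}"
      by (simp add: V_def)
  qed
  also have "\<dots> \<le> 0" using sub[OF x0, of x] by simp
  finally have "integral {0..1} ?g \<le> 0" .
  moreover have ge: "?g t \<ge> 0" for t using max[OF nonneg] by simp
  then have "0 \<le> integral {0..1} ?g" by (intro integral_nonneg integrable_continuous_real contg) auto
  ultimately have "integral {0..1} ?g = 0" by simp
  then have "\<forall>t\<in>{0..1}. ?g t = 0"
    using integral_eq_0_iff[OF contg] ge by simp
  \<comment> \<open>At \<open>t = 1/2\<close> the circle of radius \<open>x\<close> around \<open>x\<close> passes through the origin.\<close>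
  then have "?g (1/2) = 0" by (rule bspec) auto
  then show False using Vx by simp
qed

lemma entire_powr_circle_bound_nn:
  assumes F: "F holomorphic_on UNIV" and w: "norm w < 1" and p: "0 < p"
  shows "ennreal (norm (F w) powr p)
    \<le> ennreal (1 / (1 - norm w)) * (\<integral>\<^sup>+t. ennreal (norm (F (cis (2 * pi * t))) powr p) * indicator {0..1} t \<partial>lborel)"
proof -
  have cF: "continuous_on {0..1} (\<lambda>t. F (cis (2 * pi * t)))"
    by (rule continuous_on_compose2[OF holomorphic_on_imp_continuous_on[OF F]]) (auto intro!: continuous_intros)
  have "continuous_on {0..1} (\<lambda>t. norm (F (cis (2 * pi * t))) powr p)"
    by (rule continuous_on_powr'[OF continuous_on_norm[OF cF] continuous_on_const]) (use p in auto)
  then have "((\<lambda>t. norm (F (cis (2 * pi * t))) powr p) has_integral integral {0..1} (\<lambda>t. norm (F (cis (2 * pi * t))) powr p)) {0..1}"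
    by (intro integrable_integral integrable_continuous_real)
  then have "(\<integral>\<^sup>+t. ennreal (norm (F (cis (2 * pi * t))) powr p) * indicator {0..1} t \<partial>lborel)
     = ennreal (integral {0..1} (\<lambda>t. norm (F (cis (2 * pi * t))) powr p))"
    by (intro nn_integral_has_integral_lebesgue') auto
  then show ?thesis
    using entire_powr_circle_bound[OF F w p] w
    by (simp add: ennreal_mult'[symmetric] ennreal_leI)
qed

lemma of_nat_powr_continuous [continuous_intros]:
  assumes "continuous_on A f" shows "continuous_on A (\<lambda>s. (of_nat n :: complex) powr (f s))"
proof (cases "n = 0")
  case False
  then have eq: "(\<lambda>s. (of_nat n :: complex) powr (f s)) = (\<lambda>s. exp (f s * of_real (ln (real n))))"
    by (auto simp: of_nat_powr_eq_exp)
  show ?thesis unfolding eq by (intro continuous_intros assms)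
qed simp

lemma nn_integral_torus_circle_swap:
  assumes [measurable]: "(\<lambda>(\<omega>, t). h \<omega> t) \<in> borel_measurable (torus \<Otimes>\<^sub>M lborel)"
  shows "(\<integral>\<^sup>+\<omega>. (\<integral>\<^sup>+t. h \<omega> t * indicator {0..1} t \<partial>lborel) \<partial>torus)
       = (\<integral>\<^sup>+t. (\<integral>\<^sup>+\<omega>. h \<omega> t \<partial>torus) * indicator {0..1::real} t \<partial>lborel)"
proof -
  interpret torus: prob_space torus by (rule prob_space_torus)
  interpret pair_sigma_finite torus "lborel :: real measure" by unfold_locales
  have "(\<integral>\<^sup>+\<omega>. (\<integral>\<^sup>+t. h \<omega> t * indicator {0..1} t \<partial>lborel) \<partial>torus)
       = (\<integral>\<^sup>+t. (\<integral>\<^sup>+\<omega>. h \<omega> t * indicator {0..1} t \<partial>torus) \<partial>lborel)"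
    by (rule Fubini'[symmetric]) measurable
  also have "\<dots> = (\<integral>\<^sup>+t. (\<integral>\<^sup>+\<omega>. h \<omega> t \<partial>torus) * indicator {0..1} t \<partial>lborel)"
    by (intro nn_integral_cong nn_integral_multc) measurable
  finally show ?thesis .
qed

text \<open>
  Averages over the torus of averages over a vertical circle, computed in the other order. The
  factor \<open>of_nat m powr s\<close> is carried along for the decay of series starting at \<open>n = m\<close>.
\<close>

lemma nn_integral_circle_shift:
  assumes a: "a \<in> dirichlet_polys" and p: "0 < p" and m: "0 < m"
  shows "(\<integral>\<^sup>+\<omega>. (\<integral>\<^sup>+t. ennreal (norm (of_nat m powr (c + of_real r * cis (2 * pi * t))
              * bohr_lift (shift (c + of_real r * cis (2 * pi * t)) a) \<omega>) powr p) * indicator {0..1} t \<partial>lborel) \<partial>torus)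
       = (\<integral>\<^sup>+t. ennreal (real m powr (p * (Re c + r * cos (2 * pi * t)))
              * hmean p (shift (of_real (Re c + r * cos (2 * pi * t))) a)) * indicator {0..1} t \<partial>lborel)"
proof -
  let ?s = "\<lambda>t. c + of_real r * cis (2 * pi * t)"
  have [measurable]: "(\<lambda>t. of_nat n powr (- ?s t)) \<in> borel_measurable borel"
       "(\<lambda>t. of_nat n powr (?s t)) \<in> borel_measurable borel" for n
    by (intro borel_measurable_continuous_onI continuous_intros; simp)+
  have "(\<integral>\<^sup>+\<omega>. (\<integral>\<^sup>+t. ennreal (norm (of_nat m powr ?s t * bohr_lift (shift (?s t) a) \<omega>) powr p) * indicator {0..1} t \<partial>lborel) \<partial>torus)
      = (\<integral>\<^sup>+t. torus_mean p (\<lambda>\<omega>. of_nat m powr ?s t * bohr_lift (shift (?s t) a) \<omega>) * indicator {0..1} t \<partial>lborel)"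
    by (rule nn_integral_torus_circle_swap) (unfold bohr_lift_shift[OF a], measurable)
  also have "\<dots> = (\<integral>\<^sup>+t. ennreal (real m powr (p * (Re c + r * cos (2 * pi * t)))
              * hmean p (shift (of_real (Re c + r * cos (2 * pi * t))) a)) * indicator {0..1} t \<partial>lborel)"
  proof (intro nn_integral_cong arg_cong2[where f = "(*)"] refl)
    fix t
    have eq: "norm (of_nat m powr ?s t * bohr_lift (shift (?s t) a) \<omega>) powr p
       = real m powr (p * Re (?s t)) * norm (bohr_lift (shift (?s t) a) \<omega>) powr p" for \<omega>
      using m by (simp add: norm_mult powr_mult norm_powr_real_powr powr_powr mult_ac)
    have "torus_mean p (\<lambda>\<omega>. of_nat m powr ?s t * bohr_lift (shift (?s t) a) \<omega>)
       = ennreal (real m powr (p * Re (?s t)) * hmean p (shift (?s t) a))"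
      unfolding eq by (simp add: ennreal_mult' nn_integral_cmult nn_integral_bohr_lift p)
    also have "hmean p (shift (?s t) a) = hmean p (shift (of_real (Re (?s t))) a)"
      by (rule hmean_shift_Re[OF a p])
    finally show "torus_mean p (\<lambda>\<omega>. of_nat m powr ?s t * bohr_lift (shift (?s t) a) \<omega>)
       = ennreal (real m powr (p * (Re c + r * cos (2 * pi * t))) * hmean p (shift (of_real (Re c + r * cos (2 * pi * t))) a))"
      by simp
  qed
  finally show ?thesis .
qed

lemma norm_mult_powr_shift_holomorphic:
  "a \<in> dirichlet_polys \<Longrightarrow> (\<lambda>z. of_nat m powr (c + of_real r * z) * bohr_lift (shift (c + of_real r * z) a) \<omega>) holomorphic_on A"
  unfolding bohr_lift_shift by (intro holomorphic_intros of_nat_powr_holomorphic)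

lemma shift_0: "a \<in> dirichlet_polys \<Longrightarrow> shift 0 a = a"
  by (auto simp: shift_def fun_eq_iff dirichlet_polysD)

text \<open>
  The factor \<open>real m powr (p * x)\<close> is what keeps \<open>U\<close> bounded for series starting at \<open>m\<close>, so
  \<open>bounded_submean_decreasing\<close> applies to it.
\<close>

theorem hmean_shift_decay:
  assumes a: "a \<in> dirichlet_polys" and p: "0 < p" and m: "0 < m" "\<And>n. n < m \<Longrightarrow> a n = 0" and x: "0 \<le> x"
  shows "hmean p (shift (of_real x) a) \<le> real m powr (- p * x) * hmean p a"
proof -
  define U where "U x = real m powr (p * x) * hmean p (shift (of_real x) a)" for x :: real
  have contU: "continuous_on S U" for S
    unfolding U_def using m(1) by (intro continuous_intros continuous_on_hmean_shift a p) auto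
  have "U x \<le> U 0"
  proof (rule bounded_submean_decreasing[OF contU _ x])
    fix x :: real assume x: "0 \<le> x"
    have "(\<Sum>n | shift (of_real x) a n \<noteq> 0. norm (shift (of_real x) a n)) \<le> (\<Sum>n | a n \<noteq> 0. norm (a n) * real m powr (- x))"
    proof (rule sum_mono2[THEN order_trans])
      show "finite {n. a n \<noteq> 0}" by (rule dirichlet_polysD(1)[OF a])
      show "(\<Sum>n | a n \<noteq> 0. norm (shift (of_real x) a n)) \<le> (\<Sum>n | a n \<noteq> 0. norm (a n) * real m powr (- x))"
      proof (rule sum_mono)
        fix n assume "n \<in> {n. a n \<noteq> 0}"
        then have "m \<le> n" using m(2)[of n] by (auto simp: not_less[symmetric])
        then have "real n powr (- x) \<le> real m powr (- x)" using m(1) x by (intro powr_mono2') auto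
        then show "norm (shift (of_real x) a n) \<le> norm (a n) * real m powr (- x)"
          by (simp add: shift_def norm_mult norm_powr_real_powr mult_left_mono)
      qed
    qed (auto simp: shift_def)
    then have "hmean p (shift (of_real x) a) \<le> ((\<Sum>n | a n \<noteq> 0. norm (a n)) * real m powr (- x)) powr p"
      using p by (intro order_trans[OF hmean_le[OF p]] powr_mono2) (auto intro: sum_nonneg simp: sum_distrib_right)
    also have "\<dots> = real m powr (- (p * x)) * (\<Sum>n | a n \<noteq> 0. norm (a n)) powr p"
      by (simp add: powr_mult powr_powr sum_nonneg mult_ac)
    finally have "U x \<le> real m powr (p * x) * (real m powr (- (p * x)) * (\<Sum>n | a n \<noteq> 0. norm (a n)) powr p)"
      unfolding U_def by (rule mult_left_mono) simp
    also have "\<dots> = (\<Sum>n | a n \<noteq> 0. norm (a n)) powr p"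
      using m(1) by (simp add: mult.assoc[symmetric] powr_add[symmetric])
    finally show "U x \<le> (\<Sum>n | a n \<noteq> 0. norm (a n)) powr p" .
  next
    fix x r :: real assume r: "0 < r"
    let ?s = "\<lambda>t. of_real x + of_real r * cis (2 * pi * t)"
    have contc: "continuous_on {0..1} (\<lambda>t. U (x + r * cos (2 * pi * t)))"
      by (rule continuous_on_compose2[OF contU[of UNIV]]) (auto intro!: continuous_intros)
    then have nonneg: "0 \<le> integral {0..1} (\<lambda>t. U (x + r * cos (2 * pi * t)))"
      by (intro integral_nonneg integrable_continuous_real) (simp_all add: U_def hmean_nonneg)
    have "ennreal (U x) = (\<integral>\<^sup>+\<omega>. ennreal (real m powr (p * x) * norm (bohr_lift (shift (of_real x) a) \<omega>) powr p) \<partial>torus)"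
      by (simp add: U_def ennreal_mult' nn_integral_cmult nn_integral_bohr_lift p)
    also have "\<dots> = torus_mean p (\<lambda>\<omega>. of_nat m powr (of_real x + of_real r * 0)
         * bohr_lift (shift (of_real x + of_real r * 0) a) \<omega>)"
      using m by (simp add: norm_mult powr_mult norm_powr_real_powr powr_powr mult_ac)
    also have "\<dots> \<le> (\<integral>\<^sup>+\<omega>. (\<integral>\<^sup>+t. ennreal (norm (of_nat m powr ?s t * bohr_lift (shift (?s t) a) \<omega>) powr p)
         * indicator {0..1} t \<partial>lborel) \<partial>torus)"
      by (intro nn_integral_mono)
         (use entire_powr_circle_bound_nn[OF norm_mult_powr_shift_holomorphic[OF a], of 0 p] p in simp)
    also have "\<dots> = (\<integral>\<^sup>+t. ennreal (U (x + r * cos (2 * pi * t))) * indicator {0..1} t \<partial>lborel)"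
      unfolding U_def using nn_integral_circle_shift[OF a p m(1), of "of_real x" r] by simp
    also have "\<dots> = ennreal (integral {0..1} (\<lambda>t. U (x + r * cos (2 * pi * t))))"
    proof (rule nn_integral_has_integral_lebesgue')
      from contc show "((\<lambda>t. U (x + r * cos (2 * pi * t))) has_integral integral {0..1} (\<lambda>t. U (x + r * cos (2 * pi * t)))) {0..1}"
        by (intro integrable_integral integrable_continuous_real)
    qed (simp add: U_def hmean_nonneg)
    finally show "U x \<le> integral {0..1} (\<lambda>t. U (x + r * cos (2 * pi * t)))"
      using nonneg by simp
  qed
  then have "real m powr (p * x) * hmean p (shift (of_real x) a) \<le> hmean p a"
    using m(1) a unfolding U_def by (simp add: shift_0)
  then have "real m powr (- p * x) * (real m powr (p * x) * hmean p (shift (of_real x) a)) \<le> real m powr (- p * x) * hmean p a"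
    by (rule mult_left_mono) simp
  then show ?thesis using m(1) by (simp add: mult.assoc[symmetric] powr_add[symmetric])
qed

section \<open>Point evaluations and coefficient bounds\<close>

lemma bohr_lift_measurable_compose:
  assumes "\<And>j. (\<lambda>x. g x j) \<in> borel_measurable M"
  shows "(\<lambda>x. bohr_lift a (g x)) \<in> borel_measurable M"
  unfolding bohr_lift_def mult_ext_def
  by (intro borel_measurable_sum borel_measurable_times borel_measurable_prod borel_measurable_power assms) auto

lemma bohr_lift_holomorphic_compose:
  assumes "\<And>j. (\<lambda>z. g z j) holomorphic_on A"
  shows "(\<lambda>z. bohr_lift a (g z)) holomorphic_on A"
  unfolding bohr_lift_def mult_ext_def by (intro holomorphic_intros assms)

lemma mult_ext_cong: "(\<And>j. nth_prime j dvd n \<Longrightarrow> v j = w j) \<Longrightarrow> mult_ext v n = mult_ext w n"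
  unfolding mult_ext_def by (intro prod.cong) auto

text \<open>
  The variables in \<open>K\<close> are moved into the disc at once, the variables in \<open>A\<close> having been fixed
  before; the averages on the right-hand side are rotations. The point \<open>w \<omega>\<close> may depend on \<open>\<omega>\<close> because
  the bound only sees its modulus.
\<close>

lemma coordinate_disc_bound:
  assumes p: "0 < p" and w: "\<And>\<omega>. \<omega> \<in> space torus \<Longrightarrow> norm (w \<omega>) = \<rho>" "\<rho> < 1" "0 \<le> \<rho>"
  shows "torus_mean p (\<lambda>\<omega>. bohr_lift a (\<lambda>j. if j \<in> A then v j else if j \<in> K then \<omega> j * w \<omega> else \<omega> j))
     \<le> ennreal (1 / (1 - \<rho>)) * torus_mean p (\<lambda>\<omega>. bohr_lift a (\<lambda>j. if j \<in> A then v j else \<omega> j))"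
proof -
  let ?z = "\<lambda>\<omega> z j. if j \<in> A then v j else if j \<in> K then \<omega> j * z else \<omega> j"
  let ?c = "\<lambda>t. cis (2 * pi * t)"
  have [measurable]: "?c \<in> borel_measurable borel" by (intro borel_measurable_continuous_onI continuous_intros)
  let ?u = "\<lambda>t j. if j \<in> K then ?c t else 1"
  have "torus_mean p (\<lambda>\<omega>. bohr_lift a (?z \<omega> (w \<omega>)))
     \<le> (\<integral>\<^sup>+\<omega>. ennreal (1 / (1 - \<rho>)) * (\<integral>\<^sup>+t. ennreal (norm (bohr_lift a (?z \<omega> (?c t))) powr p) * indicator {0..1} t \<partial>lborel) \<partial>torus)"
  proof (rule nn_integral_mono)
    fix \<omega> assume \<omega>: "\<omega> \<in> space torus"
    have "(\<lambda>z. bohr_lift a (?z \<omega> z)) holomorphic_on UNIV"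
    proof (rule bohr_lift_holomorphic_compose)
      show "(\<lambda>z. ?z \<omega> z j) holomorphic_on UNIV" for j
        by (cases "j \<in> A"; cases "j \<in> K") (auto intro!: holomorphic_intros)
    qed
    from entire_powr_circle_bound_nn[OF this _ p, of "w \<omega>"]
    show "ennreal (norm (bohr_lift a (?z \<omega> (w \<omega>))) powr p)
       \<le> ennreal (1 / (1 - \<rho>)) * (\<integral>\<^sup>+t. ennreal (norm (bohr_lift a (?z \<omega> (?c t))) powr p) * indicator {0..1} t \<partial>lborel)"
      using w \<omega> by simp
  qed
  also have "\<dots> = ennreal (1 / (1 - \<rho>)) * (\<integral>\<^sup>+\<omega>. (\<integral>\<^sup>+t. ennreal (norm (bohr_lift a (?z \<omega> (?c t))) powr p) * indicator {0..1} t \<partial>lborel) \<partial>torus)"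
  proof (rule nn_integral_cmult)
    have [measurable]: "(\<lambda>x. bohr_lift a (?z (fst x) (?c (snd x)))) \<in> borel_measurable (torus \<Otimes>\<^sub>M lborel)"
      by (rule bohr_lift_measurable_compose) (auto intro!: borel_measurable_times measurable_compose[OF measurable_fst torus_component_measurable])
    show "(\<lambda>\<omega>. \<integral>\<^sup>+t. ennreal (norm (bohr_lift a (?z \<omega> (?c t))) powr p) * indicator {0..1} t \<partial>lborel) \<in> borel_measurable torus"
      by (rule lborel.borel_measurable_nn_integral) (unfold split_beta, measurable)
  qed
  also have "(\<integral>\<^sup>+\<omega>. (\<integral>\<^sup>+t. ennreal (norm (bohr_lift a (?z \<omega> (?c t))) powr p) * indicator {0..1} t \<partial>lborel) \<partial>torus)
     = (\<integral>\<^sup>+t. torus_mean p (\<lambda>\<omega>. bohr_lift a (?z \<omega> (?c t))) * indicator {0..1} t \<partial>lborel)"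
  proof (rule nn_integral_torus_circle_swap)
    have [measurable]: "(\<lambda>x. bohr_lift a (?z (fst x) (?c (snd x)))) \<in> borel_measurable (torus \<Otimes>\<^sub>M lborel)"
      by (rule bohr_lift_measurable_compose) (auto intro!: borel_measurable_times measurable_compose[OF measurable_fst torus_component_measurable])
    show "(\<lambda>(\<omega>, t). ennreal (norm (bohr_lift a (?z \<omega> (?c t))) powr p)) \<in> borel_measurable (torus \<Otimes>\<^sub>M lborel)"
      unfolding split_beta by measurable
  qed
  also have "\<dots> = (\<integral>\<^sup>+t. torus_mean p (\<lambda>\<omega>. bohr_lift a (\<lambda>j. if j \<in> A then v j else \<omega> j)) * indicator {0..1::real} t \<partial>lborel)"
  proof (rule nn_integral_cong, rule arg_cong2[where f = "(*)", OF _ refl])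
    fix t
    have "torus_mean p (\<lambda>\<omega>. bohr_lift a (?z \<omega> (?c t)))
       = torus_mean p (\<lambda>\<omega>. bohr_lift a (\<lambda>j. if j \<in> A then v j else \<omega> j * ?u t j))"
      by (intro nn_integral_cong arg_cong[where f = "\<lambda>v. ennreal (norm (bohr_lift a v) powr p)"]) auto
    also have "\<dots> = torus_mean p (\<lambda>\<omega>. bohr_lift a (\<lambda>j. if j \<in> A then v j else \<omega> j))"
    proof (rule nn_integral_torus_rotation)
      have [measurable]: "(\<lambda>\<omega>. bohr_lift a (\<lambda>j. if j \<in> A then v j else \<omega> j)) \<in> borel_measurable torus"
        by (rule bohr_lift_measurable_compose) auto
      show "(\<lambda>\<omega>. ennreal (norm (bohr_lift a (\<lambda>j. if j \<in> A then v j else \<omega> j)) powr p)) \<in> borel_measurable torus"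
        by measurable
    qed auto
    finally show "torus_mean p (\<lambda>\<omega>. bohr_lift a (?z \<omega> (?c t))) = \<dots>" .
  qed
  also have "\<dots> = torus_mean p (\<lambda>\<omega>. bohr_lift a (\<lambda>j. if j \<in> A then v j else \<omega> j))"
    by (simp add: nn_integral_cmult)
  finally show ?thesis .
qed

text \<open>
  Iterates the disc bound over the variables. In the step for the variable \<open>k\<close> the point of the disc is
  \<open>v k * cnj (\<omega> k)\<close>, which turns the coordinate \<open>\<omega> k\<close> into \<open>v k\<close>.
\<close>

lemma point_evaluation:
  assumes p: "0 < p" and J: "\<And>n j. a n \<noteq> 0 \<Longrightarrow> nth_prime j dvd n \<Longrightarrow> j < J" and v: "\<And>j. norm (v j) < 1"
  shows "norm (bohr_lift a v) powr p \<le> (\<Prod>j<J. 1 / (1 - norm (v j))) * hmean p a"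
proof -
  have "torus_mean p (\<lambda>\<omega>. bohr_lift a (\<lambda>j. if j < k then v j else \<omega> j))
      \<le> ennreal ((\<Prod>j<k. 1 / (1 - norm (v j))) * hmean p a)" for k
  proof (induction k)
    case 0
    show ?case by (simp add: nn_integral_bohr_lift p)
  next
    case (Suc k)
    have pos: "0 \<le> (\<Prod>j<k. 1 / (1 - norm (v j)))" using v by (intro prod_nonneg) (auto simp: less_imp_le)
    have "torus_mean p (\<lambda>\<omega>. bohr_lift a (\<lambda>j. if j < Suc k then v j else \<omega> j))
       = torus_mean p (\<lambda>\<omega>. bohr_lift a (\<lambda>j. if j \<in> {..<k} then v j else if j \<in> {k} then \<omega> j * (v k * cnj (\<omega> k)) else \<omega> j))"
    proof (intro nn_integral_cong arg_cong[where f = "\<lambda>v. ennreal (norm (bohr_lift a v) powr p)"] ext)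
      fix \<omega> j assume "\<omega> \<in> space torus"
      then have "\<omega> k * cnj (\<omega> k) = 1" by (simp add: space_torus complex_norm_square[symmetric])
      then have "\<omega> k * (v k * cnj (\<omega> k)) = v k" by (simp add: mult_ac)
      then show "(if j < Suc k then v j else \<omega> j)
         = (if j \<in> {..<k} then v j else if j \<in> {k} then \<omega> j * (v k * cnj (\<omega> k)) else \<omega> j)"
        by auto
    qed
    also have "\<dots> \<le> ennreal (1 / (1 - norm (v k))) * torus_mean p (\<lambda>\<omega>. bohr_lift a (\<lambda>j. if j \<in> {..<k} then v j else \<omega> j))"
      by (rule coordinate_disc_bound[OF p]) (use v in \<open>auto simp: norm_mult space_torus\<close>)
    also have "\<dots> \<le> ennreal (1 / (1 - norm (v k))) * ennreal ((\<Prod>j<k. 1 / (1 - norm (v j))) * hmean p a)"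
      using Suc.IH by (intro mult_left_mono) auto
    also have "\<dots> = ennreal ((\<Prod>j<Suc k. 1 / (1 - norm (v j))) * hmean p a)"
      using v pos by (subst ennreal_mult'[symmetric]) (auto simp: less_imp_le mult_ac)
    finally show ?case .
  qed
  from this[of J] have "torus_mean p (\<lambda>\<omega>. bohr_lift a v) \<le> ennreal ((\<Prod>j<J. 1 / (1 - norm (v j))) * hmean p a)"
  proof (rule order_trans[rotated])
    have "bohr_lift a (\<lambda>j. if j < J then v j else \<omega> j) = bohr_lift a v" for \<omega>
      unfolding bohr_lift_def by (intro sum.cong arg_cong2[where f = "(*)"] mult_ext_cong) (use J in auto)
    then show "torus_mean p (\<lambda>\<omega>. bohr_lift a v)
       \<le> torus_mean p (\<lambda>\<omega>. bohr_lift a (\<lambda>j. if j < J then v j else \<omega> j))"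
      by simp
  qed
  moreover have "0 \<le> (\<Prod>j<J. 1 / (1 - norm (v j)))" using v by (intro prod_nonneg) (auto simp: less_imp_le)
  ultimately show ?thesis
    using prob_space.emeasure_space_1[OF prob_space_torus] by (simp add: hmean_nonneg)
qed

text \<open>
  The part supported on numbers without prime factors of index \<open>\<ge> d\<close>: the Bohr lift with these
  variables set to \<open>0\<close>.
\<close>

definition smooth_part :: "nat \<Rightarrow> (nat \<Rightarrow> complex) \<Rightarrow> nat \<Rightarrow> complex" where
  "smooth_part d a n = (if \<exists>j\<ge>d. nth_prime j dvd n then 0 else a n)"

lemma smooth_part_polys: "a \<in> dirichlet_polys \<Longrightarrow> smooth_part d a \<in> dirichlet_polys"
  unfolding dirichlet_polys_def smooth_part_def by (auto intro: finite_subset[of _ "{n. a n \<noteq> 0}"])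

text \<open>
  Setting variables to \<open>0\<close> is evaluation at the centre of a disc, where the disc bound has constant \<open>1\<close>.
\<close>

lemma hmean_smooth_part_le:
  assumes a: "a \<in> dirichlet_polys" and p: "0 < p"
  shows "hmean p (smooth_part d a) \<le> hmean p a"
proof -
  have eq: "bohr_lift (smooth_part d a) \<omega> = bohr_lift a (\<lambda>j. if j \<in> {} then 0 else if j \<in> {d..} then \<omega> j * 0 else \<omega> j)" for \<omega>
  proof -
    have "smooth_part d a n * mult_ext \<omega> n = a n * mult_ext (\<lambda>j. if j \<in> {} then 0 else if j \<in> {d..} then \<omega> j * 0 else \<omega> j) n"
      if "a n \<noteq> 0" for n
    proof (cases "\<exists>j\<ge>d. nth_prime j dvd n")
      case True
      then obtain j where j: "d \<le> j" "nth_prime j dvd n" by auto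
      have "0 < n" using that dirichlet_polysD(2)[OF a] by (cases "n = 0") auto
      then have "0 < multiplicity (nth_prime j) n" using j by (simp add: prime_multiplicity_gt_zero_iff)
      then have "mult_ext (\<lambda>j. if j \<in> {} then 0 else if j \<in> {d..} then \<omega> j * 0 else \<omega> j) n = 0"
        unfolding mult_ext_def
        by (intro prod_zero finite_nth_prime_dvd \<open>0 < n\<close>) (use j in \<open>auto intro!: exI[of _ j]\<close>)
      then show ?thesis using True by (simp add: smooth_part_def)
    next
      case False
      then have "mult_ext (\<lambda>j. if j \<in> {} then 0 else if j \<in> {d..} then \<omega> j * 0 else \<omega> j) n = mult_ext \<omega> n"
        by (intro mult_ext_cong) auto
      moreover have "smooth_part d a n = a n" unfolding smooth_part_def using False by (rule if_not_P)
      ultimately show ?thesis by simp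
    qed
    then show ?thesis
      by (subst bohr_lift_superset[of "{n. a n \<noteq> 0}"])
         (use dirichlet_polysD[OF a] in \<open>auto simp: smooth_part_def bohr_lift_def\<close>)
  qed
  have "ennreal (hmean p (smooth_part d a)) \<le> ennreal (1 / (1 - 0)) * ennreal (hmean p a)"
    unfolding nn_integral_bohr_lift[OF p, symmetric] eq
    using coordinate_disc_bound[OF p, of "\<lambda>_. 0" 0 a "{}" "\<lambda>_. 0" "{d..}"] by simp
  then show ?thesis by (simp add: hmean_nonneg)
qed

lemma nth_prime_powr_less_one: "0 < s \<Longrightarrow> real (nth_prime j) powr (- s) < 1"
  using nth_prime_ge[of j] by (intro powr_less_one) linarith+

lemma cnj_mult_ext_measurable [measurable]: "(\<lambda>\<omega>. cnj (mult_ext \<omega> n)) \<in> borel_measurable torus"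
  by (rule measurable_compose[OF mult_ext_measurable])
     (intro borel_measurable_continuous_onI continuous_intros)

text \<open>
  A vertical translation by \<open>pi / ln (k / n)\<close> preserves the integral and changes its sign.
\<close>

lemma torus_character_orthogonal:
  assumes "0 < k" "0 < n"
  shows "(LINT \<omega>|torus. mult_ext \<omega> k * cnj (mult_ext \<omega> n)) = (if k = n then 1 else 0)"
proof -
  interpret prob_space torus by (rule prob_space_torus)
  show ?thesis
  proof (cases "k = n")
    case True
    have "(LINT \<omega>|torus. mult_ext \<omega> k * cnj (mult_ext \<omega> n)) = (LINT \<omega>|torus. 1)"
      by (rule Bochner_Integration.integral_cong)
         (auto simp: True complex_norm_square[symmetric] norm_mult_ext_torus)
    then show ?thesis using True prob_space by simp
  next
    case False
    let ?I = "LINT \<omega>|torus. mult_ext \<omega> k * cnj (mult_ext \<omega> n)"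
    let ?d = "ln (real k) - ln (real n)"
    have d: "?d \<noteq> 0" using False assms by simp
    \<comment> \<open>With this \<open>t\<close> the rotation multiplies the integrand by \<open>exp (- \<i> pi)\<close>.\<close>
    define t where "t = pi / ?d"
    let ?u = "prime_powr (\<i> * of_real t)"
    have u: "norm (?u j) = 1" for j by (simp add: norm_prime_powr nth_prime_pos)
    have "mult_ext ?u k * cnj (mult_ext ?u n) = exp (- (\<i> * of_real (t * ?d)))"
      using assms by (simp add: mult_ext_prime_powr of_nat_powr_eq_exp exp_cnj exp_add[symmetric] algebra_simps)
    also have "t * ?d = pi" using d by (simp add: t_def)
    finally have m1: "mult_ext ?u k * cnj (mult_ext ?u n) = -1" by (simp add: exp_minus)
    have "?I = (LINT \<omega>|distr torus torus (\<lambda>\<omega> j. \<omega> j * ?u j). mult_ext \<omega> k * cnj (mult_ext \<omega> n))"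
      by (simp add: torus_rotation(1)[OF u])
    also have "\<dots> = (LINT \<omega>|torus. mult_ext (\<lambda>j. \<omega> j * ?u j) k * cnj (mult_ext (\<lambda>j. \<omega> j * ?u j) n))"
      by (rule integral_distr[OF torus_rotation(2)[OF u]])
         (intro borel_measurable_times mult_ext_measurable cnj_mult_ext_measurable)
    also have "\<dots> = (LINT \<omega>|torus. (mult_ext ?u k * cnj (mult_ext ?u n)) * (mult_ext \<omega> k * cnj (mult_ext \<omega> n)))"
      by (rule Bochner_Integration.integral_cong) (auto simp: mult_ext_mult mult_ac)
    also have "\<dots> = - ?I" unfolding m1 by simp
    finally show ?thesis using False by simp
  qed
qed

lemma coefficient_le_sup:
  assumes a: "a \<in> dirichlet_polys" and C: "\<And>\<omega>. \<omega> \<in> space torus \<Longrightarrow> norm (bohr_lift a \<omega>) \<le> C" and n: "0 < n"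
  shows "norm (a n) \<le> C"
proof -
  interpret prob_space torus by (rule prob_space_torus)
  have int: "integrable torus (\<lambda>\<omega>. a k * mult_ext \<omega> k * cnj (mult_ext \<omega> n))" for k
    by (rule integrable_const_bound[where B = "norm (a k)"])
       (auto simp: norm_mult norm_mult_ext_torus intro!: borel_measurable_times mult_ext_measurable cnj_mult_ext_measurable)
  have "(LINT \<omega>|torus. bohr_lift a \<omega> * cnj (mult_ext \<omega> n))
      = (\<Sum>k | a k \<noteq> 0. a k * (LINT \<omega>|torus. mult_ext \<omega> k * cnj (mult_ext \<omega> n)))"
    unfolding bohr_lift_def sum_distrib_right
    by (subst Bochner_Integration.integral_sum) (use int in \<open>auto simp: mult.assoc\<close>)
  also have "\<dots> = (\<Sum>k | a k \<noteq> 0. if k = n then a k else 0)"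
    by (rule sum.cong[OF refl], subst torus_character_orthogonal[OF _ n])
       (use dirichlet_polysD(2)[OF a] in \<open>auto intro!: Nat.gr0I\<close>)
  also have "\<dots> = a n" using dirichlet_polysD(1)[OF a] by (simp add: sum.delta)
  finally have "norm (a n) = norm (LINT \<omega>|torus. bohr_lift a \<omega> * cnj (mult_ext \<omega> n))" by simp
  also have "\<dots> \<le> (LINT \<omega>|torus. norm (bohr_lift a \<omega> * cnj (mult_ext \<omega> n)))"
    by (rule integral_norm_bound)
  also have "\<dots> \<le> C"
  proof (rule integral_le_const)
    show "integrable torus (\<lambda>\<omega>. norm (bohr_lift a \<omega> * cnj (mult_ext \<omega> n)))"
      by (rule integrable_const_bound[where B = C]) (use C in \<open>auto simp: norm_mult norm_mult_ext_torus\<close>)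
    show "AE \<omega> in torus. norm (bohr_lift a \<omega> * cnj (mult_ext \<omega> n)) \<le> C"
      using C by (auto simp: norm_mult norm_mult_ext_torus)
  qed
  finally show ?thesis .
qed

text \<open>
  The coefficient of the translated polynomial is bounded by its supremum over the torus, and that by
  point evaluation with \<open>norm (v j)\<close> equal to the \<open>j\<close>-th prime to the power \<open>- s\<close>.
\<close>

lemma coefficient_bound:
  assumes a: "a \<in> dirichlet_polys" and p: "0 < p" and s: "0 < s"
    and J: "\<And>n j. a n \<noteq> 0 \<Longrightarrow> nth_prime j dvd n \<Longrightarrow> j < J"
  shows "norm (a n) \<le> real n powr s * ((\<Prod>j<J. 1 / (1 - real (nth_prime j) powr (- s))) * hmean p a) powr (1 / p)"
proof (cases "n = 0")
  case True
  then show ?thesis using dirichlet_polysD(2)[OF a] by simp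
next
  case False
  let ?K = "\<Prod>j<J. 1 / (1 - real (nth_prime j) powr (- s))"
  have lt1: "real (nth_prime j) powr (- s) < 1" for j
    using s by (rule nth_prime_powr_less_one)
  have "norm (shift (of_real s) a n) \<le> (?K * hmean p a) powr (1 / p)"
  proof (rule coefficient_le_sup[OF shift_polys[OF a]])
    fix \<omega> assume \<omega>: "\<omega> \<in> space torus"
    let ?v = "\<lambda>j. \<omega> j * prime_powr (of_real s) j"
    have nv: "norm (?v j) = real (nth_prime j) powr (- s)" for j
      using \<omega> by (simp add: norm_mult norm_prime_powr space_torus)
    have "norm (bohr_lift a ?v) powr p \<le> (\<Prod>j<J. 1 / (1 - norm (?v j))) * hmean p a"
      by (rule point_evaluation[OF p J]) (use nv lt1 in auto)
    then have "(norm (bohr_lift a ?v) powr p) powr (1 / p) \<le> (?K * hmean p a) powr (1 / p)"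
      unfolding nv using p by (intro powr_mono2) auto
    then show "norm (bohr_lift (shift (of_real s) a) \<omega>) \<le> (?K * hmean p a) powr (1 / p)"
      using p by (simp add: shift_eq_twist[OF a] bohr_lift_twist[OF a] powr_powr)
  qed (use False in auto)
  then have "real n powr s * (norm (a n) * real n powr (- s)) \<le> real n powr s * (?K * hmean p a) powr (1 / p)"
    by (intro mult_left_mono) (auto simp: shift_def norm_mult norm_powr_real_powr)
  moreover have "real n powr s * (norm (a n) * real n powr (- s)) = norm (a n)"
    using False by (simp add: powr_minus field_simps)
  ultimately show ?thesis by simp
qed

text \<open>
  The product over all integers \<open>\<ge> 2\<close> in place of the primes telescopes.
\<close>

lemma euler_product_2_le: "(\<Prod>j<J. 1 / (1 - real (nth_prime j) powr (- 2))) \<le> 2"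
proof -
  have "(\<Prod>j<J. 1 / (1 - real (nth_prime j) powr (- 2))) \<le> 2 * (real J + 1) / (real J + 2)"
  proof (induction J)
    case (Suc J)
    have q: "real J + 2 \<le> real (nth_prime J)" using nth_prime_ge[of J] by linarith
    then have "real (nth_prime J) powr (-2) \<le> (real J + 2) powr (-2)" by (intro powr_mono2') auto
    also have "\<dots> = 1 / (real J + 2)^2" by (simp add: powr_minus powr_numeral field_simps)
    finally have "1 - 1 / (real J + 2)^2 \<le> 1 - real (nth_prime J) powr (-2)" by simp
    moreover have eq: "1 - 1 / (real J + 2)^2 = (real J + 1) * (real J + 3) / (real J + 2)^2"
    proof -
      have "1 - 1 / (real J + 2)^2 = ((real J + 2)^2 - 1) / (real J + 2)^2" by (simp add: diff_divide_distrib)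
      also have "(real J + 2)^2 - 1 = (real J + 1) * (real J + 3)" by (simp add: power2_eq_square algebra_simps)
      finally show ?thesis .
    qed
    ultimately have "1 / (1 - real (nth_prime J) powr (-2)) \<le> 1 / ((real J + 1) * (real J + 3) / (real J + 2)^2)"
      using nth_prime_powr_less_one[of 2 J] by (intro divide_left_mono mult_pos_pos) auto
    also have "\<dots> = (real J + 2)^2 / ((real J + 1) * (real J + 3))" by simp
    finally have 1: "1 / (1 - real (nth_prime J) powr (-2)) \<le> (real J + 2)^2 / ((real J + 1) * (real J + 3))" .
    have "(\<Prod>j<Suc J. 1 / (1 - real (nth_prime j) powr (- 2)))
       = (\<Prod>j<J. 1 / (1 - real (nth_prime j) powr (- 2))) * (1 / (1 - real (nth_prime J) powr (-2)))" by simp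
    also have "\<dots> \<le> (2 * (real J + 1) / (real J + 2)) * ((real J + 2)^2 / ((real J + 1) * (real J + 3)))"
    proof (rule mult_mono[OF Suc.IH 1])
      have "real (nth_prime J) powr (-2) < 1" by (rule nth_prime_powr_less_one) simp
      then show "0 \<le> 1 / (1 - real (nth_prime J) powr - 2)" by simp
    qed auto
    also have "\<dots> = 2 * (real J + 2) / (real J + 3)"
    proof -
      have *: "2 * x / y * (y^2 / (x * z)) = 2 * y / z" if "x \<noteq> 0" "y \<noteq> 0" for x y z :: real
        using that by (simp add: power2_eq_square)
      show ?thesis by (rule *) auto
    qed
    also have "\<dots> = 2 * (real (Suc J) + 1) / (real (Suc J) + 2)"
      by (simp add: add.commute)
    finally show ?case .
  qed simp
  also have "\<dots> \<le> 2" by (simp add: field_simps)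
  finally show ?thesis .
qed

lemma coefficient_bound_square:
  assumes a: "a \<in> dirichlet_polys" and p: "0 < p"
  shows "norm (a n) \<le> real n ^ 2 * (2 * hmean p a) powr (1 / p)"
proof -
  obtain J where J: "\<And>n. a n \<noteq> 0 \<Longrightarrow> n < J"
    using dirichlet_polysD(1)[OF a] unfolding finite_nat_set_iff_bounded by blast
  have J': "j < J" if "a n \<noteq> 0" "nth_prime j dvd n" for n j
  proof -
    have "0 < n" using that(1) dirichlet_polysD(2)[OF a] by (cases "n = 0") auto
    from nth_prime_dvd_less[OF this that(2)] J[OF that(1)] show ?thesis by simp
  qed
  have "norm (a n) \<le> real n powr 2 * ((\<Prod>j<J. 1 / (1 - real (nth_prime j) powr (- 2))) * hmean p a) powr (1 / p)"
    by (rule coefficient_bound[OF a p _ J']) auto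
  also have "\<dots> \<le> real n powr 2 * (2 * hmean p a) powr (1 / p)"
  proof (intro mult_left_mono powr_mono2 mult_right_mono euler_product_2_le hmean_nonneg mult_nonneg_nonneg prod_nonneg ballI)
    fix j
    have "real (nth_prime j) powr (- 2) < 1" by (rule nth_prime_powr_less_one) simp
    then show "0 \<le> 1 / (1 - real (nth_prime j) powr (- 2))" by simp
  qed (use p in auto)
  finally show ?thesis by (simp add: powr_numeral)
qed

section \<open>Compactness of horizontal translations\<close>

text \<open>
  Partial sums are dominated by a finite Euler product: expand the product of truncated geometric series.
\<close>

lemma summable_smooth_numbers:
  assumes s: "0 < s"
  shows "summable (\<lambda>n. if 0 < n \<and> (\<forall>j\<ge>d. \<not> nth_prime j dvd n) then real n powr (- s) else 0)"
proof (rule summableI_nonneg_bounded)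
  fix N
  let ?x = "\<lambda>j. real (nth_prime j) powr (- s)"
  let ?S = "{n. n < N \<and> 0 < n \<and> (\<forall>j\<ge>d. \<not> nth_prime j dvd n)}"
  let ?e = "\<lambda>n. \<lambda>j\<in>{..<d}. multiplicity (nth_prime j) n"
  have x: "0 \<le> ?x j" "?x j < 1" for j using nth_prime_powr_less_one[OF s] by auto
  have term_eq: "real n powr (- s) = (\<Prod>j\<in>{..<d}. ?x j ^ ?e n j)" if "n \<in> ?S" for n
  proof -
    have n: "0 < n" using that by simp
    have nd: "j < d" if "nth_prime j dvd n" for j using that \<open>n \<in> ?S\<close> by (metis (mono_tags, lifting) mem_Collect_eq not_le)
    have "real n powr (- s) = norm (mult_ext (prime_powr (of_real s)) n)"
      using n by (simp add: mult_ext_prime_powr norm_powr_real_powr)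
    also have "\<dots> = (\<Prod>j<d. ?x j ^ multiplicity (nth_prime j) n)"
      by (subst mult_ext_eq_prod[OF n nd]) (simp_all add: prod_norm[symmetric] norm_power norm_prime_powr)
    finally show ?thesis by simp
  qed
  have inj: "inj_on ?e ?S"
  proof (rule inj_onI)
    fix k n assume k: "k \<in> ?S" and n: "n \<in> ?S" and eq: "?e k = ?e n"
    show "k = n"
    proof (rule multiplicity_eq_nat)
      fix q :: nat assume "prime q"
      then obtain j where j: "nth_prime j = q" using nth_prime_surj by metis
      show "multiplicity q k = multiplicity q n"
      proof (cases "j < d")
        case True
        then show ?thesis using fun_cong[OF eq, of j] j by simp
      next
        case False
        then show ?thesis using k n j by (auto simp: not_dvd_imp_multiplicity_0)
      qed
    qed (use k n in auto)
  qed
  have sub: "?e ` ?S \<subseteq> PiE {..<d} (\<lambda>_. {..<N})"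
  proof -
    have "multiplicity (nth_prime j) n < N" if "n \<in> ?S" for n j
    proof -
      let ?k = "multiplicity (nth_prime j) n"
      have "?k < 2 ^ ?k" by (rule less_exp)
      also have "\<dots> \<le> nth_prime j ^ ?k" using nth_prime_ge[of j] by (intro power_mono) auto
      also have "\<dots> \<le> n" using that by (intro dvd_imp_le multiplicity_dvd) auto
      finally show ?thesis using that by simp
    qed
    then show ?thesis by (intro image_subsetI) (simp add: restrict_PiE_iff)
  qed
  have "(\<Sum>n<N. if 0 < n \<and> (\<forall>j\<ge>d. \<not> nth_prime j dvd n) then real n powr (- s) else 0)
      = (\<Sum>n\<in>?S. real n powr (- s))"
    by (rule sum.mono_neutral_cong_right) auto
  also have "\<dots> = (\<Sum>n\<in>?S. (\<Prod>j\<in>{..<d}. ?x j ^ ?e n j))" by (rule sum.cong[OF refl term_eq])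
  also have "\<dots> = (\<Sum>g\<in>?e ` ?S. (\<Prod>j\<in>{..<d}. ?x j ^ g j))" by (simp add: sum.reindex[OF inj])
  also have "\<dots> \<le> (\<Sum>g\<in>PiE {..<d} (\<lambda>_. {..<N}). (\<Prod>j\<in>{..<d}. ?x j ^ g j))"
    by (rule sum_mono2[OF _ sub]) (auto intro!: finite_PiE prod_nonneg)
  also have "\<dots> = (\<Prod>j\<in>{..<d}. \<Sum>e<N. ?x j ^ e)" by (rule prod_sum_PiE[symmetric]) auto
  also have "\<dots> \<le> (\<Prod>j\<in>{..<d}. 1 / (1 - ?x j))"
  proof (rule prod_mono)
    fix j
    have "(\<Sum>e<N. ?x j ^ e) = (1 - ?x j ^ N) / (1 - ?x j)" using x(2)[of j] by (simp add: one_diff_power_eq[of _ N])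
    also have "\<dots> \<le> 1 / (1 - ?x j)" using x[of j] by (intro divide_right_mono) auto
    finally show "0 \<le> (\<Sum>e<N. ?x j ^ e) \<and> (\<Sum>e<N. ?x j ^ e) \<le> 1 / (1 - ?x j)"
      by (simp add: sum_nonneg)
  qed
  finally show "(\<Sum>n<N. if 0 < n \<and> (\<forall>j\<ge>d. \<not> nth_prime j dvd n) then real n powr (- s) else 0)
      \<le> (\<Prod>j\<in>{..<d}. 1 / (1 - ?x j))" .
qed auto

lemma smooth_part_primes: "smooth_part d a n \<noteq> 0 \<Longrightarrow> nth_prime j dvd n \<Longrightarrow> j < d"
  by (metis smooth_part_def not_le)

text \<open>
  On finitely many primes the coefficients grow at most like \<open>n powr (x / 2)\<close>, so after translation
  by \<open>x\<close> they have a summable majorant and convergence of each coefficient suffices.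
\<close>

lemma smooth_part_shift_tendsto_zero:
  assumes p: "0 < p" and g: "\<And>k. g k \<in> dirichlet_polys" and M: "\<And>k. hmean p (g k) \<le> M"
    and lim: "\<And>n. (\<lambda>k. g k n) \<longlonglongrightarrow> 0" and x: "0 < x"
  shows "(\<lambda>k. hmean p (shift (of_real x) (smooth_part d (g k)))) \<longlonglongrightarrow> 0"
proof -
  let ?K = "\<Prod>j<d. 1 / (1 - real (nth_prime j) powr (- (x / 2)))"
  define C where "C = (?K * M) powr (1 / p)"
  have K: "0 \<le> ?K" by (intro prod_nonneg ballI) (use nth_prime_powr_less_one[of "x/2"] x in \<open>auto simp: less_imp_le\<close>)
  let ?b = "\<lambda>n k. norm (shift (of_real x) (smooth_part d (g k)) n)"
  let ?B = "\<lambda>n. C * (if 0 < n \<and> (\<forall>j\<ge>d. \<not> nth_prime j dvd n) then real n powr (- (x / 2)) else 0)"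
  have bound: "?b n k \<le> ?B n" for n k
  proof (cases "0 < n \<and> (\<forall>j\<ge>d. \<not> nth_prime j dvd n)")
    case True
    have "norm (smooth_part d (g k) n) \<le> real n powr (x / 2) * (?K * hmean p (smooth_part d (g k))) powr (1 / p)"
      by (rule coefficient_bound[OF smooth_part_polys[OF g] p _ smooth_part_primes]) (use x in auto)
    also have "\<dots> \<le> real n powr (x / 2) * C"
      unfolding C_def using K p hmean_smooth_part_le[OF g p, of d k] M[of k]
      by (intro mult_left_mono powr_mono2) (auto intro!: mult_left_mono mult_nonneg_nonneg hmean_nonneg)
    finally have "?b n k \<le> real n powr (x / 2) * C * real n powr (- x)"
      by (simp add: shift_def norm_mult norm_powr_real_powr mult_right_mono)
    also have "\<dots> = C * (real n powr (x / 2) * real n powr (- x))" by simp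
    also have "real n powr (x / 2) * real n powr (- x) = real n powr (- (x / 2))"
      by (simp add: powr_add[symmetric])
    finally show ?thesis using True by simp
  next
    case False
    then have "smooth_part d (g k) n = 0"
      using dirichlet_polysD(2)[OF g] by (cases "n = 0") (auto simp: smooth_part_def)
    then have b0: "?b n k = 0" by (simp add: shift_def)
    have B0: "?B n = 0" unfolding if_not_P[OF False] by simp
    show ?thesis unfolding b0 B0 by (rule order_refl)
  qed
  have sB: "summable ?B" using x by (intro summable_mult summable_smooth_numbers) auto
  have sb: "summable (\<lambda>n. ?b n k)" for k
    by (rule summable_comparison_test'[OF sB, of 0], unfold real_norm_def abs_norm_cancel, rule bound)
  have "(\<lambda>k. \<Sum>n. ?b n k) \<longlonglongrightarrow> (\<Sum>n::nat. (0::real))"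
  proof (rule tannerys_theorem[THEN conjunct2, THEN conjunct2])
    fix n
    show "(\<lambda>k. ?b n k) \<longlonglongrightarrow> 0"
    proof (rule tendsto_norm_zero)
      have "(\<lambda>k. g k n * of_nat n powr (- of_real x)) \<longlonglongrightarrow> 0 * of_nat n powr (- of_real x)"
        by (intro tendsto_mult lim tendsto_const)
      then show "(\<lambda>k. shift (of_real x) (smooth_part d (g k)) n) \<longlonglongrightarrow> 0"
        by (cases "\<exists>j\<ge>d. nth_prime j dvd n")
           (simp_all only: shift_def smooth_part_def if_True if_False mult_zero_left tendsto_const)
    qed
  next
    show "\<forall>\<^sub>F (n, k) in sequentially \<times>\<^sub>F sequentially. norm (?b n k) \<le> ?B n"
      using bound by (intro always_eventually) auto
  qed (use sB in auto)
  then have "(\<lambda>k. (\<Sum>n. ?b n k) powr p) \<longlonglongrightarrow> 0 powr p"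
    by (intro tendsto_powr' tendsto_const) (auto simp: p intro!: always_eventually suminf_nonneg sb)
  then have lim0: "(\<lambda>k. (\<Sum>n. ?b n k) powr p) \<longlonglongrightarrow> 0" by simp
  have le: "hmean p (shift (of_real x) (smooth_part d (g k))) \<le> (\<Sum>n. ?b n k) powr p" for k
  proof -
    have "(\<Sum>n. ?b n k) = (\<Sum>n | shift (of_real x) (smooth_part d (g k)) n \<noteq> 0. ?b n k)"
      by (rule suminf_finite) (auto intro!: dirichlet_polysD(1) shift_polys smooth_part_polys g)
    then show ?thesis using hmean_le[OF p] by simp
  qed
  show ?thesis
    by (rule tendsto_sandwich[OF _ _ tendsto_const lim0]) (use le hmean_nonneg in auto)
qed

text \<open>
  Compactness of the horizontal translation, in the form in which it is used: bounded sequences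
  with coefficients tending to \<open>0\<close> are mapped to null sequences.
\<close>

theorem hmean_shift_tendsto_zero:
  assumes p: "0 < p" and g: "\<And>k. g k \<in> dirichlet_polys" and M: "\<And>k. hmean p (g k) \<le> M"
    and lim: "\<And>n. (\<lambda>k. g k n) \<longlonglongrightarrow> 0" and x: "0 < x"
  shows "(\<lambda>k. hmean p (shift (of_real x) (g k))) \<longlonglongrightarrow> 0"
proof (rule tendstoI)
  fix e :: real assume e: "0 < e"
  define L where "L = 2 powr p * (2 powr p * M + 2 powr p * M)"
  have M0: "0 \<le> M" using hmean_nonneg M order_trans by blast
  have L: "0 \<le> L" unfolding L_def using M0 by simp
  have "(\<lambda>d. real (d + 2) powr (- (p * x)) * L) \<longlonglongrightarrow> 0 * L"
    using p x by (intro tendsto_mult tendsto_const tendsto_neg_powr filterlim_compose[OF filterlim_real_sequentially]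
       filterlim_add_const_nat_at_top) auto
  then have "\<forall>\<^sub>F d in sequentially. real (d + 2) powr (- (p * x)) * L < e / 2"
    using e by (intro order_tendstoD) auto
  \<comment> \<open>The prime with index \<open>d\<close> is at least \<open>d + 2\<close>, and \<open>L\<close> bounds the mean of the part of \<open>g k\<close> that is damped.\<close>
  then obtain d where d: "real (d + 2) powr (- (p * x)) * L < e / 2"
    by (auto simp: eventually_sequentially)
  have tail: "2 powr p * hmean p (shift (of_real x) (\<lambda>n. g k n - smooth_part d (g k) n)) < e / 2" for k
  proof -
    let ?h = "\<lambda>n. g k n - smooth_part d (g k) n"
    have h: "?h \<in> dirichlet_polys" by (intro dirichlet_polys_diff smooth_part_polys g)
    have "hmean p (shift (of_real x) ?h) \<le> real (d + 2) powr (- p * x) * hmean p ?h"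
    proof (rule hmean_shift_decay[OF h p])
      fix n assume n: "n < d + 2"
      show "?h n = 0"
      proof (cases "n = 0")
        case False
        then have "\<not> (\<exists>j\<ge>d. nth_prime j dvd n)"
          using n nth_prime_ge by (meson add_le_mono1 dvd_imp_le leD le_trans neq0_conv)
        then have "smooth_part d (g k) n = g k n" unfolding smooth_part_def by (rule if_not_P)
        then show ?thesis by simp
      qed (use dirichlet_polysD(2)[OF h] in simp)
    qed (use x in auto)
    also have "hmean p ?h \<le> 2 powr p * M + 2 powr p * M"
    proof -
      have "(\<lambda>n::nat. 0::complex) \<in> dirichlet_polys" by (simp add: dirichlet_polys_def)
      from hmean_triangle[OF p g this smooth_part_polys[OF g], of k d k]
      have "hmean p ?h \<le> 2 powr p * hmean p (g k) + 2 powr p * hmean p (smooth_part d (g k))"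
        by (simp add: hmean_uminus)
      also have "\<dots> \<le> 2 powr p * M + 2 powr p * M"
        using M[of k] hmean_smooth_part_le[OF g p, of d k] by (intro add_mono mult_left_mono) auto
      finally show ?thesis .
    qed
    finally have "hmean p (shift (of_real x) ?h) \<le> real (d + 2) powr (- (p * x)) * (2 powr p * M + 2 powr p * M)"
      by (simp add: mult_left_mono)
    then have "2 powr p * hmean p (shift (of_real x) ?h) \<le> real (d + 2) powr (- (p * x)) * L"
      unfolding L_def using mult_left_mono[of _ _ "2 powr p"] by (simp add: mult_ac)
    with d show ?thesis by linarith
  qed
  have "(\<lambda>k. 2 powr p * hmean p (shift (of_real x) (smooth_part d (g k)))) \<longlonglongrightarrow> 2 powr p * 0"
    by (intro tendsto_mult tendsto_const smooth_part_shift_tendsto_zero[OF p g M lim x])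
  from order_tendstoD(2)[OF this, of "e / 2"] e
  have "\<forall>\<^sub>F k in sequentially. 2 powr p * hmean p (shift (of_real x) (smooth_part d (g k))) < e / 2"
    by simp
  then show "\<forall>\<^sub>F k in sequentially. dist (hmean p (shift (of_real x) (g k))) 0 < e"
  proof eventually_elim
    case (elim k)
    let ?h = "\<lambda>n. g k n - smooth_part d (g k) n"
    have h: "?h \<in> dirichlet_polys" by (intro dirichlet_polys_diff smooth_part_polys g)
    have "(\<lambda>n. shift (of_real x) ?h n + shift (of_real x) (smooth_part d (g k)) n) = shift (of_real x) (g k)"
      by (auto simp: shift_def fun_eq_iff ring_distribs)
    with hmean_add_le[OF p zero_less_one shift_polys[OF h] shift_polys[OF smooth_part_polys[OF g]], of "of_real x" "of_real x" d k]
    have "hmean p (shift (of_real x) (g k))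
       \<le> 2 powr p * hmean p (shift (of_real x) ?h) + 2 powr p * hmean p (shift (of_real x) (smooth_part d (g k)))"
      by simp
    also have "\<dots> < e" using tail[of k] elim by linarith
    finally show ?case using hmean_nonneg by simp
  qed
qed

section \<open>Elements of the Hardy spaces\<close>

text \<open>
  The Cauchy condition of the completion, in terms of \<open>p\<close>-th powers of norms.
\<close>

definition hcauchy :: "real \<Rightarrow> (nat \<Rightarrow> nat \<Rightarrow> complex) \<Rightarrow> bool" where
  "hcauchy p P \<longleftrightarrow> (\<forall>k. P k \<in> dirichlet_polys) \<and>
     (\<forall>\<epsilon>>0. \<exists>K. \<forall>j\<ge>K. \<forall>k\<ge>K. hmean p (\<lambda>n. P j n - P k n) < \<epsilon>)"

lemma hcauchyD:
  assumes "hcauchy p P"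
  shows "P k \<in> dirichlet_polys" "0 < \<epsilon> \<Longrightarrow> \<exists>K. \<forall>j\<ge>K. \<forall>k\<ge>K. hmean p (\<lambda>n. P j n - P k n) < \<epsilon>"
  using assms by (auto simp: hcauchy_def)

lemma approximates_iff:
  assumes p: "0 < p"
  shows "approximates p P a \<longleftrightarrow> hcauchy p P \<and> (\<forall>n. (\<lambda>k. P k n) \<longlonglongrightarrow> a n)"
proof -
  have *: "poly_norm p b < e \<longleftrightarrow> hmean p b < e powr p" if "0 < e" for b e
  proof -
    have pos: "0 \<le> poly_norm p b" by (simp add: poly_norm_eq)
    have "poly_norm p b < e \<longleftrightarrow> poly_norm p b powr p < e powr p"
      using powr_less_mono2[OF p pos, of e] powr_mono2[of p e "poly_norm p b"] p that
      by (auto simp: not_less[symmetric])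
    then show ?thesis using p by (simp add: poly_norm_eq powr_powr hmean_nonneg)
  qed
  have "(\<forall>\<epsilon>>0. \<exists>K. \<forall>j\<ge>K. \<forall>k\<ge>K. poly_norm p (\<lambda>n. P j n - P k n) < \<epsilon>)
     \<longleftrightarrow> (\<forall>\<epsilon>>0. \<exists>K. \<forall>j\<ge>K. \<forall>k\<ge>K. hmean p (\<lambda>n. P j n - P k n) < \<epsilon>)" (is "?L \<longleftrightarrow> ?R")
  proof
    assume L: ?L
    show ?R
    proof (intro allI impI)
      fix e :: real assume e: "0 < e"
      then have "0 < e powr (1 / p)" by simp
      with L obtain K where "\<forall>j\<ge>K. \<forall>k\<ge>K. poly_norm p (\<lambda>n. P j n - P k n) < e powr (1 / p)" by blast
      then show "\<exists>K. \<forall>j\<ge>K. \<forall>k\<ge>K. hmean p (\<lambda>n. P j n - P k n) < e"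
        using p e by (auto simp: * powr_powr intro!: exI[of _ K])
    qed
  next
    assume R: ?R
    show ?L
    proof (intro allI impI)
      fix e :: real assume e: "0 < e"
      then have "0 < e powr p" by simp
      with R obtain K where "\<forall>j\<ge>K. \<forall>k\<ge>K. hmean p (\<lambda>n. P j n - P k n) < e powr p" by blast
      then show "\<exists>K. \<forall>j\<ge>K. \<forall>k\<ge>K. poly_norm p (\<lambda>n. P j n - P k n) < e"
        using e by (auto simp: * intro!: exI[of _ K])
    qed
  qed
  then show ?thesis unfolding approximates_def hcauchy_def by auto
qed

lemma hcauchy_bounded:
  assumes "hcauchy p P" "0 < p" shows "\<exists>B. \<forall>k. hmean p (P k) \<le> B"
proof -
  note P = hcauchyD(1)[OF assms(1)]
  obtain K where K: "\<And>j k. K \<le> j \<Longrightarrow> K \<le> k \<Longrightarrow> hmean p (\<lambda>n. P j n - P k n) < 1"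
    using hcauchyD(2)[OF assms(1) zero_less_one] by blast
  let ?B = "2 powr p * hmean p (P K) + 2 powr p * 1 + (\<Sum>k<K. hmean p (P k))"
  have "hmean p (P k) \<le> ?B" for k
  proof (cases "k < K")
    case True
    then have "hmean p (P k) \<le> (\<Sum>k<K. hmean p (P k))"
      using hmean_nonneg by (intro member_le_sum) auto
    then show ?thesis using hmean_nonneg[of p "P K"] by (simp add: add_increasing)
  next
    case False
    have "hmean p (P k) \<le> 2 powr p * hmean p (P K) + 2 powr p * hmean p (\<lambda>n. P k n - P K n)"
      using hmean_diff_le[OF assms(2) zero_less_one P P, of k K] by simp
    also have "\<dots> \<le> 2 powr p * hmean p (P K) + 2 powr p * 1"
      using K[of k K] False by (intro add_mono mult_left_mono) auto
    also have "\<dots> \<le> ?B" using hmean_nonneg by (simp add: sum_nonneg)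
    finally show ?thesis .
  qed
  then show ?thesis by blast
qed

lemma hcauchy_hmean_convergent:
  assumes P: "hcauchy p P" and p: "0 < p" shows "convergent (\<lambda>k. hmean p (P k))"
proof -
  obtain B where B: "\<And>k. hmean p (P k) \<le> B" using hcauchy_bounded[OF P p] by blast
  have "((\<lambda>i. hmean p (\<lambda>n. P (fst i) n - P (snd i) n)) \<longlongrightarrow> 0) (sequentially \<times>\<^sub>F sequentially)"
  proof (rule tendstoI)
    fix e :: real assume "0 < e"
    from hcauchyD(2)[OF P this]
    show "\<forall>\<^sub>F i in sequentially \<times>\<^sub>F sequentially. dist (hmean p (\<lambda>n. P (fst i) n - P (snd i) n)) 0 < e"
      unfolding eventually_prod_sequentially using hmean_nonneg by (auto 4 3)
  qed
  from hmean_merge[OF p hcauchyD(1)[OF P] hcauchyD(1)[OF P] B this]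
  have lim: "((\<lambda>i. hmean p (P (fst i)) - hmean p (P (snd i))) \<longlongrightarrow> 0) (sequentially \<times>\<^sub>F sequentially)" .
  have "Cauchy (\<lambda>k. hmean p (P k))"
  proof (rule CauchyI)
    fix e :: real assume "0 < e"
    from tendstoD[OF lim this] obtain N where "\<forall>m\<ge>N. \<forall>n\<ge>N. dist (hmean p (P n) - hmean p (P m)) 0 < e"
      unfolding eventually_prod_sequentially by auto
    then show "\<exists>M. \<forall>m\<ge>M. \<forall>n\<ge>M. norm (hmean p (P m) - hmean p (P n)) < e"
      by (intro exI[of _ N]) (auto simp: dist_real_def)
  qed
  then show ?thesis by (simp add: Cauchy_convergent_iff)
qed

text \<open>
  Weighting the terms by \<open>2 ^ k\<close> keeps the sum integrable and makes it control every term geometrically.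
\<close>

lemma fast_AE_bound:
  assumes f [measurable]: "\<And>k::nat. f k \<in> borel_measurable M" and le: "\<And>k. (\<integral>\<^sup>+x. f k x \<partial>M) \<le> ennreal ((1/4) ^ k)"
  shows "AE x in M. \<exists>C\<ge>0. \<forall>k. f k x \<le> ennreal (C * (1/2) ^ k)"
proof -
  have "(\<integral>\<^sup>+x. (\<Sum>k. 2 ^ k * f k x) \<partial>M) = (\<Sum>k. 2 ^ k * (\<integral>\<^sup>+x. f k x \<partial>M))"
    by (simp add: nn_integral_suminf nn_integral_cmult)
  also have "\<dots> \<le> (\<Sum>k. ennreal ((1/2) ^ k))"
  proof (intro suminf_le summableI)
    fix k :: nat
    have "2 ^ k * (\<integral>\<^sup>+x. f k x \<partial>M) \<le> ennreal (2 ^ k) * ennreal ((1/4) ^ k)"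
      using le[of k] by (simp add: ennreal_power[symmetric] mult_left_mono)
    also have "\<dots> = ennreal ((1/2) ^ k)"
      by (simp add: ennreal_mult'[symmetric] power_mult_distrib[symmetric])
    finally show "2 ^ k * (\<integral>\<^sup>+x. f k x \<partial>M) \<le> ennreal ((1/2) ^ k)" .
  qed
  also have "\<dots> < \<infinity>"
    by (subst suminf_ennreal2) (auto intro!: summable_geometric)
  finally have "(\<integral>\<^sup>+x. (\<Sum>k. 2 ^ k * f k x) \<partial>M) \<noteq> \<infinity>" by simp
  then have "AE x in M. (\<Sum>k. 2 ^ k * f k x) \<noteq> \<infinity>" by (intro nn_integral_PInf_AE) measurable
  then show ?thesis
  proof eventually_elim
    case (elim x)
    then obtain C where C: "(\<Sum>k. 2 ^ k * f k x) = ennreal C" "0 \<le> C"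
      by (cases "(\<Sum>k. 2 ^ k * f k x)") auto
    have "f k x \<le> ennreal (C * (1/2) ^ k)" for k
    proof -
      have "2 ^ k * f k x \<le> ennreal C"
        unfolding C(1)[symmetric] using sum_le_suminf[OF summableI, of "{k}" "\<lambda>k. 2 ^ k * f k x"] by simp
      then have "ennreal ((1/2) ^ k) * (2 ^ k * f k x) \<le> ennreal ((1/2) ^ k) * ennreal C"
        by (rule mult_left_mono) simp
      moreover have "ennreal ((1/2) ^ k) * (2 ^ k * f k x) = f k x"
      proof -
        have "ennreal ((1/2) ^ k) * 2 ^ k = ennreal ((1/2) ^ k * 2 ^ k)"
          by (simp add: ennreal_mult' ennreal_power[symmetric])
        also have "\<dots> = 1" by (simp add: power_mult_distrib[symmetric])
        finally show ?thesis by (simp add: mult.assoc[symmetric])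
      qed
      ultimately show ?thesis using C(2) by (simp add: ennreal_mult'[symmetric] mult.commute)
    qed
    with C(2) show ?case by blast
  qed
qed

lemma fast_subsequence:
  assumes "\<And>k. \<exists>K::nat. \<forall>i\<ge>K. \<forall>j\<ge>K. D k i j"
  shows "\<exists>r. strict_mono r \<and> (\<forall>k. D k (r (Suc k)) (r k))"
proof -
  obtain K where K: "\<And>k i j. K k \<le> i \<Longrightarrow> K k \<le> j \<Longrightarrow> D k i j" using assms by metis
  have "\<exists>r. \<forall>k. K k \<le> r k \<and> r k < r (Suc k)"
  proof (rule dependent_nat_choice)
    show "\<exists>x. K (Suc k) \<le> x \<and> y < x" for y k
      by (rule exI[of _ "max (Suc y) (K (Suc k))"]) auto
  qed auto
  then obtain r where r: "\<And>k. K k \<le> r k" "\<And>k. r k < r (Suc k)" by blast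
  have "D k (r (Suc k)) (r k)" for k
    using K[of k "r (Suc k)" "r k"] r[of k] by simp
  then show ?thesis using r(2) by (intro exI[of _ r]) (auto intro: strict_monoI_Suc)
qed

section \<open>Vertical limits of elements of the Hardy spaces\<close>

lemma uniform_limit_telescoping:
  fixes f :: "nat \<Rightarrow> 'a \<Rightarrow> 'b :: banach"
  assumes M: "\<And>k x. x \<in> A \<Longrightarrow> norm (f (Suc k) x - f k x) \<le> M k" and "summable M"
  shows "uniform_limit A f (\<lambda>x. lim (\<lambda>k. f k x)) sequentially"
proof -
  let ?l = "\<lambda>x. \<Sum>k. f (Suc k) x - f k x"
  have "uniform_limit A (\<lambda>n x. \<Sum>k<n. f (Suc k) x - f k x) ?l sequentially"
    by (rule Weierstrass_m_test) (use assms in auto)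
  moreover have "(\<Sum>k<n. f (Suc k) x - f k x) = f n x - f 0 x" for n x
    by (rule sum_lessThan_telescope)
  ultimately have "uniform_limit A (\<lambda>n x. f n x - f 0 x) ?l sequentially" by simp
  then have "uniform_limit A (\<lambda>n x. (f n x - f 0 x) + f 0 x) (\<lambda>x. ?l x + f 0 x) sequentially"
    by (intro uniform_limit_intros)
  then have "uniformly_convergent_on A f"
    by (auto simp: uniformly_convergent_on_def)
  then show ?thesis by (simp only: uniformly_convergent_uniform_limit_iff)
qed

lemma hmean_shift_le:
  assumes a: "a \<in> dirichlet_polys" and p: "0 < p" and x: "0 \<le> x"
  shows "hmean p (shift (of_real x) a) \<le> hmean p a"
  using hmean_shift_decay[OF a p zero_less_one _ x] dirichlet_polysD(2)[OF a] by simp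

text \<open>
  The average of the \<open>p\<close>-th power of the modulus over the circle with centre \<open>R\<close> and radius \<open>R\<close>, which
  touches the imaginary axis and stays in the closed right half-plane.
\<close>

definition disc_mean :: "real \<Rightarrow> real \<Rightarrow> (nat \<Rightarrow> complex) \<Rightarrow> (nat \<Rightarrow> complex) \<Rightarrow> ennreal" where
  "disc_mean p R a \<omega> = (\<integral>\<^sup>+t. ennreal (norm (bohr_lift (shift (of_real R + of_real R * cis (2 * pi * t)) a) \<omega>) powr p)
     * indicator {0..1} t \<partial>lborel)"

lemma disc_mean_measurable:
  assumes a: "a \<in> dirichlet_polys" shows "disc_mean p R a \<in> borel_measurable torus"
proof -
  let ?s = "\<lambda>t. of_real R + of_real R * cis (2 * pi * t)"
  have [measurable]: "(\<lambda>t. of_nat n powr (- ?s t)) \<in> borel_measurable borel" for n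
    by (intro borel_measurable_continuous_onI continuous_intros; simp)
  show ?thesis
    unfolding disc_mean_def[abs_def] bohr_lift_shift[OF a]
    by (rule lborel.borel_measurable_nn_integral) (unfold split_beta, measurable)
qed

lemma nn_integral_disc_mean_le:
  assumes a: "a \<in> dirichlet_polys" and p: "0 < p" and R: "0 \<le> R"
  shows "(\<integral>\<^sup>+\<omega>. disc_mean p R a \<omega> \<partial>torus) \<le> ennreal (hmean p a)"
proof -
  have "(\<integral>\<^sup>+\<omega>. disc_mean p R a \<omega> \<partial>torus)
      = (\<integral>\<^sup>+t. ennreal (hmean p (shift (of_real (R + R * cos (2 * pi * t))) a)) * indicator {0..1} t \<partial>lborel)"
    unfolding disc_mean_def using nn_integral_circle_shift[OF a p zero_less_one, of "of_real R" R] by simp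
  also have "\<dots> \<le> (\<integral>\<^sup>+t. ennreal (hmean p a) * indicator {0..1::real} t \<partial>lborel)"
  proof (intro nn_integral_mono mult_right_mono ennreal_leI hmean_shift_le a p)
    fix t
    have "R * (- 1) \<le> R * cos (2 * pi * t)" using R by (intro mult_left_mono) auto
    then show "0 \<le> R + R * cos (2 * pi * t)" by simp
  qed auto
  also have "\<dots> = ennreal (hmean p a)" by (simp add: nn_integral_cmult)
  finally show ?thesis .
qed

text \<open>
  The smaller disc has radius \<open>R - 1 / R\<close>, so in the unit disc its points have modulus at most
  \<open>1 - 1 / R\<^sup>2\<close>.
\<close>

lemma disc_sup_le_disc_mean:
  assumes a: "a \<in> dirichlet_polys" and p: "0 < p" and R: "1 \<le> R" and s: "s \<in> cball (of_real R) (R - 1 / R)"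
  shows "ennreal (norm (bohr_lift (shift s a) \<omega>) powr p) \<le> ennreal (R\<^sup>2) * disc_mean p R a \<omega>"
proof -
  define w where "w = (s - of_real R) / of_real R"
  have R0: "0 < R" using R by simp
  have "norm w \<le> (R - 1 / R) / R"
    using s R0 by (simp add: w_def norm_divide dist_norm norm_minus_commute divide_right_mono)
  also have "\<dots> = 1 - 1 / R\<^sup>2" using R0 by (simp add: field_simps power2_eq_square)
  finally have nw: "norm w \<le> 1 - 1 / R\<^sup>2" .
  then have "1 / (1 - norm w) \<le> 1 / (1 / R\<^sup>2)" using R0 by (intro frac_le) auto
  then have inv: "1 / (1 - norm w) \<le> R\<^sup>2" by simp
  have w1: "norm w < 1" using nw R0 by (smt (verit) divide_pos_pos zero_less_power)
  have sw: "of_real R + of_real R * w = s" using R0 by (simp add: w_def)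
  have "(\<lambda>z. bohr_lift (shift (of_real R + of_real R * z) a) \<omega>) holomorphic_on UNIV"
    using norm_mult_powr_shift_holomorphic[OF a, of 1] by simp
  from entire_powr_circle_bound_nn[OF this w1 p]
  have "ennreal (norm (bohr_lift (shift s a) \<omega>) powr p) \<le> ennreal (1 / (1 - norm w)) * disc_mean p R a \<omega>"
    by (simp only: sw disc_mean_def)
  also have "\<dots> \<le> ennreal (R\<^sup>2) * disc_mean p R a \<omega>"
    using inv by (intro mult_right_mono ennreal_leI) auto
  finally show ?thesis .
qed

text \<open>
  The radius \<open>R - 1 / R\<close> is large enough for these discs to exhaust the half-plane as \<open>R\<close> grows.
\<close>

lemma disc_exhaustion:
  assumes "s \<in> half_plane"
  shows "\<exists>N. s \<in> ball (of_real (real (Suc N))) (real (Suc N) - 1 / real (Suc N))"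
proof -
  have s: "0 < Re s" using assms by (simp add: half_plane_def)
  obtain N :: nat where N: "((norm s)\<^sup>2 + 2) / (2 * Re s) < real N" using reals_Archimedean2 by blast
  define R where "R = real (Suc N)"
  have R: "1 \<le> R" by (simp add: R_def)
  have "((norm s)\<^sup>2 + 2) / (2 * Re s) < R" using N by (simp add: R_def)
  then have R2: "(norm s)\<^sup>2 + 2 < 2 * R * Re s" using s by (simp add: field_simps)
  have "(norm (s - of_real R))\<^sup>2 = R\<^sup>2 - 2 * R * Re s + (norm s)\<^sup>2"
    by (simp add: cmod_power2 power2_diff)
  also have "\<dots> < R\<^sup>2 - 2 + 1 / R\<^sup>2" using R2 R by (smt (verit) divide_pos_pos zero_less_power)
  also have "\<dots> = (R - 1 / R)\<^sup>2" using R by (simp add: power2_diff power_divide)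
  finally have "(norm (s - of_real R))\<^sup>2 < (R - 1 / R)\<^sup>2" .
  moreover have "0 \<le> R - 1 / R" using R by (simp add: field_simps) (metis mult_mono' order_trans mult_1 zero_le_one)
  ultimately have "norm (s - of_real R) < R - 1 / R" by (rule power2_less_imp_less)
  then show ?thesis by (intro exI[of _ N]) (simp add: R_def dist_norm norm_minus_commute)
qed

lemma disc_subset_half_plane: "1 \<le> R \<Longrightarrow> ball (of_real R) (R - 1 / R) \<subseteq> half_plane"
proof
  fix s :: complex assume R: "1 \<le> R" and "s \<in> ball (of_real R) (R - 1 / R)"
  then have "norm (of_real R - s) < R - 1 / R" by (simp add: dist_norm)
  moreover have "R - Re s \<le> norm (of_real R - s)" using complex_Re_le_cmod[of "of_real R - s"] by simp
  moreover have "0 < 1 / R" using R by simp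
  ultimately show "s \<in> half_plane" unfolding half_plane_def mem_Collect_eq by linarith
qed

text \<open>
  Coefficients are \<open>O(n\<^sup>2)\<close> uniformly in \<open>k\<close>, so dominated convergence of the series holds far to the
  right.
\<close>

lemma dirichlet_series_limit:
  assumes p: "0 < p" and P: "\<And>k. P k \<in> dirichlet_polys" and B: "\<And>k. hmean p (P k) \<le> B"
    and lim: "\<And>n. (\<lambda>k. P k n) \<longlonglongrightarrow> a n" and \<omega>: "\<omega> \<in> space torus" and s: "4 < Re s"
    and g: "(\<lambda>k. bohr_lift (shift s (P k)) \<omega>) \<longlonglongrightarrow> g"
  shows "(\<lambda>n. a n * mult_ext \<omega> n * of_nat n powr (- s)) sums g"
proof -
  define C where "C = (2 * B) powr (1 / p)"
  let ?a = "\<lambda>n k. P k n * mult_ext \<omega> n * of_nat n powr (- s)"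
  let ?b = "\<lambda>n. a n * mult_ext \<omega> n * of_nat n powr (- s)"
  let ?M = "\<lambda>n. C * real n powr (- 2)"
  have B0: "0 \<le> B" using B hmean_nonneg order_trans by blast
  have bound: "norm (?a n k) \<le> ?M n" for n k
  proof (cases "n = 0")
    case True
    then show ?thesis using dirichlet_polysD(2)[OF P] by simp
  next
    case False
    have "norm (P k n) \<le> real n ^ 2 * (2 * hmean p (P k)) powr (1 / p)" by (rule coefficient_bound_square[OF P p])
    also have "\<dots> \<le> real n ^ 2 * C"
      unfolding C_def using B[of k] p hmean_nonneg by (intro mult_left_mono powr_mono2) auto
    finally have "norm (?a n k) \<le> real n ^ 2 * C * real n powr (- Re s)"
      using \<omega> by (simp add: norm_mult norm_mult_ext_torus norm_powr_real_powr mult_right_mono)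
    also have "\<dots> \<le> real n ^ 2 * C * real n powr (- 4)"
      using False s by (intro mult_left_mono powr_mono) (auto simp: C_def)
    also have "\<dots> = C * (real n powr 2 * real n powr (- 4))" using False by (simp add: powr_numeral)
    also have "real n powr 2 * real n powr (- 4) = real n powr (- 2)" by (subst powr_add[symmetric]) simp
    finally show ?thesis .
  qed
  have sM: "summable ?M" by (intro summable_mult) (simp add: summable_real_powr_iff)
  have tan: "summable (\<lambda>n. norm (?b n)) \<and> (\<lambda>k. \<Sum>n. ?a n k) \<longlonglongrightarrow> (\<Sum>n. ?b n)"
  proof (rule tannerys_theorem[THEN conjunct2])
    show "(\<lambda>k. ?a n k) \<longlonglongrightarrow> ?b n" for n by (intro tendsto_mult lim tendsto_const)
    show "\<forall>\<^sub>F (n, k) in sequentially \<times>\<^sub>F sequentially. norm (?a n k) \<le> ?M n"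
      using bound by (intro always_eventually) auto
  qed (use sM in auto)
  have "(\<Sum>n. ?a n k) = bohr_lift (shift s (P k)) \<omega>" for k
    unfolding bohr_lift_shift[OF P] by (rule suminf_finite) (use dirichlet_polysD(1)[OF P] in auto)
  then have "(\<Sum>n. ?b n) = g" using tan g LIMSEQ_unique by auto
  then show ?thesis using tan summable_norm_cancel summable_sums by fastforce
qed

lemma power_powr_commute: "0 \<le> (x::real) \<Longrightarrow> (x ^ k) powr q = (x powr q) ^ k"
  by (induction k) (auto simp: powr_mult)

text \<open>
  Along a rapidly converging subsequence, for almost every \<open>\<omega>\<close> the differences are geometrically small
  on each disc of the exhaustion, because the disc means have small integrals over the torus. The limit
  is holomorphic in the half-plane and equals the Dirichlet series far to the right.
\<close>

theorem hardy_vertical_limit_AE: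
  assumes p: "0 < p" and P: "hcauchy p P" and lim: "\<And>n. (\<lambda>k. P k n) \<longlonglongrightarrow> a n"
  obtains r where "strict_mono r"
    "AE \<omega> in torus. \<exists>g. analytic_extension (\<lambda>n. a n * mult_ext \<omega> n) g \<and>
        (\<forall>s\<in>half_plane. (\<lambda>k. bohr_lift (shift s (P (r k))) \<omega>) \<longlonglongrightarrow> g s)"
proof -
  note poly = hcauchyD(1)[OF P]
  obtain B where B: "\<And>k. hmean p (P k) \<le> B" using hcauchy_bounded[OF P p] by blast
  have "\<exists>K. \<forall>i\<ge>K. \<forall>j\<ge>K. hmean p (\<lambda>n. P i n - P j n) < (1/4) ^ k" for k :: nat
    by (rule hcauchyD(2)[OF P]) simp
  from fast_subsequence[of "\<lambda>k i j. hmean p (\<lambda>n. P i n - P j n) < (1/4) ^ k", OF this]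
  obtain r where r: "strict_mono r" and fast: "\<And>k. hmean p (\<lambda>n. P (r (Suc k)) n - P (r k) n) < (1/4) ^ k"
    by blast
  let ?d = "\<lambda>k n. P (r (Suc k)) n - P (r k) n"
  have d: "?d k \<in> dirichlet_polys" for k by (intro dirichlet_polys_diff poly)
  have "AE \<omega> in torus. \<forall>N. \<exists>C\<ge>0. \<forall>k. disc_mean p (real (Suc N)) (?d k) \<omega> \<le> ennreal (C * (1/2) ^ k)"
  proof (intro AE_all_countable[THEN iffD2] allI fast_AE_bound disc_mean_measurable d)
    fix N k
    show "(\<integral>\<^sup>+\<omega>. disc_mean p (real (Suc N)) (?d k) \<omega> \<partial>torus) \<le> ennreal ((1/4) ^ k)"
      using nn_integral_disc_mean_le[OF d p, of "real (Suc N)" k] fast[of k]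
      by (auto intro: order_trans ennreal_leI less_imp_le)
  qed
  then have "AE \<omega> in torus. \<exists>g. analytic_extension (\<lambda>n. a n * mult_ext \<omega> n) g \<and>
        (\<forall>s\<in>half_plane. (\<lambda>k. bohr_lift (shift s (P (r k))) \<omega>) \<longlonglongrightarrow> g s)"
    using AE_space
  proof eventually_elim
    case (elim \<omega>)
    let ?f = "\<lambda>k s. bohr_lift (shift s (P (r k))) \<omega>"
    define g where "g s = lim (\<lambda>k. ?f k s)" for s
    let ?A = "\<lambda>N. cball (of_real (real (Suc N)) :: complex) (real (Suc N) - 1 / real (Suc N))"
    have unif: "uniform_limit (?A N) ?f g sequentially" for N
    proof -
      obtain C where C: "0 \<le> C" "\<And>k. disc_mean p (real (Suc N)) (?d k) \<omega> \<le> ennreal (C * (1/2) ^ k)"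
        using elim by blast
      define D where "D = (real (Suc N))\<^sup>2 * C"
      show ?thesis
        unfolding g_def
      proof (rule uniform_limit_telescoping)
        fix k s assume s: "s \<in> ?A N"
        have "ennreal (norm (bohr_lift (shift s (?d k)) \<omega>) powr p)
            \<le> ennreal ((real (Suc N))\<^sup>2) * disc_mean p (real (Suc N)) (?d k) \<omega>"
          by (rule disc_sup_le_disc_mean[OF d p _ s]) simp
        also have "\<dots> \<le> ennreal ((real (Suc N))\<^sup>2) * ennreal (C * (1/2) ^ k)"
          by (rule mult_left_mono[OF C(2)]) simp
        also have "\<dots> = ennreal (D * (1/2) ^ k)" by (simp add: D_def ennreal_mult'[symmetric] mult.assoc)
        finally have "norm (bohr_lift (shift s (?d k)) \<omega>) powr p \<le> D * (1/2) ^ k"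
          using C(1) by (simp add: D_def)
        then have "(norm (bohr_lift (shift s (?d k)) \<omega>) powr p) powr (1 / p) \<le> (D * (1/2) ^ k) powr (1 / p)"
          using p by (intro powr_mono2) auto
        also have "\<dots> = D powr (1 / p) * ((1/2) powr (1 / p)) ^ k"
          using C(1) by (subst powr_mult) (auto simp: D_def power_powr_commute simp del: power_one_over)
        finally have "norm (bohr_lift (shift s (?d k)) \<omega>) \<le> D powr (1 / p) * ((1/2) powr (1 / p)) ^ k"
          using p by (simp add: powr_powr)
        then show "norm (?f (Suc k) s - ?f k s) \<le> D powr (1 / p) * ((1/2) powr (1 / p)) ^ k"
          by (simp add: shift_diff bohr_lift_diff shift_polys poly)
      next
        have "(1/2) powr (1 / p) < (1::real)" using p by (simp add: powr01_less_one)
        then show "summable (\<lambda>k. D powr (1 / p) * ((1/2) powr (1 / p)) ^ k)"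
          by (intro summable_mult summable_geometric) simp
      qed
    qed
    have conv: "(\<lambda>k. ?f k s) \<longlonglongrightarrow> g s" if s: "s \<in> half_plane" for s
    proof -
      obtain N where "s \<in> ball (of_real (real (Suc N))) (real (Suc N) - 1 / real (Suc N))"
        using disc_exhaustion[OF s] by blast
      then show ?thesis by (intro tendsto_uniform_limitI[OF unif[of N]]) (use ball_subset_cball in blast)
    qed
    have "g holomorphic_on half_plane"
    proof (rule holomorphic_uniform_sequence)
      show "open half_plane" by (simp add: half_plane_def open_halfspace_Re_gt)
      show "?f k holomorphic_on half_plane" for k by (rule bohr_lift_shift_holomorphic[OF poly])
      fix s assume s: "s \<in> half_plane"
      let ?b = "\<lambda>N. ball (of_real (real (Suc N)) :: complex) (real (Suc N) - 1 / real (Suc N))"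
      obtain N where N: "s \<in> ?b N" using disc_exhaustion[OF s] by blast
      then obtain e where e: "0 < e" "cball s e \<subseteq> ?b N"
        using open_contains_cball[THEN iffD1, OF open_ball, THEN bspec, OF N] by blast
      have "?b N \<subseteq> half_plane" by (rule disc_subset_half_plane) simp
      moreover have "uniform_limit (cball s e) ?f g sequentially"
        by (rule uniform_limit_on_subset[OF unif[of N]]) (use e ball_subset_cball in blast)
      ultimately show "\<exists>e>0. cball s e \<subseteq> half_plane \<and> uniform_limit (cball s e) ?f g sequentially"
        using e by blast
    qed
    moreover have sums: "(\<lambda>n. a n * mult_ext \<omega> n * of_nat n powr (- s)) sums g s" if s: "4 < Re s" for s
    proof (rule dirichlet_series_limit[OF p poly B _ _ s])
      show "(\<lambda>k. P (r k) n) \<longlonglongrightarrow> a n" for n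
        using LIMSEQ_subseq_LIMSEQ[OF lim r] by (simp add: o_def)
      show "(\<lambda>k. ?f k s) \<longlonglongrightarrow> g s" using s by (intro conv) (simp add: half_plane_def)
    qed (use elim in auto)
    ultimately have "analytic_extension (\<lambda>n. a n * mult_ext \<omega> n) g"
      unfolding analytic_extension_def by blast
    with conv show ?case by blast
  qed
  with r show ?thesis by (rule that)
qed

lemma analytic_extension_unique:
  assumes f: "analytic_extension b f" and g: "analytic_extension b g" and s: "s \<in> half_plane"
  shows "f s = g s"
proof -
  obtain x where x: "\<And>s. x < Re s \<Longrightarrow> (\<lambda>n. b n * of_nat n powr (- s)) sums f s"
    using f by (auto simp: analytic_extension_def)
  obtain y where y: "\<And>s. y < Re s \<Longrightarrow> (\<lambda>n. b n * of_nat n powr (- s)) sums g s"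
    using g by (auto simp: analytic_extension_def)
  let ?S = "{s. max 0 (max x y) < Re s}"
  show ?thesis
  proof (rule analytic_continuation_open[where f = f and g = g and s = ?S and s' = half_plane])
    show "open ?S" by (rule open_halfspace_Re_gt)
    show "open half_plane" by (simp add: half_plane_def open_halfspace_Re_gt)
    have "max 0 (max x y) < Re (of_real (max 0 (max x y) + 1))"
      by (subst Re_complex_of_real) linarith
    then show "?S \<noteq> {}" by blast
    show "connected half_plane"
      by (simp add: half_plane_def convex_connected convex_halfspace_Re_gt)
    show "?S \<subseteq> half_plane" by (auto simp: half_plane_def)
    show "f z = g z" if "z \<in> ?S" for z using x[of z] y[of z] that sums_unique2 by auto
  qed (use f g s in \<open>auto simp: analytic_extension_def\<close>)
qed

lemma vertical_limit_eq:
  assumes g: "analytic_extension (\<lambda>n. a n * mult_ext \<omega> n) g" and s: "s \<in> half_plane"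
  shows "vertical_limit a \<omega> s = g s"
  unfolding vertical_limit_def
  by (rule analytic_extension_unique[OF someI[of "analytic_extension (\<lambda>n. a n * mult_ext \<omega> n)", OF g] g s])

lemma vertical_limit_poly:
  assumes a: "a \<in> dirichlet_polys" and s: "s \<in> half_plane"
  shows "vertical_limit a \<omega> s = bohr_lift (shift s a) \<omega>"
proof (rule vertical_limit_eq[OF _ s])
  show "analytic_extension (\<lambda>n. a n * mult_ext \<omega> n) (\<lambda>s. bohr_lift (shift s a) \<omega>)"
    unfolding analytic_extension_def
  proof (intro conjI exI allI impI)
    show "(\<lambda>s. bohr_lift (shift s a) \<omega>) holomorphic_on half_plane" by (rule bohr_lift_shift_holomorphic[OF a])
    show "(\<lambda>n. a n * mult_ext \<omega> n * of_nat n powr - s) sums bohr_lift (shift s a) \<omega>" for s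
      unfolding bohr_lift_shift[OF a] by (rule sums_finite) (use dirichlet_polysD(1)[OF a] in auto)
  qed
qed

text \<open>
  An element of the completion is determined by its coefficients: if these vanish, the vertical limits
  vanish in the half-plane, so by Fatou's lemma all right translates of \<open>D j\<close> are as small as the
  tail of the Cauchy sequence, and translating back to \<open>0\<close> is continuous for the polynomial \<open>D j\<close>.
\<close>

lemma hcauchy_null:
  assumes p: "0 < p" and D: "hcauchy p D" and lim: "\<And>n. (\<lambda>k. D k n) \<longlonglongrightarrow> 0"
  shows "(\<lambda>k. hmean p (D k)) \<longlonglongrightarrow> 0"
proof (rule LIMSEQ_I)
  fix e :: real assume e: "0 < e"
  note poly = hcauchyD(1)[OF D]
  obtain r where r: "strict_mono r" and ae: "AE \<omega> in torus. \<exists>g. analytic_extension (\<lambda>n. 0 * mult_ext \<omega> n) g \<and>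
        (\<forall>s\<in>half_plane. (\<lambda>k. bohr_lift (shift s (D (r k))) \<omega>) \<longlonglongrightarrow> g s)"
    by (rule hardy_vertical_limit_AE[OF p D lim])
  have zero: "analytic_extension (\<lambda>n. 0 * mult_ext \<omega> n) (\<lambda>s. 0)" for \<omega>
    by (auto simp: analytic_extension_def)
  obtain K where K: "\<And>j k. K \<le> j \<Longrightarrow> K \<le> k \<Longrightarrow> hmean p (\<lambda>n. D j n - D k n) < e / 2"
    using hcauchyD(2)[OF D, of "e/2"] e by auto
  have "hmean p (D j) < e" if j: "K \<le> j" for j
  proof -
    have le: "hmean p (shift (of_real x) (D j)) \<le> e / 2" if x: "0 < x" for x
    proof -
      let ?s = "of_real x :: complex"
      have "ennreal (hmean p (shift ?s (D j))) = torus_mean p (\<lambda>\<omega>. bohr_lift (shift ?s (D j)) \<omega>)"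
        by (rule nn_integral_bohr_lift[OF p, symmetric])
      also have "\<dots> = (\<integral>\<^sup>+\<omega>. liminf (\<lambda>k. ennreal (norm (bohr_lift (shift ?s (\<lambda>n. D j n - D (r k) n)) \<omega>) powr p)) \<partial>torus)"
      proof (rule nn_integral_cong_AE)
        show "AE \<omega> in torus. ennreal (norm (bohr_lift (shift ?s (D j)) \<omega>) powr p)
           = liminf (\<lambda>k. ennreal (norm (bohr_lift (shift ?s (\<lambda>n. D j n - D (r k) n)) \<omega>) powr p))"
          using ae
        proof eventually_elim
          case (elim \<omega>)
          then obtain g where g: "analytic_extension (\<lambda>n. 0 * mult_ext \<omega> n) g"
             "\<And>s. s \<in> half_plane \<Longrightarrow> (\<lambda>k. bohr_lift (shift s (D (r k))) \<omega>) \<longlonglongrightarrow> g s" by blast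
          have s: "?s \<in> half_plane" using x by (simp add: half_plane_def)
          have "g ?s = 0" using analytic_extension_unique[OF g(1) zero s] .
          then have "(\<lambda>k. bohr_lift (shift ?s (D j)) \<omega> - bohr_lift (shift ?s (D (r k))) \<omega>) \<longlonglongrightarrow> bohr_lift (shift ?s (D j)) \<omega> - 0"
            using g(2)[OF s] by (intro tendsto_intros) auto
          then have "(\<lambda>k. ennreal (norm (bohr_lift (shift ?s (\<lambda>n. D j n - D (r k) n)) \<omega>) powr p))
              \<longlonglongrightarrow> ennreal (norm (bohr_lift (shift ?s (D j)) \<omega>) powr p)"
            using p by (intro tendsto_ennrealI tendsto_powr' tendsto_norm tendsto_const)
              (auto simp: shift_diff bohr_lift_diff shift_polys poly)
          then show ?case by (rule lim_imp_Liminf[OF sequentially_bot, symmetric])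
        qed
      qed
      also have "\<dots> \<le> liminf (\<lambda>k. \<integral>\<^sup>+\<omega>. ennreal (norm (bohr_lift (shift ?s (\<lambda>n. D j n - D (r k) n)) \<omega>) powr p) \<partial>torus)"
        by (rule nn_integral_liminf) measurable
      also have "\<dots> \<le> liminf (\<lambda>k. ennreal (e / 2))"
      proof (rule Liminf_mono)
        show "\<forall>\<^sub>F k in sequentially. torus_mean p (\<lambda>\<omega>. bohr_lift (shift ?s (\<lambda>n. D j n - D (r k) n)) \<omega>) \<le> ennreal (e / 2)"
          using eventually_ge_at_top[of K]
        proof eventually_elim
          case (elim k)
          then have "K \<le> r k" using seq_suble[OF r, of k] by simp
          have "hmean p (shift ?s (\<lambda>n. D j n - D (r k) n)) \<le> hmean p (\<lambda>n. D j n - D (r k) n)"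
            using x by (intro hmean_shift_le dirichlet_polys_diff poly p) auto
          also have "\<dots> < e / 2" by (rule K[OF j \<open>K \<le> r k\<close>])
          finally show ?case unfolding nn_integral_bohr_lift[OF p] by (intro ennreal_leI) simp
        qed
      qed
      also have "\<dots> = ennreal (e / 2)" by (simp add: Liminf_const)
      finally show ?thesis using e by simp
    qed
    have "continuous_on {0..1} (\<lambda>x. hmean p (shift (of_real x) (D j)))"
      by (rule continuous_on_hmean_shift[OF poly p])
    then have "continuous_on (closure {0<..<1}) (\<lambda>x. hmean p (shift (of_real x) (D j)))" by simp
    then have "hmean p (shift (of_real 0) (D j)) \<le> e / 2"
      by (rule continuous_le_on_closure) (simp, rule le, simp)
    then show ?thesis using e by (simp add: shift_0 poly)
  qed
  then show "\<exists>K. \<forall>k\<ge>K. norm (hmean p (D k) - 0) < e" using hmean_nonneg by (intro exI[of _ K]) auto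
qed

lemma hcauchy_diff:
  assumes p: "0 < p" and P: "hcauchy p P" and Q: "hcauchy p Q"
  shows "hcauchy p (\<lambda>k n. P k n - Q k n)"
  unfolding hcauchy_def
proof (intro conjI allI impI)
  fix e :: real assume e: "0 < e"
  define c where "c = 2 powr p"
  have c: "0 < c" by (simp add: c_def)
  obtain K where K: "\<And>j k. K \<le> j \<Longrightarrow> K \<le> k \<Longrightarrow> hmean p (\<lambda>n. P j n - P k n) < e / (2 * c)"
    using hcauchyD(2)[OF P, of "e / (2 * c)"] e c by auto
  obtain L where L: "\<And>j k. L \<le> j \<Longrightarrow> L \<le> k \<Longrightarrow> hmean p (\<lambda>n. Q j n - Q k n) < e / (2 * c)"
    using hcauchyD(2)[OF Q, of "e / (2 * c)"] e c by auto
  have "hmean p (\<lambda>n. (P j n - Q j n) - (P k n - Q k n)) < e" if "max K L \<le> j" "max K L \<le> k" for j k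
  proof -
    have "hmean p (\<lambda>n. (P j n - P k n) + (Q k n - Q j n))
       \<le> c * hmean p (\<lambda>n. P j n - P k n) + c * hmean p (\<lambda>n. Q k n - Q j n)"
      using hmean_add_le[OF p zero_less_one dirichlet_polys_diff[OF hcauchyD(1)[OF P] hcauchyD(1)[OF P]]
        dirichlet_polys_diff[OF hcauchyD(1)[OF Q] hcauchyD(1)[OF Q]]] by (simp add: c_def)
    also have "\<dots> < c * (e / (2 * c)) + c * (e / (2 * c))"
      using K[of j k] L[of k j] that c by (intro add_strict_mono mult_strict_left_mono) auto
    also have "\<dots> = e" using c by simp
    finally show ?thesis by (simp add: algebra_simps)
  qed
  then show "\<exists>K. \<forall>j\<ge>K. \<forall>k\<ge>K. hmean p (\<lambda>n. (P j n - Q j n) - (P k n - Q k n)) < e" by blast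
qed (intro dirichlet_polys_diff hcauchyD(1)[OF P] hcauchyD(1)[OF Q])

text \<open>
  The norm in the completion is well defined: any two approximating sequences of an element differ by
  a null sequence.
\<close>

lemma hardy_norm_limit:
  assumes p: "0 < p" and P: "approximates p P a"
  shows "(\<lambda>k. hmean p (P k)) \<longlonglongrightarrow> hardy_norm p a powr p" and "0 \<le> hardy_norm p a"
proof -
  have P': "hcauchy p P" "\<And>n. (\<lambda>k. P k n) \<longlonglongrightarrow> a n" using P by (auto simp: approximates_iff[OF p])
  obtain L where L: "(\<lambda>k. hmean p (P k)) \<longlonglongrightarrow> L"
    using hcauchy_hmean_convergent[OF P'(1) p] by (auto simp: convergent_def)
  have L0: "0 \<le> L" by (rule LIMSEQ_le_const[OF L]) (use hmean_nonneg in auto)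
  have norm_lim: "(\<lambda>k. poly_norm p (Q k)) \<longlonglongrightarrow> L powr (1 / p)" if "(\<lambda>k. hmean p (Q k)) \<longlonglongrightarrow> L" for Q
    unfolding poly_norm_eq using p that by (intro tendsto_powr' tendsto_const) (auto simp: hmean_nonneg)
  have "hardy_norm p a = L powr (1 / p)"
    unfolding hardy_norm_def
  proof (rule the_equality)
    show "\<exists>P. approximates p P a \<and> (\<lambda>k. poly_norm p (P k)) \<longlonglongrightarrow> L powr (1 / p)"
      using P norm_lim[OF L] by blast
    fix r assume "\<exists>Q. approximates p Q a \<and> (\<lambda>k. poly_norm p (Q k)) \<longlonglongrightarrow> r"
    then obtain Q where Q: "approximates p Q a" "(\<lambda>k. poly_norm p (Q k)) \<longlonglongrightarrow> r" by blast
    then have Q': "hcauchy p Q" "\<And>n. (\<lambda>k. Q k n) \<longlonglongrightarrow> a n" by (auto simp: approximates_iff[OF p])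
    obtain B where B: "\<And>k. hmean p (P k) \<le> B" using hcauchy_bounded[OF P'(1) p] by blast
    have "(\<lambda>k. hmean p (\<lambda>n. Q k n - P k n)) \<longlonglongrightarrow> 0"
    proof (rule hcauchy_null[OF p hcauchy_diff[OF p Q'(1) P'(1)]])
      show "(\<lambda>k. Q k n - P k n) \<longlonglongrightarrow> 0" for n using tendsto_diff[OF Q'(2) P'(2), of n n] by simp
    qed
    from hmean_merge[OF p hcauchyD(1)[OF Q'(1)] hcauchyD(1)[OF P'(1)] B this]
    have "(\<lambda>k. (hmean p (Q k) - hmean p (P k)) + hmean p (P k)) \<longlonglongrightarrow> 0 + L" by (intro tendsto_add L)
    then have "(\<lambda>k. poly_norm p (Q k)) \<longlonglongrightarrow> L powr (1 / p)" by (intro norm_lim) simp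
    then show "r = L powr (1 / p)" using Q(2) LIMSEQ_unique by blast
  qed
  then show "(\<lambda>k. hmean p (P k)) \<longlonglongrightarrow> hardy_norm p a powr p" "0 \<le> hardy_norm p a"
    using L L0 p by (auto simp: powr_powr)
qed

lemma hardy_poly:
  assumes p: "0 < p" and a: "a \<in> dirichlet_polys"
  shows "a \<in> hardy p" and "hardy_norm p a powr p = hmean p a"
proof -
  have h0: "hmean p (\<lambda>n. 0) = 0"
    using hmean_le[OF p, of "\<lambda>n. 0"] hmean_nonneg[of p "\<lambda>n. 0"] p by simp
  have A: "approximates p (\<lambda>k. a) a"
    unfolding approximates_iff[OF p] hcauchy_def using a h0 by auto
  then show "a \<in> hardy p" by (auto simp: hardy_def)
  show "hardy_norm p a powr p = hmean p a"
    using hardy_norm_limit(1)[OF p A] LIMSEQ_unique tendsto_const by blast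
qed

text \<open>
  Elements starting at \<open>n = m\<close> are limits of polynomials starting at \<open>n = m\<close>, since the finitely many
  earlier coefficients tend to \<open>0\<close>.
\<close>

lemma approximates_truncate:
  assumes p: "0 < p" and P: "approximates p P a" and a: "\<And>n. n < m \<Longrightarrow> a n = 0"
  shows "approximates p (\<lambda>k n. if n < m then 0 else P k n) a"
proof -
  have P': "hcauchy p P" "\<And>n. (\<lambda>k. P k n) \<longlonglongrightarrow> a n" using P by (auto simp: approximates_iff[OF p])
  note poly = hcauchyD(1)[OF P'(1)]
  let ?R = "\<lambda>k n. if n < m then P k n else 0"
  have R: "?R k \<in> dirichlet_polys" for k
    using dirichlet_polys_mult[OF poly, of k "\<lambda>n. if n < m then 1 else 0"] by (simp add: if_distrib cong: if_cong)
  have hR: "hcauchy p ?R"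
    unfolding hcauchy_def
  proof (intro conjI allI impI R)
    fix e :: real assume e: "0 < e"
    have "((\<lambda>i. hmean p (\<lambda>n. ?R (fst i) n - ?R (snd i) n)) \<longlongrightarrow> 0) (sequentially \<times>\<^sub>F sequentially)"
    proof (rule tendsto_hmean_zero[OF p, of "{..<m}"])
      fix n assume "n \<in> {..<m}"
      have "((\<lambda>i. P (fst i) n) \<longlongrightarrow> a n) (sequentially \<times>\<^sub>F sequentially)"
           "((\<lambda>i. P (snd i) n) \<longlongrightarrow> a n) (sequentially \<times>\<^sub>F sequentially)"
        using filterlim_compose[OF P'(2) filterlim_fst] filterlim_compose[OF P'(2) filterlim_snd] by auto
      from tendsto_diff[OF this]
      show "((\<lambda>i. ?R (fst i) n - ?R (snd i) n) \<longlongrightarrow> 0) (sequentially \<times>\<^sub>F sequentially)"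
        using \<open>n \<in> {..<m}\<close> by simp
    qed auto
    from order_tendstoD(2)[OF this e]
    show "\<exists>K. \<forall>j\<ge>K. \<forall>k\<ge>K. hmean p (\<lambda>n. ?R j n - ?R k n) < e"
      unfolding eventually_prod_sequentially fst_conv snd_conv by blast
  qed
  have "(\<lambda>k n. if n < m then 0 else P k n) = (\<lambda>k n. P k n - ?R k n)" by (auto simp: fun_eq_iff)
  moreover have "(\<lambda>k. if n < m then 0 else P k n) \<longlonglongrightarrow> a n" for n
    using P'(2)[of n] a[of n] by (cases "n < m") auto
  ultimately show ?thesis
    unfolding approximates_iff[OF p] using hcauchy_diff[OF p P'(1) hR] by simp
qed

section \<open>Integration over cones\<close>

lemma epowr_ennreal: "0 \<le> x \<Longrightarrow> epowr (ennreal x) p = ennreal (x powr p)"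
  by (simp add: epowr_def)

lemma epowr_top [simp]: "epowr \<infinity> p = \<infinity>" "epowr top p = top"
  by (simp_all add: epowr_def)

lemma epowr_epowr: "p \<noteq> 0 \<Longrightarrow> epowr (epowr x (1 / p)) p = x"
  by (cases x) (auto simp: epowr_ennreal powr_powr)

lemma epowr_less_top_iff [simp]: "epowr x p < \<infinity> \<longleftrightarrow> x < \<infinity>" "epowr x p < top \<longleftrightarrow> x < top"
  by (cases x; simp add: epowr_ennreal)+

lemma epowr_mono: "0 \<le> p \<Longrightarrow> x \<le> y \<Longrightarrow> epowr x p \<le> epowr y p"
  by (cases x; cases y) (auto simp: epowr_ennreal intro!: ennreal_leI powr_mono2 simp: top_unique)

lemma epowr_measurable [measurable]: "(\<lambda>x. epowr x p) \<in> borel_measurable borel"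
proof -
  have "(\<lambda>x::ennreal. if x = \<infinity> then \<infinity> else ennreal (enn2real x powr p)) \<in> borel_measurable borel"
    by measurable
  then show ?thesis by (simp add: epowr_def[abs_def])
qed

definition line_measure :: "real measure" where
  "line_measure = density lborel (\<lambda>\<tau>. ennreal (1 / (1 + \<tau>\<^sup>2)))"

lemma strip_measure_eq: "strip_measure = completion (torus \<Otimes>\<^sub>M line_measure)"
  by (simp add: strip_measure_def line_measure_def)

lemma sets_line_measure [measurable_cong]: "sets line_measure = sets borel"
  by (simp add: line_measure_def)

lemma space_line_measure [simp]: "space line_measure = UNIV"
  by (simp add: line_measure_def)

lemma sigma_finite_line_measure: "sigma_finite_measure line_measure"
  unfolding line_measure_def
  by (subst sigma_finite_measure.sigma_finite_iff_density_finite[OF sigma_finite_lborel]) auto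

lemma AE_line_measure: "(AE \<tau> in line_measure. P \<tau>) \<longleftrightarrow> (AE \<tau> in lborel. P \<tau>)"
proof -
  have "0 < 1 / (1 + \<tau>\<^sup>2)" for \<tau> :: real by (simp add: add_pos_nonneg)
  then show ?thesis unfolding line_measure_def by (subst AE_density) auto
qed

lemma sigma_finite_torus: "sigma_finite_measure torus"
  by (rule finite_measure.axioms(1)[OF prob_space.axioms(1)[OF prob_space_torus]])

lemma arctan_vector_derivative:
  "(arctan has_vector_derivative 1 / (1 + x\<^sup>2)) (at x within A)"
  using DERIV_arctan[of x]
  by (auto simp: has_real_derivative_iff_has_vector_derivative[symmetric] inverse_eq_divide intro: has_field_derivative_at_within)

text \<open>
  The weight is the measure of the set of boundary points whose cone contains \<open>s\<close>, divided by \<open>Re s\<close>.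
  The closed form by arc tangents shows that it is positive and measurable.
\<close>

lemma line_measure_cone:
  assumes "s \<in> half_plane"
  shows "(\<integral>\<^sup>+\<tau>. indicator (stolz_cone \<tau>) s \<partial>line_measure) = ennreal (Re s * weight s)"
    and weight_eq_arctan: "weight s = (arctan (Im s + Re s) - arctan (Im s - Re s)) / Re s"
    and weight_pos: "0 < weight s"
proof -
  have s: "0 < Re s" using assms by (simp add: half_plane_def)
  let ?a = "Im s - Re s" and ?b = "Im s + Re s"
  have ab: "?a \<le> ?b" using s by simp
  have cont: "continuous_on {?a..?b} (\<lambda>\<tau>::real. 1 / (1 + \<tau>\<^sup>2))"
    by (intro continuous_intros) (auto simp: add_nonneg_eq_0_iff)
  have int: "(LBINT \<tau>:{?a..?b}. 1 / (1 + \<tau>\<^sup>2)) = arctan ?b - arctan ?a"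
    unfolding set_lebesgue_integral_def
    by (rule integral_FTC_atLeastAtMost[OF ab arctan_vector_derivative cont])
  show w: "weight s = (arctan ?b - arctan ?a) / Re s"
    unfolding weight_def int by simp
  have "arctan ?a < arctan ?b" using s by (simp add: arctan_less_iff)
  then show "0 < weight s" using s by (simp add: w)
  have "(\<integral>\<^sup>+\<tau>. indicator (stolz_cone \<tau>) s \<partial>line_measure)
     = (\<integral>\<^sup>+\<tau>. ennreal (1 / (1 + \<tau>\<^sup>2)) * indicator (stolz_cone \<tau>) s \<partial>lborel)"
  proof -
    have "(\<lambda>\<tau>. indicator (stolz_cone \<tau>) s :: ennreal) = indicator {?a<..<?b}"
      using assms by (auto simp: fun_eq_iff stolz_cone_def indicator_def abs_less_iff)
    then show ?thesis unfolding line_measure_def by (subst nn_integral_density) auto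
  qed
  also have "\<dots> = (\<integral>\<^sup>+\<tau>. ennreal (1 / (1 + \<tau>\<^sup>2)) * indicator {?a..?b} \<tau> \<partial>lborel)"
  proof (rule nn_integral_cong_AE)
    have "AE \<tau> in lborel. \<tau> \<noteq> ?a \<and> \<tau> \<noteq> ?b"
      using AE_lborel_singleton[of ?a] AE_lborel_singleton[of ?b] by eventually_elim simp
    then show "AE \<tau> in lborel. ennreal (1 / (1 + \<tau>\<^sup>2)) * indicator (stolz_cone \<tau>) s
      = ennreal (1 / (1 + \<tau>\<^sup>2)) * indicator {?a..?b} \<tau>"
      by eventually_elim (use assms in \<open>auto simp: stolz_cone_def indicator_def abs_less_iff\<close>)
  qed
  also have "\<dots> = ennreal (arctan ?b - arctan ?a)"
    by (rule nn_integral_has_integral_lebesgue'[OF _ fundamental_theorem_of_calculus[OF ab arctan_vector_derivative]]) simp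
  also have "arctan ?b - arctan ?a = Re s * weight s" using s by (simp add: w)
  finally show "(\<integral>\<^sup>+\<tau>. indicator (stolz_cone \<tau>) s \<partial>line_measure) = ennreal (Re s * weight s)" .
qed

text \<open>
  The \<open>p\<close>-th power of the area operator at the boundary point \<open>\<tau>\<close>, for one vertical limit \<open>h\<close>.
\<close>

definition cone_integral :: "real \<Rightarrow> complex measure \<Rightarrow> (complex \<Rightarrow> complex) \<Rightarrow> real \<Rightarrow> ennreal" where
  "cone_integral p \<mu> h \<tau> = (\<integral>\<^sup>+ s \<in> stolz_cone \<tau>. ennreal (norm (h s) powr p / Re s) \<partial>\<mu>)"

lemma area_op_eq: "area_op \<mu> p a (\<omega>, \<tau>) = enn2ereal (epowr (cone_integral p \<mu> (vertical_limit a \<omega>) \<tau>) (1 / p))"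
  by (simp add: area_op_def cone_integral_def)

lemma cone_integral_cong: "(\<And>s. s \<in> half_plane \<Longrightarrow> h s = h' s) \<Longrightarrow> cone_integral p \<mu> h \<tau> = cone_integral p \<mu> h' \<tau>"
  unfolding cone_integral_def
  by (intro nn_integral_cong) (auto simp: indicator_def stolz_cone_def)

lemma space_half_plane_measure:
  assumes "sets \<mu> = sets (restrict_space borel half_plane)"
  shows "space \<mu> = half_plane"
  using sets_eq_imp_space_eq[OF assms] by (simp add: space_restrict_space)

lemma borel_measurable_half_plane_measure:
  assumes sets: "sets \<mu> = sets (restrict_space borel half_plane)" and f: "f \<in> borel_measurable borel"
  shows "f \<in> borel_measurable \<mu>"
  using measurable_restrict_space1[OF f, of half_plane] by (simp add: measurable_cong_sets[OF sets refl])

lemma weight_measurable: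
  assumes sets: "sets \<mu> = sets (restrict_space borel half_plane)"
  shows "weight \<in> borel_measurable \<mu>"
proof -
  have "(\<lambda>s. (arctan (Im s + Re s) - arctan (Im s - Re s)) / Re s) \<in> borel_measurable \<mu>"
    by (rule borel_measurable_half_plane_measure[OF sets]) measurable
  then show ?thesis
    by (subst measurable_cong[where g = "\<lambda>s. (arctan (Im s + Re s) - arctan (Im s - Re s)) / Re s"])
       (simp_all add: weight_eq_arctan space_half_plane_measure[OF sets])
qed

lemma weight_moment_eq:
  "weight_moment \<mu> p m = (\<integral>\<^sup>+s. ennreal (weight s) * ennreal (real m powr (- p * Re s)) \<partial>\<mu>)"
  by (simp add: weight_moment_def ennreal_mult'')

locale half_plane_measure = sigma_finite_measure \<mu> for \<mu> :: "complex measure" +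
  assumes sets_mu: "sets \<mu> = sets (restrict_space borel half_plane)"
begin

abbreviation jointly_measurable :: "((nat \<Rightarrow> complex) \<Rightarrow> complex \<Rightarrow> complex) \<Rightarrow> bool" where
  "jointly_measurable h \<equiv> (\<lambda>(\<omega>, s). h \<omega> s) \<in> borel_measurable (torus \<Otimes>\<^sub>M \<mu>)"

abbreviation area_version ::
  "real \<Rightarrow> ((nat \<Rightarrow> complex) \<times> real \<Rightarrow> ereal) \<Rightarrow> ((nat \<Rightarrow> complex) \<Rightarrow> complex \<Rightarrow> complex) \<Rightarrow> bool" where
  "area_version p F h \<equiv> AE \<omega> in torus. \<forall>\<tau>. F (\<omega>, \<tau>) = enn2ereal (epowr (cone_integral p \<mu> (h \<omega>) \<tau>) (1 / p))"

lemma Re_Im_measurable [measurable]: "Re \<in> borel_measurable \<mu>" "Im \<in> borel_measurable \<mu>"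
  by (rule borel_measurable_half_plane_measure[OF sets_mu]; measurable)+

lemma space_mu: "space \<mu> = half_plane"
  by (rule space_half_plane_measure[OF sets_mu])

lemma stolz_cone_measurable [measurable]:
  "(\<lambda>(\<tau>, s). indicator (stolz_cone \<tau>) s :: ennreal) \<in> borel_measurable (line_measure \<Otimes>\<^sub>M \<mu>)"
proof -
  have "(\<lambda>(\<tau>, s). if \<bar>Im s - \<tau>\<bar> < Re s then 1 else 0 :: ennreal) \<in> borel_measurable (line_measure \<Otimes>\<^sub>M \<mu>)"
    by measurable
  then show ?thesis
    by (subst measurable_cong[where g = "\<lambda>(\<tau>, s). if \<bar>Im s - \<tau>\<bar> < Re s then 1 else 0 :: ennreal"])
       (auto simp: space_pair_measure space_mu stolz_cone_def indicator_def)
qed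

context
  fixes p :: real and h :: "(nat \<Rightarrow> complex) \<Rightarrow> complex \<Rightarrow> complex"
  assumes h: "jointly_measurable h"
begin

lemma cone_integrand_measurable:
  "(\<lambda>((\<omega>, \<tau>), s). ennreal (norm (h \<omega> s) powr p / Re s) * indicator (stolz_cone \<tau>) s)
     \<in> borel_measurable ((torus \<Otimes>\<^sub>M line_measure) \<Otimes>\<^sub>M \<mu>)"
proof -
  have [measurable]: "(\<lambda>x. h (fst (fst x)) (snd x)) \<in> borel_measurable ((torus \<Otimes>\<^sub>M line_measure) \<Otimes>\<^sub>M \<mu>)"
    using measurable_compose[OF _ h, of "\<lambda>x. (fst (fst x), snd x)" "(torus \<Otimes>\<^sub>M line_measure) \<Otimes>\<^sub>M \<mu>"] by simp
  have [measurable]: "(\<lambda>x. indicator (stolz_cone (snd (fst x))) (snd x) :: ennreal) \<in> borel_measurable ((torus \<Otimes>\<^sub>M line_measure) \<Otimes>\<^sub>M \<mu>)"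
    using measurable_compose[OF _ stolz_cone_measurable, of "\<lambda>x. (snd (fst x), snd x)" "(torus \<Otimes>\<^sub>M line_measure) \<Otimes>\<^sub>M \<mu>"] by simp
  show ?thesis unfolding split_beta by measurable
qed

lemma cone_integral_measurable:
  "(\<lambda>(\<omega>, \<tau>). cone_integral p \<mu> (h \<omega>) \<tau>) \<in> borel_measurable (torus \<Otimes>\<^sub>M line_measure)"
  unfolding cone_integral_def case_prod_beta'
  by (rule borel_measurable_nn_integral) (use cone_integrand_measurable in \<open>simp add: case_prod_beta'\<close>)

text \<open>
  Tonelli's theorem, first for the boundary point and the point of the half-plane, then for the latter
  and the torus.
\<close>

lemma nn_integral_cone_integral:
  "(\<integral>\<^sup>+x. cone_integral p \<mu> (h (fst x)) (snd x) \<partial>(torus \<Otimes>\<^sub>M line_measure))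
   = (\<integral>\<^sup>+s. ennreal (weight s) * torus_mean p (\<lambda>\<omega>. h \<omega> s) \<partial>\<mu>)"
proof -
  interpret L: sigma_finite_measure line_measure by (rule sigma_finite_line_measure)
  interpret T: sigma_finite_measure torus by (rule sigma_finite_torus)
  interpret LM: pair_sigma_finite line_measure \<mu> by unfold_locales
  interpret TM: pair_sigma_finite torus \<mu> by unfold_locales
  interpret TL: pair_sigma_finite torus line_measure by unfold_locales
  have hs [measurable]: "h \<omega> \<in> borel_measurable \<mu>" if "\<omega> \<in> space torus" for \<omega>
    using measurable_compose[OF measurable_Pair1'[OF that] h] by simp
  have hw [measurable]: "(\<lambda>\<omega>. h \<omega> s) \<in> borel_measurable torus" if "s \<in> space \<mu>" for s
    using measurable_compose[OF measurable_Pair2'[OF that] h] by simp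
  have inner: "(\<integral>\<^sup>+\<tau>. cone_integral p \<mu> (h \<omega>) \<tau> \<partial>line_measure)
     = (\<integral>\<^sup>+s. ennreal (norm (h \<omega> s) powr p) * ennreal (weight s) \<partial>\<mu>)" if \<omega>: "\<omega> \<in> space torus" for \<omega>
  proof -
    have [measurable]: "(\<lambda>(\<tau>, s). ennreal (norm (h \<omega> s) powr p / Re s) * indicator (stolz_cone \<tau>) s) \<in> borel_measurable (line_measure \<Otimes>\<^sub>M \<mu>)"
      using hs[OF \<omega>] by measurable
    have "(\<integral>\<^sup>+\<tau>. cone_integral p \<mu> (h \<omega>) \<tau> \<partial>line_measure)
      = (\<integral>\<^sup>+s. (\<integral>\<^sup>+\<tau>. ennreal (norm (h \<omega> s) powr p / Re s) * indicator (stolz_cone \<tau>) s \<partial>line_measure) \<partial>\<mu>)"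
      unfolding cone_integral_def by (rule LM.Fubini'[symmetric]) measurable
    also have "\<dots> = (\<integral>\<^sup>+s. ennreal (norm (h \<omega> s) powr p) * ennreal (weight s) \<partial>\<mu>)"
    proof (rule nn_integral_cong)
      fix s assume s: "s \<in> space \<mu>"
      then have sh: "s \<in> half_plane" by (simp add: space_mu)
      then have R: "0 < Re s" by (simp add: half_plane_def)
      have "(\<lambda>\<tau>. indicator (stolz_cone \<tau>) s :: ennreal) \<in> borel_measurable line_measure"
        using measurable_compose[OF measurable_Pair2'[OF s] stolz_cone_measurable] by simp
      then have "(\<integral>\<^sup>+\<tau>. ennreal (norm (h \<omega> s) powr p / Re s) * indicator (stolz_cone \<tau>) s \<partial>line_measure)
         = ennreal (norm (h \<omega> s) powr p / Re s) * ennreal (Re s * weight s)"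
        by (simp add: nn_integral_cmult line_measure_cone[OF sh])
      also have "\<dots> = ennreal (norm (h \<omega> s) powr p) * ennreal (weight s)"
        using R weight_pos[OF sh] by (simp add: ennreal_mult'[symmetric])
      finally show "(\<integral>\<^sup>+\<tau>. ennreal (norm (h \<omega> s) powr p / Re s) * indicator (stolz_cone \<tau>) s \<partial>line_measure)
         = ennreal (norm (h \<omega> s) powr p) * ennreal (weight s)" .
    qed
    finally show ?thesis .
  qed
  have [measurable]: "weight \<in> borel_measurable \<mu>" by (rule weight_measurable[OF sets_mu])
  have [measurable]: "(\<lambda>(\<omega>, s). ennreal (norm (h \<omega> s) powr p) * ennreal (weight s)) \<in> borel_measurable (torus \<Otimes>\<^sub>M \<mu>)"
    using h unfolding split_beta by measurable
  have "(\<integral>\<^sup>+x. cone_integral p \<mu> (h (fst x)) (snd x) \<partial>(torus \<Otimes>\<^sub>M line_measure))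
     = (\<integral>\<^sup>+\<omega>. (\<integral>\<^sup>+\<tau>. cone_integral p \<mu> (h \<omega>) \<tau> \<partial>line_measure) \<partial>torus)"
    using L.nn_integral_fst[of "\<lambda>x. cone_integral p \<mu> (h (fst x)) (snd x)" torus] cone_integral_measurable
    by (simp add: split_beta)
  also have "\<dots> = (\<integral>\<^sup>+\<omega>. (\<integral>\<^sup>+s. ennreal (norm (h \<omega> s) powr p) * ennreal (weight s) \<partial>\<mu>) \<partial>torus)"
    by (rule nn_integral_cong) (rule inner)
  also have "\<dots> = (\<integral>\<^sup>+s. (\<integral>\<^sup>+\<omega>. ennreal (norm (h \<omega> s) powr p) * ennreal (weight s) \<partial>torus) \<partial>\<mu>)"
    by (rule TM.Fubini'[symmetric]) measurable
  also have "\<dots> = (\<integral>\<^sup>+s. ennreal (weight s) * torus_mean p (\<lambda>\<omega>. h \<omega> s) \<partial>\<mu>)"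
    by (intro nn_integral_cong) (subst nn_integral_multc, use hw in measurable, simp add: mult.commute)
  finally show ?thesis .
qed

end

end

section \<open>Functions on the strip\<close>

lemma measurable_completion_AE:
  assumes G: "G \<in> borel_measurable M" and FG: "AE x in M. F x = G x"
  shows "F \<in> borel_measurable (completion M)"
proof (rule measurableI)
  fix A :: "'b set" assume A: "A \<in> sets borel"
  \<comment> \<open>\<open>F x \<in> A\<close> is decided by \<open>G\<close> off a null set, and every subset of a null set is measurable.\<close>
  have comb: "Measurable.pred N (\<lambda>x. (D x \<and> \<not> B x) \<or> E x)"
    if [measurable]: "Measurable.pred N B" "Measurable.pred N D" "Measurable.pred N E"
    for N :: "'a measure" and B D E by measurable
  have 1: "Measurable.pred (completion M) (\<lambda>x. F x \<noteq> G x)"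
    by (rule sets_completion_AE) (use FG in auto)
  have 2: "Measurable.pred (completion M) (\<lambda>x. F x \<noteq> G x \<and> F x \<in> A)"
    by (rule sets_completion_AE) (use FG in auto)
  have 3: "Measurable.pred (completion M) (\<lambda>x. G x \<in> A)"
    using measurable_sets[OF measurable_completion[OF G] A] by (simp add: pred_def vimage_def Int_def conj_commute)
  have "Measurable.pred (completion M) (\<lambda>x. (G x \<in> A \<and> \<not> F x \<noteq> G x) \<or> (F x \<noteq> G x \<and> F x \<in> A))"
    using 1 3 2 by (rule comb)
  moreover have "((G x \<in> A \<and> \<not> F x \<noteq> G x) \<or> (F x \<noteq> G x \<and> F x \<in> A)) = (F x \<in> A)" for x by auto
  ultimately show "F -` A \<inter> space (completion M) \<in> sets (completion M)"
    by (simp add: pred_def vimage_def Int_def conj_commute)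
qed auto

lemma AE_pair_fst:
  assumes "AE x in M1. P x" "sigma_finite_measure M2"
  shows "AE z in M1 \<Otimes>\<^sub>M M2. P (fst z)"
proof -
  interpret sigma_finite_measure M2 by fact
  obtain N where N: "N \<in> null_sets M1" "{x \<in> space M1. \<not> P x} \<subseteq> N"
    using assms(1) by (auto elim!: AE_E2 simp: eventually_ae_filter)
  show ?thesis
  proof (rule AE_I')
    show "N \<times> space M2 \<in> null_sets (M1 \<Otimes>\<^sub>M M2)"
      using N(1) by (auto simp: null_sets_def emeasure_pair_measure_Times)
  qed (use N(2) in \<open>auto simp: space_pair_measure\<close>)
qed

lemma sigma_finite_of_positive_functions:
  fixes f :: "'i \<Rightarrow> 'a \<Rightarrow> ennreal"
  assumes I: "countable I" and f [measurable]: "\<And>i. i \<in> I \<Longrightarrow> f i \<in> borel_measurable M"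
    and fin: "\<And>i. i \<in> I \<Longrightarrow> (\<integral>\<^sup>+x. f i x \<partial>M) < \<infinity>"
    and pos: "\<And>x. x \<in> space M \<Longrightarrow> \<exists>i\<in>I. 0 < f i x"
  shows "sigma_finite_measure M"
proof
  let ?A = "\<lambda>(i, k::nat). {x \<in> space M. 1 \<le> of_nat k * f i x}"
  show "\<exists>A. countable A \<and> A \<subseteq> sets M \<and> \<Union> A = space M \<and> (\<forall>a\<in>A. emeasure M a \<noteq> \<infinity>)"
  proof (intro exI[of _ "?A ` (I \<times> UNIV)"] conjI)
    show "countable (?A ` (I \<times> UNIV))" using I by auto
    show "?A ` (I \<times> UNIV) \<subseteq> sets M" by auto
    show "\<Union> (?A ` (I \<times> UNIV)) = space M"
    proof (intro equalityI subsetI)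
      fix x assume x: "x \<in> space M"
      then obtain i where i: "i \<in> I" "0 < f i x" using pos by blast
      obtain k :: nat where "1 \<le> of_nat k * f i x"
      proof (cases "f i x")
        case (real r)
        then have "0 < r" using i(2) by simp
        then obtain k :: nat where "1 / r < real k" using reals_Archimedean2 by blast
        then have "1 \<le> real k * r" using \<open>0 < r\<close> by (simp add: field_simps)
        then have "ennreal 1 \<le> of_nat k * f i x"
          using real by (simp add: ennreal_of_nat_eq_real_of_nat ennreal_mult'[symmetric] ennreal_leI del: ennreal_1)
        then show ?thesis by (intro that[of k]) simp
      next
        case top
        then show ?thesis by (intro that[of 1]) simp
      qed
      then show "x \<in> \<Union> (?A ` (I \<times> UNIV))" using i x by auto
    qed auto
    show "\<forall>a\<in>?A ` (I \<times> UNIV). emeasure M a \<noteq> \<infinity>"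
    proof
      fix a assume "a \<in> ?A ` (I \<times> UNIV)"
      then obtain i k where i: "i \<in> I" and a: "a = {x \<in> space M. 1 \<le> of_nat k * f i x}" by auto
      have "emeasure M a \<le> of_nat k * (\<integral>\<^sup>+x. f i x * indicator (space M) x \<partial>M)"
        unfolding a by (rule nn_integral_Markov_inequality) (use f[OF i] in auto)
      also have "(\<integral>\<^sup>+x. f i x * indicator (space M) x \<partial>M) = (\<integral>\<^sup>+x. f i x \<partial>M)"
        by (rule nn_integral_cong) simp
      also have "of_nat k * \<dots> < \<infinity>" using fin[OF i] by (simp add: ennreal_mult_less_top ennreal_of_nat_eq_real_of_nat)
      finally show "emeasure M a \<noteq> \<infinity>" by simp
    qed
  qed
qed

lemma Lpi_norm_eq: "Lpi_norm p F = epowr (\<integral>\<^sup>+x. epowr (e2ennreal \<bar>F x\<bar>) p \<partial>(torus \<Otimes>\<^sub>M line_measure)) (1 / p)"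
  by (simp add: Lpi_norm_def strip_measure_eq nn_integral_completion)

lemma e2ennreal_abs_enn2ereal [simp]: "e2ennreal \<bar>enn2ereal x\<bar> = x"
  by (simp add: abs_ereal_ge0)

section \<open>Boundedness of the area operator\<close>

definition monomial :: "nat \<Rightarrow> nat \<Rightarrow> complex" where
  "monomial m n = (if n = m then 1 else 0)"

lemma monomial_polys: "0 < m \<Longrightarrow> monomial m \<in> dirichlet_polys"
  by (auto simp: dirichlet_polys_def monomial_def)

lemma norm_bohr_lift_monomial:
  assumes "\<omega> \<in> space torus" "0 < m"
  shows "norm (bohr_lift (shift s (monomial m)) \<omega>) = real m powr (- Re s)"
proof -
  have "{n. monomial m n \<noteq> 0} = {m}" by (auto simp: monomial_def)
  then show ?thesis
    using assms
    by (simp add: bohr_lift_shift monomial_polys norm_mult norm_mult_ext_torus norm_powr_real_powr)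
       (simp add: monomial_def)
qed

lemma hmean_monomial: assumes "0 < m" shows "hmean p (monomial m) = 1"
proof -
  interpret prob_space torus by (rule prob_space_torus)
  have "hmean p (monomial m) = (LINT \<omega>|torus. 1)"
    unfolding hmean_def
  proof (rule Bochner_Integration.integral_cong)
    fix \<omega> assume "\<omega> \<in> space torus"
    from norm_bohr_lift_monomial[OF this assms, of 0]
    show "norm (bohr_lift (monomial m) \<omega>) powr p = 1"
      using assms by (simp add: shift_0 monomial_polys)
  qed simp
  then show ?thesis using prob_space by simp
qed

lemma sigma_finite_of_moment:
  assumes sets: "sets \<mu> = sets (restrict_space borel half_plane)" and m: "0 < m" and fin: "weight_moment \<mu> p m < \<infinity>"
  shows "sigma_finite_measure \<mu>"
proof (rule sigma_finite_of_positive_functions[where I = "{()}"])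
  have [measurable]: "weight \<in> borel_measurable \<mu>" by (rule weight_measurable[OF sets])
  have [measurable]: "(\<lambda>s. real m powr (- p * Re s)) \<in> borel_measurable \<mu>"
    by (rule borel_measurable_half_plane_measure[OF sets]) measurable
  show "(\<lambda>s. ennreal (weight s) * ennreal (real m powr (- p * Re s))) \<in> borel_measurable \<mu>" by measurable
  show "(\<integral>\<^sup>+s. ennreal (weight s) * ennreal (real m powr (- p * Re s)) \<partial>\<mu>) < \<infinity>"
    using fin by (simp add: weight_moment_eq)
  show "\<exists>i\<in>{()}. 0 < ennreal (weight s) * ennreal (real m powr (- p * Re s))" if "s \<in> space \<mu>" for s
    using that m weight_pos[of s] by (simp add: space_half_plane_measure[OF sets] ennreal_zero_less_mult_iff)
qed simp

lemma area_op_monomial: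
  assumes \<omega>: "\<omega> \<in> space torus" and m: "0 < m"
  shows "area_op \<mu> p (monomial m) (\<omega>, \<tau>)
    = enn2ereal (epowr (\<integral>\<^sup>+s\<in>stolz_cone \<tau>. ennreal (real m powr (- p * Re s) / Re s) \<partial>\<mu>) (1 / p))"
  unfolding area_op_eq cone_integral_def
proof (intro arg_cong[where f = enn2ereal] arg_cong2[where f = epowr] refl nn_integral_cong)
  fix s
  show "ennreal (norm (vertical_limit (monomial m) \<omega> s) powr p / Re s) * indicator (stolz_cone \<tau>) s
      = ennreal (real m powr (- p * Re s) / Re s) * indicator (stolz_cone \<tau>) s"
  proof (cases "s \<in> half_plane")
    case True
    then show ?thesis
      by (simp add: vertical_limit_poly[OF monomial_polys[OF m]] norm_bohr_lift_monomial[OF \<omega> m] powr_powr mult.commute)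
  qed (auto simp: stolz_cone_def)
qed

text \<open>
  The cone integrals of the monomial do not depend on the vertical limit, so finiteness almost
  everywhere provides a boundary point with finite cone integral in every interval. The cones with vertices
  in countably many such points cover the half-plane.
\<close>

lemma sigma_finite_of_area_op:
  assumes p: "0 < p" and sets: "sets \<mu> = sets (restrict_space borel half_plane)" and m: "0 < m"
    and Lpi: "area_op \<mu> p (monomial m) \<in> Lpi p"
  shows "sigma_finite_measure \<mu>"
proof -
  interpret torus: prob_space torus by (rule prob_space_torus)
  interpret L: sigma_finite_measure line_measure by (rule sigma_finite_line_measure)
  interpret TL: pair_sigma_finite torus line_measure by unfold_locales
  define \<Phi> where "\<Phi> \<tau> = (\<integral>\<^sup>+s\<in>stolz_cone \<tau>. ennreal (real m powr (- p * Re s) / Re s) \<partial>\<mu>)" for \<tau>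
  let ?F = "area_op \<mu> p (monomial m)"
  have F: "?F \<in> borel_measurable strip_measure" "Lpi_norm p ?F < \<infinity>" using Lpi by (auto simp: Lpi_def)
  have "(\<lambda>x. epowr (e2ennreal \<bar>?F x\<bar>) p) \<in> borel_measurable strip_measure"
    using F(1) by (intro measurable_compose[OF _ epowr_measurable]) measurable
  moreover have "(\<integral>\<^sup>+x. epowr (e2ennreal \<bar>?F x\<bar>) p \<partial>strip_measure) \<noteq> \<infinity>"
    using F(2) by (simp add: Lpi_norm_def)
  ultimately have "AE x in strip_measure. epowr (e2ennreal \<bar>?F x\<bar>) p \<noteq> \<infinity>"
    by (rule nn_integral_PInf_AE)
  then have "AE x in torus \<Otimes>\<^sub>M line_measure. epowr (e2ennreal \<bar>?F x\<bar>) p \<noteq> \<infinity>"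
    unfolding strip_measure_eq AE_completion_iff .
  then have "AE \<omega> in torus. AE \<tau> in line_measure. epowr (e2ennreal \<bar>?F (\<omega>, \<tau>)\<bar>) p \<noteq> \<infinity>"
    by (rule TL.AE_pair)
  then have "AE \<omega> in torus. AE \<tau> in lborel. \<Phi> \<tau> < \<infinity>"
    using AE_space
  proof eventually_elim
    case (elim \<omega>)
    have "epowr (e2ennreal \<bar>?F (\<omega>, \<tau>)\<bar>) p = \<Phi> \<tau>" for \<tau>
      using p elim by (simp add: area_op_monomial[OF _ m] \<Phi>_def epowr_epowr)
    then show ?case using elim by (simp add: AE_line_measure less_top)
  qed
  then have ae: "AE \<tau> in lborel. \<Phi> \<tau> < \<infinity>" by simp
  have ex: "\<exists>\<tau>. a < \<tau> \<and> \<tau> < b \<and> \<Phi> \<tau> < \<infinity>" if "a < b" for a b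
  proof (rule ccontr)
    assume "\<not> ?thesis"
    then have no: "\<Phi> \<tau> < \<infinity> \<longrightarrow> \<tau> \<notin> {a<..<b}" for \<tau> by auto
    have "AE \<tau> in lborel. \<tau> \<notin> {a<..<b}" using ae by eventually_elim (use no in blast)
    then have "emeasure lborel {a<..<b} = 0" by (subst (asm) AE_iff_measurable[of "{a<..<b}"]) auto
    then show False using that by simp
  qed
  \<comment> \<open>A vertex with finite cone integral in each rational interval.\<close>
  define T where "T = (\<lambda>(a, b). SOME \<tau>. real_of_rat a < \<tau> \<and> \<tau> < real_of_rat b \<and> \<Phi> \<tau> < \<infinity>)"
  have T: "real_of_rat a < T (a, b) \<and> T (a, b) < real_of_rat b \<and> \<Phi> (T (a, b)) < \<infinity>" if "a < b" for a b
    unfolding T_def case_prod_conv by (rule someI_ex[OF ex]) (simp add: that of_rat_less)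
  show ?thesis
  proof (rule sigma_finite_of_positive_functions[where I = "{(a, b). a < b}" and
        f = "\<lambda>i s. ennreal (real m powr (- p * Re s) / Re s) * indicator (stolz_cone (T i)) s"])
    show "(\<lambda>s. ennreal (real m powr (- p * Re s) / Re s) * indicator (stolz_cone (T i)) s) \<in> borel_measurable \<mu>" for i
    proof (rule borel_measurable_half_plane_measure[OF sets])
      have [measurable]: "stolz_cone (T i) \<in> sets borel"
        unfolding stolz_cone_def half_plane_def by measurable
      show "(\<lambda>s. ennreal (real m powr (- p * Re s) / Re s) * indicator (stolz_cone (T i)) s) \<in> borel_measurable borel"
        by measurable
    qed
    show "(\<integral>\<^sup>+s. ennreal (real m powr (- p * Re s) / Re s) * indicator (stolz_cone (T i)) s \<partial>\<mu>) < \<infinity>" if "i \<in> {(a, b). a < b}" for i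
      using that T by (auto simp: \<Phi>_def)
    fix s assume "s \<in> space \<mu>"
    then have s: "s \<in> half_plane" "0 < Re s" by (auto simp: space_half_plane_measure[OF sets] half_plane_def)
    obtain a where a: "Im s - Re s < real_of_rat a" "real_of_rat a < Im s" using of_rat_dense[of "Im s - Re s" "Im s"] s by auto
    obtain b where b: "Im s < real_of_rat b" "real_of_rat b < Im s + Re s" using of_rat_dense[of "Im s" "Im s + Re s"] s by auto
    have ab: "a < b" using a b by (metis less_trans of_rat_less)
    moreover have "s \<in> stolz_cone (T (a, b))" using T[OF ab] a b s by (auto simp: stolz_cone_def abs_less_iff)
    ultimately show "\<exists>i\<in>{(a, b). a < b}. 0 < ennreal (real m powr (- p * Re s) / Re s) * indicator (stolz_cone (T i)) s"
      using s m by (intro bexI[of _ "(a, b)"]) auto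
  qed simp
qed

lemma approximates_subseq:
  assumes p: "0 < p" and P: "approximates p P a" and r: "strict_mono r"
  shows "approximates p (\<lambda>k. P (r k)) a"
proof -
  have P': "hcauchy p P" "\<And>n. (\<lambda>k. P k n) \<longlonglongrightarrow> a n" using P by (auto simp: approximates_iff[OF p])
  have "hcauchy p (\<lambda>k. P (r k))"
    unfolding hcauchy_def
  proof (intro conjI allI impI hcauchyD(1)[OF P'(1)])
    fix e :: real assume "0 < e"
    from hcauchyD(2)[OF P'(1) this] obtain K where "\<forall>j\<ge>K. \<forall>k\<ge>K. hmean p (\<lambda>n. P j n - P k n) < e" by blast
    then show "\<exists>K. \<forall>j\<ge>K. \<forall>k\<ge>K. hmean p (\<lambda>n. P (r j) n - P (r k) n) < e"
      using seq_suble[OF r] by (meson le_trans)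
  qed
  then show ?thesis
    unfolding approximates_iff[OF p] using LIMSEQ_subseq_LIMSEQ[OF P'(2) r] by (simp add: o_def)
qed

context half_plane_measure
begin

lemma shift_joint_measurable:
  assumes a: "a \<in> dirichlet_polys"
  shows "(\<lambda>(\<omega>, s). bohr_lift (shift s a) \<omega>) \<in> borel_measurable (torus \<Otimes>\<^sub>M \<mu>)"
proof -
  have [measurable]: "(\<lambda>s. of_nat n powr (- s)) \<in> borel_measurable \<mu>" for n
    by (rule borel_measurable_half_plane_measure[OF sets_mu]) (intro borel_measurable_continuous_onI continuous_intros)
  show ?thesis unfolding bohr_lift_shift[OF a] split_beta by measurable
qed

text \<open>
  Vertical limits are only known almost everywhere on the torus; functions that agree with cone
  integrals of a jointly measurable \<open>h\<close> almost everywhere are measurable for the completed measure.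
\<close>

lemma area_function:
  assumes p: "0 < p" and h: "jointly_measurable h"
    and F: "area_version p F h"
  shows "F \<in> borel_measurable strip_measure"
    and "(\<integral>\<^sup>+x. epowr (e2ennreal \<bar>F x\<bar>) p \<partial>(torus \<Otimes>\<^sub>M line_measure))
       = (\<integral>\<^sup>+s. ennreal (weight s) * torus_mean p (\<lambda>\<omega>. h \<omega> s) \<partial>\<mu>)"
proof -
  have ae: "AE x in torus \<Otimes>\<^sub>M line_measure. F x = enn2ereal (epowr (cone_integral p \<mu> (h (fst x)) (snd x)) (1 / p))"
    using AE_pair_fst[OF F sigma_finite_line_measure]
  proof eventually_elim
    case (elim x)
    then have "F (fst x, snd x) = enn2ereal (epowr (cone_integral p \<mu> (h (fst x)) (snd x)) (1 / p))" by blast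
    then show ?case by simp
  qed
  have [measurable]: "(\<lambda>x. cone_integral p \<mu> (h (fst x)) (snd x)) \<in> borel_measurable (torus \<Otimes>\<^sub>M line_measure)"
    using cone_integral_measurable[OF h, of p] by (simp add: case_prod_beta')
  have "(\<lambda>x. enn2ereal (epowr (cone_integral p \<mu> (h (fst x)) (snd x)) (1 / p))) \<in> borel_measurable (torus \<Otimes>\<^sub>M line_measure)"
    by (intro measurable_compose[OF measurable_compose[OF _ epowr_measurable]]) measurable
  then show "F \<in> borel_measurable strip_measure"
    unfolding strip_measure_eq by (rule measurable_completion_AE[OF _ ae])
  have "(\<integral>\<^sup>+x. epowr (e2ennreal \<bar>F x\<bar>) p \<partial>(torus \<Otimes>\<^sub>M line_measure))
      = (\<integral>\<^sup>+x. cone_integral p \<mu> (h (fst x)) (snd x) \<partial>(torus \<Otimes>\<^sub>M line_measure))"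
    by (rule nn_integral_cong_AE, use ae in eventually_elim) (use p in \<open>simp add: epowr_epowr\<close>)
  then show "(\<integral>\<^sup>+x. epowr (e2ennreal \<bar>F x\<bar>) p \<partial>(torus \<Otimes>\<^sub>M line_measure))
       = (\<integral>\<^sup>+s. ennreal (weight s) * torus_mean p (\<lambda>\<omega>. h \<omega> s) \<partial>\<mu>)"
    using nn_integral_cone_integral[OF h, of p] by simp
qed

text \<open>
  The jointly measurable version \<open>H\<close> of the vertical limits is the pointwise limit along the subsequence of
  \<open>hardy_vertical_limit_AE\<close>. Its distance to a polynomial \<open>Q\<close> is estimated by Fatou's lemma and the decay
  of horizontal means.
\<close>

lemma hardy_representation:
  assumes p: "0 < p" and m: "0 < m" and a: "a \<in> hardy p" and am: "\<And>n. n < m \<Longrightarrow> a n = 0"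
  obtains P H where "approximates p P a" "\<forall>k. \<forall>n<m. P k n = 0"
    "jointly_measurable H"
    "area_version p (area_op \<mu> p a) H"
    "\<forall>Q e s. Q \<in> dirichlet_polys \<longrightarrow> (\<forall>n<m. Q n = 0) \<longrightarrow> (\<lambda>k. hmean p (\<lambda>n. P k n - Q n)) \<longlonglongrightarrow> e \<longrightarrow>
        s \<in> half_plane \<longrightarrow> torus_mean p (\<lambda>\<omega>. H \<omega> s - bohr_lift (shift s Q) \<omega>)
           \<le> ennreal (real m powr (- p * Re s) * e)"
proof -
  obtain P0 where "approximates p P0 a" using a by (auto simp: hardy_def)
  from approximates_truncate[OF p this am]
  obtain P1 where P1: "approximates p P1 a" and P1m: "\<And>k n. n < m \<Longrightarrow> P1 k n = 0"
    by (metis (mono_tags, lifting))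
  have P1': "hcauchy p P1" "\<And>n. (\<lambda>k. P1 k n) \<longlonglongrightarrow> a n" using P1 by (auto simp: approximates_iff[OF p])
  obtain r where r: "strict_mono r" and ae: "AE \<omega> in torus. \<exists>g. analytic_extension (\<lambda>n. a n * mult_ext \<omega> n) g \<and>
        (\<forall>s\<in>half_plane. (\<lambda>k. bohr_lift (shift s (P1 (r k))) \<omega>) \<longlonglongrightarrow> g s)"
    by (rule hardy_vertical_limit_AE[OF p P1'])
  define P where "P k = P1 (r k)" for k
  have P: "approximates p P a" unfolding P_def by (rule approximates_subseq[OF p P1 r])
  have poly: "P k \<in> dirichlet_polys" for k using P by (auto simp: approximates_def)
  have Pm: "P k n = 0" if "n < m" for k n by (simp add: P_def P1m that)
  define H where "H \<omega> s = lim (\<lambda>k. bohr_lift (shift s (P k)) \<omega>)" for \<omega> s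
  have H: "jointly_measurable H"
    unfolding H_def case_prod_beta'
    by (rule borel_measurable_lim_metric) (use shift_joint_measurable[OF poly] in \<open>simp add: case_prod_beta'\<close>)
  have conv: "AE \<omega> in torus. \<forall>s\<in>half_plane. vertical_limit a \<omega> s = H \<omega> s \<and> (\<lambda>k. bohr_lift (shift s (P k)) \<omega>) \<longlonglongrightarrow> H \<omega> s"
    using ae
  proof eventually_elim
    case (elim \<omega>)
    then obtain g where g: "analytic_extension (\<lambda>n. a n * mult_ext \<omega> n) g"
       "\<And>s. s \<in> half_plane \<Longrightarrow> (\<lambda>k. bohr_lift (shift s (P k)) \<omega>) \<longlonglongrightarrow> g s" by (auto simp: P_def)
    then have "H \<omega> s = g s" if "s \<in> half_plane" for s using that unfolding H_def by (intro limI) auto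
    then show ?case using g vertical_limit_eq[OF g(1)] by simp
  qed
  show ?thesis
  proof (rule that[OF P _ H])
    show "\<forall>k. \<forall>n<m. P k n = 0" using Pm by blast
    show "area_version p (area_op \<mu> p a) H"
      using conv
    proof eventually_elim
      case (elim \<omega>)
      then show ?case unfolding area_op_eq
        by (intro allI arg_cong[where f = enn2ereal] arg_cong2[where f = epowr] refl cone_integral_cong) blast
    qed
  next
    show "\<forall>Q e s. Q \<in> dirichlet_polys \<longrightarrow> (\<forall>n<m. Q n = 0) \<longrightarrow> (\<lambda>k. hmean p (\<lambda>n. P k n - Q n)) \<longlonglongrightarrow> e \<longrightarrow>
        s \<in> half_plane \<longrightarrow> torus_mean p (\<lambda>\<omega>. H \<omega> s - bohr_lift (shift s Q) \<omega>)
           \<le> ennreal (real m powr (- p * Re s) * e)"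
    proof (intro allI impI)
      fix Q e s
      assume Q: "Q \<in> dirichlet_polys" and Qm: "\<forall>n<m. Q n = 0"
        and e: "(\<lambda>k. hmean p (\<lambda>n. P k n - Q n)) \<longlonglongrightarrow> e" and s: "s \<in> half_plane"
      have s0: "0 < Re s" using s by (simp add: half_plane_def)
      let ?b = "\<lambda>k \<omega>. bohr_lift (shift s (\<lambda>n. P k n - Q n)) \<omega>"
      have "torus_mean p (\<lambda>\<omega>. H \<omega> s - bohr_lift (shift s Q) \<omega>)
         = (\<integral>\<^sup>+\<omega>. liminf (\<lambda>k. ennreal (norm (?b k \<omega>) powr p)) \<partial>torus)"
      proof (rule nn_integral_cong_AE)
        show "AE \<omega> in torus. ennreal (norm (H \<omega> s - bohr_lift (shift s Q) \<omega>) powr p) = liminf (\<lambda>k. ennreal (norm (?b k \<omega>) powr p))"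
          using conv
        proof eventually_elim
          case (elim \<omega>)
          then have "(\<lambda>k. bohr_lift (shift s (P k)) \<omega> - bohr_lift (shift s Q) \<omega>) \<longlonglongrightarrow> H \<omega> s - bohr_lift (shift s Q) \<omega>"
            using s by (intro tendsto_intros) auto
          then have "(\<lambda>k. ennreal (norm (?b k \<omega>) powr p)) \<longlonglongrightarrow> ennreal (norm (H \<omega> s - bohr_lift (shift s Q) \<omega>) powr p)"
            using p by (intro tendsto_ennrealI tendsto_powr' tendsto_norm tendsto_const)
              (auto simp: shift_diff bohr_lift_diff shift_polys poly Q)
          then show ?case by (rule lim_imp_Liminf[OF sequentially_bot, symmetric])
        qed
      qed
      also have "\<dots> \<le> liminf (\<lambda>k. \<integral>\<^sup>+\<omega>. ennreal (norm (?b k \<omega>) powr p) \<partial>torus)"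
        by (rule nn_integral_liminf) measurable
      also have "\<dots> \<le> liminf (\<lambda>k. ennreal (real m powr (- p * Re s) * hmean p (\<lambda>n. P k n - Q n)))"
      proof (rule Liminf_mono, rule always_eventually, rule allI)
        fix k
        have d: "(\<lambda>n. P k n - Q n) \<in> dirichlet_polys" by (rule dirichlet_polys_diff[OF poly Q])
        show "torus_mean p (?b k) \<le> ennreal (real m powr (- p * Re s) * hmean p (\<lambda>n. P k n - Q n))"
          unfolding nn_integral_bohr_lift[OF p] hmean_shift_Re[OF d p, of s]
          by (rule ennreal_leI, rule hmean_shift_decay[OF d p m]) (use Pm Qm s0 in auto)
      qed
      also have "\<dots> = ennreal (real m powr (- p * Re s) * e)"
        by (rule lim_imp_Liminf) (auto intro!: tendsto_ennrealI tendsto_mult e)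
      finally show "torus_mean p (\<lambda>\<omega>. H \<omega> s - bohr_lift (shift s Q) \<omega>)
             \<le> ennreal (real m powr (- p * Re s) * e)" .
    qed
  qed
qed

lemma moment_integrand_measurable: "(\<lambda>s. ennreal (weight s) * ennreal (real m powr (- p * Re s))) \<in> borel_measurable \<mu>"
proof -
  have [measurable]: "weight \<in> borel_measurable \<mu>" by (rule weight_measurable[OF sets_mu])
  show ?thesis by measurable
qed

lemma nn_integral_weight_le:
  assumes "\<And>s. s \<in> half_plane \<Longrightarrow> f s \<le> ennreal (real m powr (- p * Re s)) * c"
  shows "(\<integral>\<^sup>+s. ennreal (weight s) * f s \<partial>\<mu>) \<le> weight_moment \<mu> p m * c"
proof -
  have "(\<integral>\<^sup>+s. ennreal (weight s) * f s \<partial>\<mu>) \<le> (\<integral>\<^sup>+s. ennreal (weight s) * (ennreal (real m powr (- p * Re s)) * c) \<partial>\<mu>)"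
    using assms by (intro nn_integral_mono mult_left_mono) (auto simp: space_mu)
  also have "\<dots> = weight_moment \<mu> p m * c"
    unfolding weight_moment_eq using moment_integrand_measurable
    by (subst nn_integral_multc[symmetric]) (auto simp: mult.assoc)
  finally show ?thesis .
qed

theorem area_op_norm_le:
  assumes p: "0 < p" and m: "0 < m" and a: "a \<in> hardy p" and am: "\<And>n. n < m \<Longrightarrow> a n = 0"
  shows "area_op \<mu> p a \<in> borel_measurable strip_measure"
    and "(\<integral>\<^sup>+x. epowr (e2ennreal \<bar>area_op \<mu> p a x\<bar>) p \<partial>(torus \<Otimes>\<^sub>M line_measure))
       \<le> weight_moment \<mu> p m * ennreal (hardy_norm p a powr p)"
proof -
  obtain P H where P: "approximates p P a" "\<forall>k. \<forall>n<m. P k n = 0"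
    and H: "jointly_measurable H"
    and ae: "area_version p (area_op \<mu> p a) H"
    and est: "\<forall>Q e s. Q \<in> dirichlet_polys \<longrightarrow> (\<forall>n<m. Q n = 0) \<longrightarrow> (\<lambda>k. hmean p (\<lambda>n. P k n - Q n)) \<longlonglongrightarrow> e \<longrightarrow>
        s \<in> half_plane \<longrightarrow> torus_mean p (\<lambda>\<omega>. H \<omega> s - bohr_lift (shift s Q) \<omega>)
           \<le> ennreal (real m powr (- p * Re s) * e)"
    by (rule hardy_representation[OF p m a am])
  show "area_op \<mu> p a \<in> borel_measurable strip_measure" by (rule area_function(1)[OF p H ae])
  have le: "torus_mean p (\<lambda>\<omega>. H \<omega> s) \<le> ennreal (real m powr (- p * Re s)) * ennreal (hardy_norm p a powr p)"
    if s: "s \<in> half_plane" for s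
  proof -
    have z: "(\<lambda>n::nat. 0::complex) \<in> dirichlet_polys" by (simp add: dirichlet_polys_def)
    have "(\<lambda>k. hmean p (\<lambda>n. P k n - 0)) \<longlonglongrightarrow> hardy_norm p a powr p"
      using hardy_norm_limit(1)[OF p P(1)] by simp
    with est z s have "torus_mean p (\<lambda>\<omega>. H \<omega> s - bohr_lift (shift s (\<lambda>n. 0)) \<omega>)
           \<le> ennreal (real m powr (- p * Re s) * hardy_norm p a powr p)" by blast
    then show ?thesis
      by (simp add: bohr_lift_shift[OF z] ennreal_mult'')
  qed
  show "(\<integral>\<^sup>+x. epowr (e2ennreal \<bar>area_op \<mu> p a x\<bar>) p \<partial>(torus \<Otimes>\<^sub>M line_measure))
       \<le> weight_moment \<mu> p m * ennreal (hardy_norm p a powr p)"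
    unfolding area_function(2)[OF p H ae] by (rule nn_integral_weight_le[OF le])
qed

lemma area_op_monomial_norm:
  assumes p: "0 < p" and m: "0 < m"
  shows "Lpi_norm p (area_op \<mu> p (monomial m)) = epowr (weight_moment \<mu> p m) (1 / p)"
proof -
  interpret torus: prob_space torus by (rule prob_space_torus)
  let ?h = "\<lambda>\<omega> s. bohr_lift (shift s (monomial m)) \<omega>"
  have "(\<integral>\<^sup>+x. epowr (e2ennreal \<bar>area_op \<mu> p (monomial m) x\<bar>) p \<partial>(torus \<Otimes>\<^sub>M line_measure))
      = (\<integral>\<^sup>+s. ennreal (weight s) * torus_mean p (\<lambda>\<omega>. ?h \<omega> s) \<partial>\<mu>)"
  proof (rule area_function(2)[OF p shift_joint_measurable[OF monomial_polys[OF m]]])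
    show "area_version p (area_op \<mu> p (monomial m)) ?h"
      unfolding area_op_eq
      by (intro AE_I2 allI arg_cong[where f = enn2ereal] arg_cong2[where f = epowr] refl cone_integral_cong
            vertical_limit_poly monomial_polys m)
  qed
  also have "\<dots> = weight_moment \<mu> p m"
    unfolding weight_moment_eq
  proof (rule nn_integral_cong)
    fix s
    have "torus_mean p (\<lambda>\<omega>. ?h \<omega> s) = (\<integral>\<^sup>+\<omega>. ennreal (real m powr (- p * Re s)) \<partial>torus)"
      by (rule nn_integral_cong) (simp add: norm_bohr_lift_monomial m powr_powr mult.commute)
    then show "ennreal (weight s) * torus_mean p (\<lambda>\<omega>. ?h \<omega> s)
       = ennreal (weight s) * ennreal (real m powr (- p * Re s))"
      by (simp add: torus.emeasure_space_1)
  qed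
  finally show ?thesis by (simp add: Lpi_norm_eq)
qed

end

text \<open>
  The series starting at \<open>n = m\<close>; the two spaces of the theorem are the cases \<open>m = 1\<close> and \<open>m = 2\<close>.
\<close>

definition hardy_from :: "real \<Rightarrow> nat \<Rightarrow> (nat \<Rightarrow> complex) set" where
  "hardy_from p m = {a \<in> hardy p. \<forall>n<m. a n = 0}"

lemma hardy_zero_coefficient:
  assumes "a \<in> hardy p" shows "a 0 = 0"
proof -
  obtain P where "approximates p P a" using assms by (auto simp: hardy_def)
  then have P: "\<And>k. P k \<in> dirichlet_polys" "(\<lambda>k. P k 0) \<longlonglongrightarrow> a 0"
    by (simp_all add: approximates_def)
  then have "(\<lambda>k::nat. 0) \<longlonglongrightarrow> a 0" by (simp add: dirichlet_polysD(2))
  then show ?thesis by (simp add: LIMSEQ_const_iff)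
qed

lemma hardy_eq: "hardy p = hardy_from p 1"
  by (auto simp: hardy_from_def hardy_zero_coefficient)

lemma hardy0_eq: "hardy0 p = hardy_from p 2"
  by (auto simp: hardy_from_def hardy0_def hardy_zero_coefficient less_2_cases_iff)

lemma monomial_hardy_from:
  assumes "0 < p" "0 < m"
  shows "monomial m \<in> hardy_from p m" and "hardy_norm p (monomial m) = 1"
proof -
  show "monomial m \<in> hardy_from p m"
    using hardy_poly(1)[OF assms(1) monomial_polys[OF assms(2)]] by (auto simp: hardy_from_def monomial_def)
  have A: "approximates p (\<lambda>k. monomial m) (monomial m)"
    unfolding approximates_iff[OF assms(1)] hcauchy_def using hmean_le[OF assms(1), of "\<lambda>n. 0"] assms
    by (auto simp: monomial_polys intro: le_less_trans)
  have "hardy_norm p (monomial m) powr p = 1"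
    using hardy_poly(2)[OF assms(1) monomial_polys[OF assms(2)]] by (simp add: hmean_monomial assms)
  then have "(hardy_norm p (monomial m) powr p) powr (1 / p) = 1 powr (1 / p)" by simp
  then show "hardy_norm p (monomial m) = 1"
    using assms(1) hardy_norm_limit(2)[OF assms(1) A] by (simp add: powr_powr)
qed

text \<open>
  Both boundedness and compactness put the image of the monomial into the target space, so this is the
  necessity part of both equivalences.
\<close>

lemma moment_finite_of_Lpi:
  assumes p: "0 < p" and sets: "sets \<mu> = sets (restrict_space borel half_plane)" and m: "0 < m"
    and Lpi: "area_op \<mu> p (monomial m) \<in> Lpi p"
  shows "weight_moment \<mu> p m < \<infinity>"
proof -
  interpret half_plane_measure \<mu>
    using sigma_finite_of_area_op[OF p sets m Lpi] sets by (simp add: half_plane_measure_def half_plane_measure_axioms_def)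
  show ?thesis using Lpi area_op_monomial_norm[OF p m] by (simp add: Lpi_def)
qed

theorem area_bound_iff:
  assumes p: "0 < p" and sets: "sets \<mu> = sets (restrict_space borel half_plane)" and m: "0 < m"
    and fin: "weight_moment \<mu> p m < \<infinity>"
  shows "area_bound \<mu> p p (hardy_from p m) C \<longleftrightarrow> enn2real (weight_moment \<mu> p m) powr (1 / p) \<le> C"
proof -
  interpret half_plane_measure \<mu>
    using sigma_finite_of_moment[OF sets m fin] sets by (simp add: half_plane_measure_def half_plane_measure_axioms_def)
  define c where "c = enn2real (weight_moment \<mu> p m)"
  have c: "weight_moment \<mu> p m = ennreal c" "0 \<le> c" using fin by (auto simp: c_def)
  show ?thesis
    unfolding c_def[symmetric]
  proof
    assume "area_bound \<mu> p p (hardy_from p m) C"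
    then have "0 \<le> C" "Lpi_norm p (area_op \<mu> p (monomial m)) \<le> ennreal (C * hardy_norm p (monomial m))"
      using monomial_hardy_from(1)[OF p m] by (auto simp: area_bound_def)
    then show "c powr (1 / p) \<le> C"
      using c by (simp add: area_op_monomial_norm[OF p m] monomial_hardy_from(2)[OF p m] epowr_ennreal)
  next
    assume C: "c powr (1 / p) \<le> C"
    then have C0: "0 \<le> C" by (rule order_trans[rotated]) simp
    have "area_op \<mu> p a \<in> Lpi p \<and> Lpi_norm p (area_op \<mu> p a) \<le> ennreal (C * hardy_norm p a)"
      if a: "a \<in> hardy_from p m" for a
    proof -
      have a': "a \<in> hardy p" "\<And>n. n < m \<Longrightarrow> a n = 0" using a by (auto simp: hardy_from_def)
      obtain P where "approximates p P a" using a'(1) by (auto simp: hardy_def)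
      from hardy_norm_limit(2)[OF p this] have n0: "0 \<le> hardy_norm p a" .
      have "Lpi_norm p (area_op \<mu> p a) \<le> epowr (ennreal c * ennreal (hardy_norm p a powr p)) (1 / p)"
        unfolding Lpi_norm_eq using area_op_norm_le(2)[OF p m a'] p by (intro epowr_mono) (auto simp: c)
      also have "\<dots> = ennreal (c powr (1 / p) * hardy_norm p a)"
        using c n0 p by (simp add: ennreal_mult'[symmetric] epowr_ennreal powr_mult powr_powr)
      also have "\<dots> \<le> ennreal (C * hardy_norm p a)" using C n0 by (intro ennreal_leI mult_right_mono)
      finally have "Lpi_norm p (area_op \<mu> p a) \<le> ennreal (C * hardy_norm p a)" .
      moreover from this have "Lpi_norm p (area_op \<mu> p a) < \<infinity>" by (rule le_less_trans) simp
      ultimately show ?thesis using area_op_norm_le(1)[OF p m a'] by (simp add: Lpi_def)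
    qed
    then show "area_bound \<mu> p p (hardy_from p m) C" using C0 by (simp add: area_bound_def)
  qed
qed

lemma area_opnorm_eq:
  assumes p: "0 < p" and sets: "sets \<mu> = sets (restrict_space borel half_plane)" and m: "0 < m"
    and fin: "weight_moment \<mu> p m < \<infinity>"
  shows "ennreal (area_opnorm \<mu> p p (hardy_from p m) powr p) = weight_moment \<mu> p m"
proof -
  have "area_opnorm \<mu> p p (hardy_from p m) = enn2real (weight_moment \<mu> p m) powr (1 / p)"
    unfolding area_opnorm_def area_bound_iff[OF assms] by (rule Least_equality) auto
  then show ?thesis using p fin by (simp add: powr_powr)
qed

section \<open>Relatively compact sets in quasi-metric spaces\<close>

text \<open>
  The usual argument for metric spaces (Lebesgue number of a cover and total boundedness), for a
  distance that satisfies a quasi-triangle inequality and may vanish between different points, such as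
  functions that agree almost everywhere.
\<close>

lemma compactin_closure_of_quasi_metric:
  fixes d :: "'a \<Rightarrow> 'a \<Rightarrow> real"
  assumes top: "topspace T = X"
    and openin: "\<And>U. openin T U \<longleftrightarrow> U \<subseteq> X \<and> (\<forall>x\<in>U. \<exists>e>0. \<forall>y\<in>X. d x y < e \<longrightarrow> y \<in> U)"
    and nonneg: "\<And>x y. 0 \<le> d x y" and sym: "\<And>x y. d x y = d y x"
    and K: "0 < K" "\<And>x y z. x \<in> X \<Longrightarrow> y \<in> X \<Longrightarrow> z \<in> X \<Longrightarrow> d x z \<le> K * (d x y + d y z)"
    and complete: "\<And>x :: nat \<Rightarrow> 'a. (\<And>n. x n \<in> X) \<Longrightarrow> (\<And>e. 0 < e \<Longrightarrow> \<exists>N. \<forall>i\<ge>N. \<forall>j\<ge>N. d (x i) (x j) < e)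
        \<Longrightarrow> \<exists>l\<in>X. (\<lambda>n. d l (x n)) \<longlonglongrightarrow> 0"
    and S: "S \<subseteq> X"
    and pre: "\<And>x :: nat \<Rightarrow> 'a. (\<And>n. x n \<in> S) \<Longrightarrow>
        \<exists>r::nat \<Rightarrow> nat. strict_mono r \<and> (\<forall>e>0. \<exists>N. \<forall>i\<ge>N. \<forall>j\<ge>N. d (x (r i)) (x (r j)) < e)"
  shows "compactin T (T closure_of S)"
proof -
  let ?C = "T closure_of S"
  have CX: "?C \<subseteq> X" using closure_of_subset_topspace[of T S] top by simp
  have near: "\<exists>y\<in>S. d x y < e" if x: "x \<in> ?C" and e: "0 < e" for x e
  proof (rule ccontr)
    assume no: "\<not> (\<exists>y\<in>S. d x y < e)"
    \<comment> \<open>Balls of a quasi-metric need not be open; the set of points at positive distance from \<open>S\<close> is.\<close>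
    let ?U = "{z \<in> X. \<exists>\<delta>>0. \<forall>y\<in>S. \<delta> \<le> d z y}"
    have "openin T ?U"
      unfolding openin
    proof (intro conjI ballI)
      fix z assume "z \<in> ?U"
      then obtain \<delta> where z: "z \<in> X" and \<delta>: "0 < \<delta>" "\<And>y. y \<in> S \<Longrightarrow> \<delta> \<le> d z y" by auto
      let ?\<eta> = "\<delta> / (2 * K)"
      have \<eta>: "0 < ?\<eta>" using \<delta> K by simp
      have "z' \<in> ?U" if z': "z' \<in> X" "d z z' < ?\<eta>" for z'
      proof -
        have "?\<eta> \<le> d z' y" if y: "y \<in> S" for y
        proof (rule ccontr)
          assume "\<not> ?\<eta> \<le> d z' y"
          then have "K * (d z z' + d z' y) < K * (?\<eta> + ?\<eta>)" using z' K by (intro mult_strict_left_mono) auto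
          also have "\<dots> = \<delta>" using K by (simp add: field_simps)
          finally show False using K(2)[OF z z'(1), of y] \<delta>(2)[OF y] y S by auto
        qed
        then show ?thesis using z' \<eta> by blast
      qed
      then show "\<exists>e>0. \<forall>y\<in>X. d z y < e \<longrightarrow> y \<in> ?U" using \<eta> by blast
    qed auto
    moreover have "x \<in> ?U"
    proof -
      have "\<forall>y\<in>S. e \<le> d x y" using no by (meson not_less)
      then show ?thesis using x CX e by blast
    qed
    moreover have "\<And>U. x \<in> U \<Longrightarrow> openin T U \<Longrightarrow> \<exists>y. y \<in> S \<and> y \<in> U" using x unfolding in_closure_of by blast
    ultimately obtain y where "y \<in> S" "y \<in> ?U" by meson
    then obtain \<delta> where "0 < \<delta>" "\<delta> \<le> d y y" by blast
    moreover have "d y y = 0"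
    proof -
      have "y \<in> X" using \<open>y \<in> S\<close> S by blast
      then obtain l where l: "l \<in> X" "(\<lambda>n::nat. d l y) \<longlonglongrightarrow> 0"
        using complete[of "\<lambda>_. y"] pre[of "\<lambda>_. y"] \<open>y \<in> S\<close> by blast
      then have "d l y = 0" by (simp add: LIMSEQ_const_iff)
      then show ?thesis using K(2)[of y l y] l \<open>y \<in> X\<close> nonneg[of y y] sym[of y l] by simp
    qed
    ultimately show False by simp
  qed
  have seq: "\<exists>l\<in>?C. \<exists>r::nat \<Rightarrow> nat. strict_mono r \<and> (\<lambda>n. d l (x (r n))) \<longlonglongrightarrow> 0" if x: "\<And>n::nat. x n \<in> ?C" for x
  proof -
    have "\<exists>y\<in>S. d (x n) y < 1 / real (Suc n)" for n by (rule near[OF x]) simp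
    then obtain s where s: "\<And>n. s n \<in> S" "\<And>n. d (x n) (s n) < 1 / real (Suc n)" by metis
    obtain r :: "nat \<Rightarrow> nat" where r: "strict_mono r" and cauchy: "\<forall>e>0. \<exists>N. \<forall>i\<ge>N. \<forall>j\<ge>N. d (s (r i)) (s (r j)) < e"
      using pre[of s, OF s(1)] by blast
    have sX: "s n \<in> X" and xX: "x n \<in> X" for n using s(1)[of n] S x[of n] CX by auto
    obtain l where l: "l \<in> X" "(\<lambda>n. d l (s (r n))) \<longlonglongrightarrow> 0"
      using complete[of "\<lambda>n. s (r n)", OF sX cauchy[THEN spec, THEN mp]] by auto
    have inv: "(\<lambda>n. 1 / real (Suc (r n))) \<longlonglongrightarrow> 0"
      using LIMSEQ_subseq_LIMSEQ[OF LIMSEQ_inverse_real_of_nat r] by (simp add: o_def inverse_eq_divide)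
    have lx: "(\<lambda>n. d l (x (r n))) \<longlonglongrightarrow> 0"
    proof (rule tendsto_sandwich[of "\<lambda>_. 0" _ _ "\<lambda>n. K * (d l (s (r n)) + 1 / real (Suc (r n)))"])
      have "d l (x (r n)) \<le> K * (d l (s (r n)) + 1 / real (Suc (r n)))" for n
      proof -
        have "d l (x (r n)) \<le> K * (d l (s (r n)) + d (s (r n)) (x (r n)))" by (rule K(2)[OF l(1) sX xX])
        also have "\<dots> \<le> K * (d l (s (r n)) + 1 / real (Suc (r n)))"
          using s(2)[of "r n"] K(1) by (intro mult_left_mono add_left_mono) (auto simp: sym[of "s (r n)"] less_imp_le)
        finally show ?thesis .
      qed
      then show "\<forall>\<^sub>F n in sequentially. d l (x (r n)) \<le> K * (d l (s (r n)) + 1 / real (Suc (r n)))" by simp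
      show "(\<lambda>n. K * (d l (s (r n)) + 1 / real (Suc (r n)))) \<longlonglongrightarrow> 0"
        using tendsto_mult[OF tendsto_const tendsto_add[OF l(2) inv], of K] by simp
    qed (use nonneg in auto)
    have "l \<in> ?C"
    proof (rule ccontr)
      assume "l \<notin> ?C"
      moreover have "openin T (topspace T - ?C)" by (simp add: openin_diff)
      ultimately obtain e where e: "0 < e" "\<And>y. y \<in> X \<Longrightarrow> d l y < e \<Longrightarrow> y \<in> X - ?C"
        unfolding openin top using l(1) by blast
      from order_tendstoD(2)[OF lx e(1)] obtain n where "d l (x (r n)) < e" by (auto simp: eventually_sequentially)
      then show False using e(2)[OF xX] x by blast
    qed
    then show ?thesis using r lx by blast
  qed
  show ?thesis
    unfolding compactin_def
  proof (intro conjI allI impI)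
    show "?C \<subseteq> topspace T" using CX top by simp
    fix \<U> assume \<U>: "Ball \<U> (openin T) \<and> ?C \<subseteq> \<Union>\<U>"
    have "\<exists>e>0. \<forall>x\<in>?C. \<exists>U\<in>\<U>. \<forall>y\<in>X. d x y < e \<longrightarrow> y \<in> U"
    proof (rule ccontr)
      assume no: "\<not> ?thesis"
      have "\<exists>x\<in>?C. \<forall>U\<in>\<U>. \<exists>y\<in>X. d x y < 1 / real (Suc n) \<and> y \<notin> U" for n
      proof -
        have "0 < 1 / real (Suc n)" by simp
        with no show ?thesis by meson
      qed
      then obtain x where x: "\<And>n. x n \<in> ?C" "\<And>n U. U \<in> \<U> \<Longrightarrow> \<exists>y\<in>X. d (x n) y < 1 / real (Suc n) \<and> y \<notin> U" by metis
      obtain l r where l: "l \<in> ?C" and r: "strict_mono r" and lim: "(\<lambda>n. d l (x (r n))) \<longlonglongrightarrow> 0"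
        using seq[of x, OF x(1)] by blast
      obtain U where U: "U \<in> \<U>" "l \<in> U" using l \<U> by blast
      then have "openin T U" using \<U> by blast
      then have "\<forall>x\<in>U. \<exists>e>0. \<forall>y\<in>X. d x y < e \<longrightarrow> y \<in> U" unfolding openin by (rule conjunct2)
      then obtain e where e: "0 < e" "\<And>y. y \<in> X \<Longrightarrow> d l y < e \<Longrightarrow> y \<in> U"
        using U(2) by blast
      have inv: "(\<lambda>n. 1 / real (Suc (r n))) \<longlonglongrightarrow> 0"
        using LIMSEQ_subseq_LIMSEQ[OF LIMSEQ_inverse_real_of_nat r] by (simp add: o_def inverse_eq_divide)
      have "(\<lambda>n. K * (d l (x (r n)) + 1 / real (Suc (r n)))) \<longlonglongrightarrow> 0"
        using tendsto_mult[OF tendsto_const tendsto_add[OF lim inv], of K] by simp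
      from order_tendstoD(2)[OF this e(1)] obtain n where n: "K * (d l (x (r n)) + 1 / real (Suc (r n))) < e"
        by (auto simp: eventually_sequentially)
      obtain y where y: "y \<in> X" "d (x (r n)) y < 1 / real (Suc (r n))" "y \<notin> U" using x(2)[OF U(1)] by blast
      have "d l y \<le> K * (d l (x (r n)) + d (x (r n)) y)" using l x(1)[of "r n"] CX y by (intro K(2)) auto
      also have "\<dots> \<le> K * (d l (x (r n)) + 1 / real (Suc (r n)))" using y K(1) by (intro mult_left_mono) auto
      also have "\<dots> < e" by (rule n)
      finally show False using e(2)[OF y(1)] y(3) by blast
    qed
    then obtain e where e: "0 < e" "\<And>x. x \<in> ?C \<Longrightarrow> \<exists>U\<in>\<U>. \<forall>y\<in>X. d x y < e \<longrightarrow> y \<in> U" by blast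
    have "\<exists>A. finite A \<and> A \<subseteq> ?C \<and> (\<forall>x\<in>?C. \<exists>a\<in>A. d a x < e)"
    proof (rule ccontr)
      assume no: "\<not> ?thesis"
      have "\<exists>x. \<forall>n::nat. x n \<in> ?C \<and> (\<forall>i<n. e \<le> d (x i) (x n))"
      proof (rule dependent_wellorder_choice)
        fix n :: nat and f assume "\<And>i. i < n \<Longrightarrow> f i \<in> ?C \<and> (\<forall>j<i. e \<le> d (f j) (f i))"
        then have "f ` {..<n} \<subseteq> ?C" by auto
        then have "\<not> (\<forall>x\<in>?C. \<exists>a\<in>f ` {..<n}. d a x < e)" using no by blast
        then show "\<exists>y. y \<in> ?C \<and> (\<forall>i<n. e \<le> d (f i) y)" by (auto simp: not_less)
      qed auto
      then obtain x where x: "\<And>n::nat. x n \<in> ?C" "\<And>i n. i < n \<Longrightarrow> e \<le> d (x i) (x n)" by blast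
      obtain l r where l: "l \<in> ?C" and r: "strict_mono r" and lim: "(\<lambda>n. d l (x (r n))) \<longlonglongrightarrow> 0"
        using seq[of x, OF x(1)] by blast
      have "0 < e / (2 * K)" using e K by simp
      from order_tendstoD(2)[OF lim this] obtain n where n: "\<And>k. n \<le> k \<Longrightarrow> d l (x (r k)) < e / (2 * K)"
        by (auto simp: eventually_sequentially)
      have "d (x (r n)) (x (r (Suc n))) \<le> K * (d (x (r n)) l + d l (x (r (Suc n))))"
        using x(1) l CX by (intro K(2)) auto
      also have "\<dots> < K * (e / (2 * K) + e / (2 * K))"
        using n[of n] n[of "Suc n"] K(1) by (intro mult_strict_left_mono add_strict_mono) (auto simp: sym[of _ l])
      also have "\<dots> = e" using K by (simp add: field_simps)
      finally show False using x(2)[of "r n" "r (Suc n)"] r by (auto simp: strict_mono_def)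
    qed
    then obtain A where A: "finite A" "A \<subseteq> ?C" "\<And>x. x \<in> ?C \<Longrightarrow> \<exists>a\<in>A. d a x < e" by blast
    have "\<forall>a\<in>A. \<exists>U\<in>\<U>. \<forall>y\<in>X. d a y < e \<longrightarrow> y \<in> U" using e(2) A(2) by blast
    then obtain V where V: "\<And>a. a \<in> A \<Longrightarrow> V a \<in> \<U>" "\<And>a y. a \<in> A \<Longrightarrow> y \<in> X \<Longrightarrow> d a y < e \<Longrightarrow> y \<in> V a" by metis
    have "?C \<subseteq> \<Union> (V ` A)"
    proof
      fix x assume x: "x \<in> ?C"
      then obtain a where "a \<in> A" "d a x < e" using A(3) by blast
      then show "x \<in> \<Union> (V ` A)" using V(2)[of a x] x CX by blast
    qed
    then show "\<exists>\<F>. finite \<F> \<and> \<F> \<subseteq> \<U> \<and> ?C \<subseteq> \<Union>\<F>"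
      using A(1) V(1) by (intro exI[of _ "V ` A"]) auto
  qed
qed

section \<open>Completeness and precompactness in the target space\<close>

text \<open>
  The Riesz--Fischer theorem: a rapidly converging subsequence converges almost everywhere, and Fatou's
  lemma turns this into convergence in mean.
\<close>

lemma powr_mean_complete:
  fixes f :: "nat \<Rightarrow> 'a \<Rightarrow> real"
  assumes p: "0 < p" and f [measurable]: "\<And>k. f k \<in> borel_measurable M"
    and cauchy: "\<And>e. 0 < e \<Longrightarrow> \<exists>K. \<forall>i\<ge>K. \<forall>j\<ge>K. (\<integral>\<^sup>+x. ennreal (\<bar>f i x - f j x\<bar> powr p) \<partial>M) < ennreal e"
  obtains l where "l \<in> borel_measurable M"
    "\<forall>e>0. \<exists>K. \<forall>k\<ge>K. (\<integral>\<^sup>+x. ennreal (\<bar>l x - f k x\<bar> powr p) \<partial>M) \<le> ennreal e"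
proof -
  let ?D = "\<lambda>i j. \<integral>\<^sup>+x. ennreal (\<bar>f i x - f j x\<bar> powr p) \<partial>M"
  have "\<exists>K. \<forall>i\<ge>K. \<forall>j\<ge>K. ?D i j < ennreal ((1/4) ^ k)" for k by (rule cauchy) simp
  from fast_subsequence[of "\<lambda>k i j. ?D i j < ennreal ((1/4) ^ k)", OF this]
  obtain r where mono: "strict_mono r" and fast: "\<And>k. ?D (r (Suc k)) (r k) < ennreal ((1/4) ^ k)" by blast
  define l where "l x = lim (\<lambda>k. f (r k) x)" for x
  have l [measurable]: "l \<in> borel_measurable M" unfolding l_def[abs_def] by (rule borel_measurable_lim_metric) measurable
  have "AE x in M. \<exists>C\<ge>0. \<forall>k. ennreal (\<bar>f (r (Suc k)) x - f (r k) x\<bar> powr p) \<le> ennreal (C * (1/2) ^ k)"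
  proof (rule fast_AE_bound)
    show "(\<integral>\<^sup>+x. ennreal (\<bar>f (r (Suc k)) x - f (r k) x\<bar> powr p) \<partial>M) \<le> ennreal ((1/4) ^ k)" for k
      using fast[of k] by (rule less_imp_le)
  qed measurable
  then have conv: "AE x in M. (\<lambda>k. f (r k) x) \<longlonglongrightarrow> l x"
  proof eventually_elim
    case (elim x)
    then obtain C where C: "0 \<le> C" "\<And>k. ennreal (\<bar>f (r (Suc k)) x - f (r k) x\<bar> powr p) \<le> ennreal (C * (1/2) ^ k)" by blast
    have "uniform_limit {x} (\<lambda>k. f (r k)) l sequentially"
      unfolding l_def[abs_def]
    proof (rule uniform_limit_telescoping)
      fix k y assume "y \<in> {x}"
      then have "\<bar>f (r (Suc k)) y - f (r k) y\<bar> powr p \<le> C * (1/2) ^ k"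
        using C(2)[of k] C(1) by (simp add: ennreal_le_iff)
      then have "(\<bar>f (r (Suc k)) y - f (r k) y\<bar> powr p) powr (1 / p) \<le> (C * (1/2) ^ k) powr (1 / p)"
        using p by (intro powr_mono2) auto
      also have "\<dots> = C powr (1 / p) * ((1/2) powr (1 / p)) ^ k"
        using C(1) by (subst powr_mult) (auto simp: power_powr_commute simp del: power_one_over)
      finally show "norm (f (r (Suc k)) y - f (r k) y) \<le> C powr (1 / p) * ((1/2) powr (1 / p)) ^ k"
        using p by (simp add: powr_powr)
    next
      have "(1/2) powr (1 / p) < (1::real)" using p by (simp add: powr01_less_one)
      then show "summable (\<lambda>k. C powr (1 / p) * ((1/2) powr (1 / p)) ^ k)"
        by (intro summable_mult summable_geometric) simp
    qed
    then show ?case by (rule tendsto_uniform_limitI) simp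
  qed
  show ?thesis
  proof (rule that[OF l], intro allI impI)
    fix e :: real assume e: "0 < e"
    obtain N where N: "\<And>i j. N \<le> i \<Longrightarrow> N \<le> j \<Longrightarrow> ?D i j < ennreal e" using cauchy[OF e] by blast
    have "(\<integral>\<^sup>+x. ennreal (\<bar>l x - f k x\<bar> powr p) \<partial>M) \<le> ennreal e" if k: "N \<le> k" for k
    proof -
      have "(\<integral>\<^sup>+x. ennreal (\<bar>l x - f k x\<bar> powr p) \<partial>M) = (\<integral>\<^sup>+x. liminf (\<lambda>i. ennreal (\<bar>f (r i) x - f k x\<bar> powr p)) \<partial>M)"
      proof (rule nn_integral_cong_AE, use conv in eventually_elim)
        case (elim x)
        then have "(\<lambda>i. ennreal (\<bar>f (r i) x - f k x\<bar> powr p)) \<longlonglongrightarrow> ennreal (\<bar>l x - f k x\<bar> powr p)"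
          using p by (intro tendsto_ennrealI tendsto_powr' tendsto_rabs tendsto_diff tendsto_const) auto
        then show ?case by (rule lim_imp_Liminf[OF sequentially_bot, symmetric])
      qed
      also have "\<dots> \<le> liminf (\<lambda>i. ?D (r i) k)" by (rule nn_integral_liminf) measurable
      also have "\<dots> \<le> liminf (\<lambda>i. ennreal e)"
      proof (rule Liminf_mono)
        show "\<forall>\<^sub>F i in sequentially. ?D (r i) k \<le> ennreal e"
          using eventually_ge_at_top[of N]
          by eventually_elim (use N[OF _ k] seq_suble[OF mono] in \<open>meson le_trans less_imp_le\<close>)
      qed
      also have "\<dots> = ennreal e" by (simp add: Liminf_const)
      finally show ?thesis .
    qed
    then show "\<exists>K. \<forall>k\<ge>K. (\<integral>\<^sup>+x. ennreal (\<bar>l x - f k x\<bar> powr p) \<partial>M) \<le> ennreal e" by blast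
  qed
qed

definition real_mean :: "real \<Rightarrow> ('x \<Rightarrow> real) \<Rightarrow> 'x measure \<Rightarrow> ennreal" where
  "real_mean p f M = (\<integral>\<^sup>+x. ennreal (\<bar>f x\<bar> powr p) \<partial>M)"

lemma real_mean_add:
  assumes p: "0 < p" and [measurable]: "f \<in> borel_measurable M" "g \<in> borel_measurable M"
  shows "real_mean p (\<lambda>x. f x + g x) M \<le> ennreal (2 powr p) * (real_mean p f M + real_mean p g M)"
proof -
  have "real_mean p (\<lambda>x. f x + g x) M \<le> (\<integral>\<^sup>+x. ennreal (2 powr p) * (ennreal (\<bar>f x\<bar> powr p) + ennreal (\<bar>g x\<bar> powr p)) \<partial>M)"
    unfolding real_mean_def
  proof (rule nn_integral_mono)
    fix x
    have "\<bar>f x + g x\<bar> powr p \<le> (\<bar>f x\<bar> + \<bar>g x\<bar>) powr p" using p by (intro powr_mono2) auto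
    also have "\<dots> \<le> 2 powr p * (\<bar>f x\<bar> powr p + \<bar>g x\<bar> powr p)"
      using powr_add_le[of "\<bar>f x\<bar>" "\<bar>g x\<bar>" 1 p] p by (simp add: ring_distribs)
    finally show "ennreal (\<bar>f x + g x\<bar> powr p) \<le> ennreal (2 powr p) * (ennreal (\<bar>f x\<bar> powr p) + ennreal (\<bar>g x\<bar> powr p))"
      by (simp add: ennreal_mult'[symmetric] ennreal_plus[symmetric] ennreal_leI del: ennreal_plus)
  qed
  also have "\<dots> = ennreal (2 powr p) * (real_mean p f M + real_mean p g M)"
    unfolding real_mean_def by (simp add: nn_integral_cmult nn_integral_add)
  finally show ?thesis .
qed

abbreviation real_fun :: "('x \<Rightarrow> ereal) \<Rightarrow> 'x \<Rightarrow> real" where "real_fun F x \<equiv> real_of_ereal (F x)"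

lemma LpiD:
  assumes p: "0 < p" and F: "F \<in> Lpi p"
  shows Lpi_measurable: "real_fun F \<in> borel_measurable strip_measure"
    and Lpi_AE_finite: "AE x in strip_measure. \<bar>F x\<bar> \<noteq> \<infinity>"
    and Lpi_real_mean: "real_mean p (real_fun F) strip_measure < \<infinity>"
proof -
  have F': "F \<in> borel_measurable strip_measure" "Lpi_norm p F < \<infinity>" using F by (auto simp: Lpi_def)
  show "real_fun F \<in> borel_measurable strip_measure" using F'(1) by measurable
  have "(\<lambda>x. epowr (e2ennreal \<bar>F x\<bar>) p) \<in> borel_measurable strip_measure"
    using F'(1) by (intro measurable_compose[OF _ epowr_measurable]) measurable
  moreover have fin: "(\<integral>\<^sup>+x. epowr (e2ennreal \<bar>F x\<bar>) p \<partial>strip_measure) < \<infinity>"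
    using F'(2) by (simp add: Lpi_norm_def)
  ultimately have "AE x in strip_measure. epowr (e2ennreal \<bar>F x\<bar>) p \<noteq> \<infinity>"
    by (intro nn_integral_PInf_AE) auto
  then show ae: "AE x in strip_measure. \<bar>F x\<bar> \<noteq> \<infinity>"
    by eventually_elim auto
  have "(\<integral>\<^sup>+x. epowr (e2ennreal \<bar>F x\<bar>) p \<partial>strip_measure) = real_mean p (real_fun F) strip_measure"
    unfolding real_mean_def
  proof (rule nn_integral_cong_AE, use ae in eventually_elim)
    case (elim x)
    then obtain y where "F x = ereal y" by (cases "F x") auto
    then show ?case by (simp add: epowr_ennreal)
  qed
  with fin show "real_mean p (real_fun F) strip_measure < \<infinity>" by simp
qed

lemma Lpi_norm_diff:
  assumes p: "0 < p" and F: "F \<in> Lpi p" and G: "G \<in> Lpi p"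
  shows "Lpi_norm p (\<lambda>x. G x - F x) = epowr (real_mean p (\<lambda>x. real_fun G x - real_fun F x) strip_measure) (1 / p)"
  unfolding Lpi_norm_def real_mean_def
proof (rule arg_cong2[where f = epowr, OF nn_integral_cong_AE refl])
  show "AE x in strip_measure. epowr (e2ennreal \<bar>G x - F x\<bar>) p = ennreal (\<bar>real_fun G x - real_fun F x\<bar> powr p)"
    using Lpi_AE_finite[OF p F] Lpi_AE_finite[OF p G]
  proof eventually_elim
    case (elim x)
    then obtain y z where "F x = ereal y" "G x = ereal z" by (cases "F x"; cases "G x") auto
    then show ?case by (simp add: epowr_ennreal)
  qed
qed

lemma real_mean_uminus: "real_mean p (\<lambda>x. f x - g x) M = real_mean p (\<lambda>x. g x - f x) M"
  by (simp add: real_mean_def abs_minus_commute)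

text \<open>
  Elements of the target space are finite almost everywhere, so distances can be computed with their real parts
  as functions, where completeness and the quasi-triangle inequality are available.
\<close>

theorem Lpi_compactin_closure:
  assumes p: "0 < p" and S: "S \<subseteq> Lpi p"
    and pre: "\<And>F :: nat \<Rightarrow> _. (\<And>n. F n \<in> S) \<Longrightarrow>
        \<exists>r::nat \<Rightarrow> nat. strict_mono r \<and> (\<forall>e>0. \<exists>N. \<forall>i\<ge>N. \<forall>j\<ge>N. real_mean p (\<lambda>x. real_fun (F (r i)) x - real_fun (F (r j)) x) strip_measure < ennreal e)"
  shows "compactin (Lpi_topology p) (Lpi_topology p closure_of S)"
proof -
  let ?R = "\<lambda>F G. real_mean p (\<lambda>x. real_fun F x - real_fun G x) strip_measure"
  define d where "d F G = enn2real (?R F G)" for F G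
  have fin: "?R F G < \<infinity>" if "F \<in> Lpi p" "G \<in> Lpi p" for F G
  proof -
    have "?R F G = real_mean p (\<lambda>x. real_fun F x + - real_fun G x) strip_measure" by simp
    also have "\<dots> \<le> ennreal (2 powr p) * (real_mean p (real_fun F) strip_measure + real_mean p (\<lambda>x. - real_fun G x) strip_measure)"
      by (rule real_mean_add[OF p]) (use Lpi_measurable[OF p that(1)] Lpi_measurable[OF p that(2)] in measurable)
    also have "real_mean p (\<lambda>x. - real_fun G x) strip_measure = real_mean p (real_fun G) strip_measure" by (simp add: real_mean_def)
    also have "ennreal (2 powr p) * (real_mean p (real_fun F) strip_measure + real_mean p (real_fun G) strip_measure) < \<infinity>"
      using Lpi_real_mean[OF p that(1)] Lpi_real_mean[OF p that(2)] by (simp add: ennreal_mult_less_top)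
    finally show ?thesis .
  qed
  have less: "?R F G < ennreal e \<longleftrightarrow> d F G < e" if "F \<in> Lpi p" "G \<in> Lpi p" "0 < e" for F G e
    using fin[OF that(1,2)] that(3) unfolding d_def by (cases "?R F G") (auto simp: ennreal_less_iff)
  have norm_less: "Lpi_norm p (\<lambda>x. G x - F x) < ennreal e \<longleftrightarrow> d F G < e powr p"
    if FG: "F \<in> Lpi p" "G \<in> Lpi p" "0 < e" for F G e
  proof -
    obtain y where y: "?R G F = ennreal y" "0 \<le> y" using fin[OF FG(2,1)] by (cases "?R G F") auto
    have "y powr (1 / p) < e \<longleftrightarrow> y < e powr p"
    proof
      assume "y powr (1 / p) < e"
      then have "(y powr (1 / p)) powr p < e powr p" using p by (intro powr_less_mono2) auto
      then show "y < e powr p" using p y by (simp add: powr_powr)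
    next
      assume "y < e powr p"
      then have "y powr (1 / p) < (e powr p) powr (1 / p)" using p y by (intro powr_less_mono2) auto
      then show "y powr (1 / p) < e" using p FG(3) by (simp add: powr_powr)
    qed
    then show ?thesis
      unfolding Lpi_norm_diff[OF p FG(1,2)] d_def real_mean_uminus[of p "real_fun F"] y(1)
      using y(2) FG(3) by (simp add: epowr_ennreal ennreal_less_iff)
  qed
  show ?thesis
  proof (rule compactin_closure_of_quasi_metric[where d = d and X = "Lpi p" and K = "2 powr p"])
    show "topspace (Lpi_topology p) = Lpi p" by (rule topspace_Lpi_topology)
    fix U
    show "openin (Lpi_topology p) U \<longleftrightarrow> U \<subseteq> Lpi p \<and> (\<forall>x\<in>U. \<exists>e>0. \<forall>y\<in>Lpi p. d x y < e \<longrightarrow> y \<in> U)"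
      unfolding openin_Lpi_topology Lpi_open_def
    proof (intro conj_cong refl ball_cong)
      fix F assume U: "U \<subseteq> Lpi p" and "F \<in> U"
      then have F: "F \<in> Lpi p" by blast
      show "(\<exists>\<epsilon>>0. \<forall>G\<in>Lpi p. Lpi_norm p (\<lambda>x. G x - F x) < \<epsilon> \<longrightarrow> G \<in> U) \<longleftrightarrow> (\<exists>e>0. \<forall>G\<in>Lpi p. d F G < e \<longrightarrow> G \<in> U)"
      proof
        assume "\<exists>\<epsilon>>0. \<forall>G\<in>Lpi p. Lpi_norm p (\<lambda>x. G x - F x) < \<epsilon> \<longrightarrow> G \<in> U"
        then obtain \<epsilon> where \<epsilon>: "0 < \<epsilon>" "\<And>G. G \<in> Lpi p \<Longrightarrow> Lpi_norm p (\<lambda>x. G x - F x) < \<epsilon> \<Longrightarrow> G \<in> U" by blast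
        obtain e where e: "0 < e" "ennreal e \<le> \<epsilon>"
        proof (cases \<epsilon>)
          case (real r)
          then show ?thesis using \<epsilon>(1) by (intro that[of r]) auto
        next
          case top
          then show ?thesis by (intro that[of 1]) auto
        qed
        have "G \<in> U" if G: "G \<in> Lpi p" "d F G < e powr p" for G
          using \<epsilon>(2)[OF G(1)] norm_less[OF F G(1) e(1)] G(2) e(2) by (auto intro: less_le_trans)
        then show "\<exists>e>0. \<forall>G\<in>Lpi p. d F G < e \<longrightarrow> G \<in> U" using e(1) by (intro exI[of _ "e powr p"]) auto
      next
        assume "\<exists>e>0. \<forall>G\<in>Lpi p. d F G < e \<longrightarrow> G \<in> U"
        then obtain e where e: "0 < e" "\<And>G. G \<in> Lpi p \<Longrightarrow> d F G < e \<Longrightarrow> G \<in> U" by blast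
        have "G \<in> U" if "G \<in> Lpi p" "Lpi_norm p (\<lambda>x. G x - F x) < ennreal (e powr (1 / p))" for G
          using norm_less[OF F that(1), of "e powr (1 / p)"] that e p by (simp add: powr_powr)
        then show "\<exists>\<epsilon>>0. \<forall>G\<in>Lpi p. Lpi_norm p (\<lambda>x. G x - F x) < \<epsilon> \<longrightarrow> G \<in> U"
          using e(1) by (intro exI[of _ "ennreal (e powr (1 / p))"]) auto
      qed
    qed
  next
    show "0 \<le> d F G" for F G by (simp add: d_def)
    show "d F G = d G F" for F G by (simp add: d_def real_mean_uminus[of p "real_fun F"])
    show "d F H \<le> 2 powr p * (d F G + d G H)" if "F \<in> Lpi p" "G \<in> Lpi p" "H \<in> Lpi p" for F G H
    proof -
      have "?R F H = real_mean p (\<lambda>x. (real_fun F x - real_fun G x) + (real_fun G x - real_fun H x)) strip_measure" by simp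
      also have "\<dots> \<le> ennreal (2 powr p) * (?R F G + ?R G H)"
        by (rule real_mean_add[OF p]) (use Lpi_measurable[OF p that(1)] Lpi_measurable[OF p that(2)] Lpi_measurable[OF p that(3)] in measurable)
      finally have "?R F H \<le> ennreal (2 powr p) * (?R F G + ?R G H)" .
      then show ?thesis
        unfolding d_def using fin[OF that(1,3)] fin[OF that(1,2)] fin[OF that(2,3)]
        by (cases "?R F H"; cases "?R F G"; cases "?R G H")
           (auto simp: ennreal_mult'[symmetric] ennreal_plus[symmetric] simp del: ennreal_plus)
    qed
    show "\<exists>r::nat \<Rightarrow> nat. strict_mono r \<and> (\<forall>e>0. \<exists>N. \<forall>i\<ge>N. \<forall>j\<ge>N. d (F (r i)) (F (r j)) < e)"
      if FS: "\<And>n. F n \<in> S" for F :: "nat \<Rightarrow> _"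
    proof -
      have FL: "F n \<in> Lpi p" for n using FS[of n] S by blast
      obtain r :: "nat \<Rightarrow> nat" where r: "strict_mono r" "\<forall>e>0. \<exists>N. \<forall>i\<ge>N. \<forall>j\<ge>N. ?R (F (r i)) (F (r j)) < ennreal e"
        using pre[of F, OF FS] by blast
      have "\<exists>N. \<forall>i\<ge>N. \<forall>j\<ge>N. d (F (r i)) (F (r j)) < e" if e: "0 < e" for e
        using r(2)[THEN spec, THEN mp, OF e] unfolding less[OF FL FL e] .
      with r(1) show ?thesis by (intro exI[of _ r]) simp
    qed
    fix F :: "nat \<Rightarrow> _"
    assume F: "\<And>n. F n \<in> Lpi p" and cauchy: "\<And>e. 0 < e \<Longrightarrow> \<exists>N. \<forall>i\<ge>N. \<forall>j\<ge>N. d (F i) (F j) < e"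
    have "\<exists>K. \<forall>i\<ge>K. \<forall>j\<ge>K. (\<integral>\<^sup>+x. ennreal (\<bar>real_fun (F i) x - real_fun (F j) x\<bar> powr p) \<partial>strip_measure) < ennreal e" if "0 < e" for e
      using cauchy[OF that] unfolding real_mean_def[symmetric] less[OF F F that] .
    then obtain l where l: "l \<in> borel_measurable strip_measure"
       "\<forall>e>0. \<exists>K. \<forall>k\<ge>K. (\<integral>\<^sup>+x. ennreal (\<bar>l x - real_fun (F k) x\<bar> powr p) \<partial>strip_measure) \<le> ennreal e"
      by (rule powr_mean_complete[OF p, of "\<lambda>k. real_fun (F k)" strip_measure, OF Lpi_measurable[OF p F]])
    let ?L = "\<lambda>x. ereal (l x)"
    have "?L \<in> Lpi p"
    proof -
      obtain k where k: "real_mean p (\<lambda>x. l x - real_fun (F k) x) strip_measure \<le> ennreal 1"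
        using l(2)[THEN spec, of 1] by (auto simp: real_mean_def)
      have "real_mean p l strip_measure = real_mean p (\<lambda>x. (l x - real_fun (F k) x) + real_fun (F k) x) strip_measure" by simp
      also have "\<dots> \<le> ennreal (2 powr p) * (real_mean p (\<lambda>x. l x - real_fun (F k) x) strip_measure + real_mean p (real_fun (F k)) strip_measure)"
        by (rule real_mean_add[OF p]) (use l(1) Lpi_measurable[OF p F] in measurable)
      also have "\<dots> < \<infinity>"
        using k Lpi_real_mean[OF p F, of k] by (auto simp: ennreal_mult_less_top intro: le_less_trans)
      finally have "real_mean p l strip_measure < \<infinity>" .
      moreover have "Lpi_norm p ?L = epowr (real_mean p l strip_measure) (1 / p)"
        by (simp add: Lpi_norm_def real_mean_def epowr_ennreal)
      ultimately show ?thesis using l(1) by (simp add: Lpi_def)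
    qed
    moreover have "(\<lambda>n. d ?L (F n)) \<longlonglongrightarrow> 0"
    proof (rule LIMSEQ_I)
      fix e :: real assume e: "0 < e"
      then obtain K where K: "\<And>k. K \<le> k \<Longrightarrow> ?R ?L (F k) \<le> ennreal (e / 2)"
        using l(2)[THEN spec, of "e / 2"] by (auto simp: real_mean_def)
      have "d ?L (F k) < e" if "K \<le> k" for k
      proof -
        have "ennreal (e / 2) < ennreal e" using e by (simp add: ennreal_less_iff)
        then show ?thesis using K[OF that] less[OF \<open>?L \<in> Lpi p\<close> F e, of k] by (meson le_less_trans)
      qed
      then show "\<exists>K. \<forall>k\<ge>K. norm (d ?L (F k) - 0) < e" by (intro exI[of _ K]) (auto simp: d_def)
    qed
    ultimately show "\<exists>l\<in>Lpi p. (\<lambda>n. d l (F n)) \<longlonglongrightarrow> 0" by blast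
  qed (use S in auto)
qed

section \<open>Compactness of the area operator\<close>

text \<open>
  The area operator is a family of \<open>L\<^sup>p\<close> norms on cones, hence not linear. If \<open>X\<close>, \<open>Y\<close>, \<open>Z\<close> are the \<open>p\<close>-th
  powers of such norms of two functions and of their difference, then the difference of the two norms is
  controlled by \<open>Z\<close> up to a small multiple of \<open>X + Y\<close>. The quasi-triangle inequality is used once with the exponent \<open>p\<close>
  in the hypotheses and once with the exponent \<open>1 / p\<close>.
\<close>

lemma root_difference:
  fixes p \<eta> :: real
  assumes p: "0 < p" and \<eta>: "0 < \<eta>"
  obtains C where "0 \<le> C"
    "\<forall>X\<ge>0. \<forall>Y\<ge>0. \<forall>Z\<ge>0. (\<forall>d>0. X \<le> (1 + d) powr p * Y + (1 + 1/d) powr p * Z) \<longrightarrow>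
        (\<forall>d>0. Y \<le> (1 + d) powr p * X + (1 + 1/d) powr p * Z) \<longrightarrow>
        \<bar>X powr (1/p) - Y powr (1/p)\<bar> powr p \<le> \<eta> * (X + Y) + C * Z"
proof -
  define q where "q = 1 / p"
  have q: "0 < q" and pq: "p * q = 1" "q * p = 1" using p by (auto simp: q_def)
  have "((\<lambda>d. (2 * ((1 + d) powr q * (1 + d) - 1)) powr p) \<longlongrightarrow> (2 * ((1 + 0) powr q * (1 + 0) - 1)) powr p) (at_right (0::real))"
  proof (intro tendsto_powr' tendsto_intros)
    have "\<forall>\<^sub>F d in at_right (0::real). 0 < d" by (simp add: eventually_at_right_less)
    then have "\<forall>\<^sub>F d in at_right (0::real). 0 \<le> 2 * ((1 + d) powr q * (1 + d) - 1)"
    proof eventually_elim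
      case (elim d)
      have "1 * 1 \<le> (1 + d) powr q * (1 + d)" using elim q by (intro mult_mono ge_one_powr_ge_zero) auto
      then show ?case by simp
    qed
    then show "2 * ((1 + 0) powr q * (1 + 0) - 1) \<noteq> (0::real) \<or> 0 < p \<and> (\<forall>\<^sub>F d in at_right 0. 0 \<le> 2 * ((1 + d) powr q * (1 + d) - 1))"
      using p by simp
  qed auto
  then have "((\<lambda>d. (2 * ((1 + d) powr q * (1 + d) - 1)) powr p) \<longlongrightarrow> 0) (at_right (0::real))" by simp
  from order_tendstoD(2)[OF this \<eta>]
  have "\<forall>\<^sub>F d in at_right (0::real). 0 < d \<and> (2 * ((1 + d) powr q * (1 + d) - 1)) powr p < \<eta>"
    using eventually_at_right_less by (rule eventually_elim2) auto
  then obtain d :: real where d: "0 < d" "(2 * ((1 + d) powr q * (1 + d) - 1)) powr p < \<eta>"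
    using eventually_happens'[OF trivial_limit_at_right_real] by blast
  define \<theta> where "\<theta> = (1 + d) powr q * (1 + d) - 1"
  define L where "L = (1 + 1/d) powr q * (1 + 1/d)"
  have "1 * 1 \<le> (1 + d) powr q * (1 + d)" using d q by (intro mult_mono ge_one_powr_ge_zero) auto
  then have \<theta>: "0 \<le> \<theta>" by (simp add: \<theta>_def)
  have L: "0 \<le> L" using d by (simp add: L_def)
  have half: "X powr q - Y powr q \<le> \<theta> * Y powr q + L * Z powr q"
    if "0 \<le> X" "0 \<le> Y" "0 \<le> Z" "\<forall>d>0. X \<le> (1 + d) powr p * Y + (1 + 1/d) powr p * Z" for X Y Z
  proof -
    have "X powr q \<le> ((1 + d) powr p * Y + (1 + 1/d) powr p * Z) powr q"
      using that d q by (intro powr_mono2) auto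
    also have "\<dots> \<le> (1 + d) powr q * ((1 + d) powr p * Y) powr q + (1 + 1/d) powr q * ((1 + 1/d) powr p * Z) powr q"
      using that d q by (intro powr_add_le) auto
    also have "\<dots> = (1 + d) powr q * (1 + d) * Y powr q + L * Z powr q"
      using that d by (simp add: powr_mult powr_powr pq L_def)
    finally show ?thesis by (simp add: \<theta>_def algebra_simps)
  qed
  define C where "C = (2 * L) powr p"
  show ?thesis
  proof (rule that[of C])
    show "0 \<le> C" by (simp add: C_def)
    show "\<forall>X\<ge>0. \<forall>Y\<ge>0. \<forall>Z\<ge>0. (\<forall>d>0. X \<le> (1 + d) powr p * Y + (1 + 1/d) powr p * Z) \<longrightarrow>
        (\<forall>d>0. Y \<le> (1 + d) powr p * X + (1 + 1/d) powr p * Z) \<longrightarrow>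
        \<bar>X powr (1/p) - Y powr (1/p)\<bar> powr p \<le> \<eta> * (X + Y) + C * Z"
    proof (intro allI impI)
      fix X Y Z :: real
      assume X: "0 \<le> X" and Y: "0 \<le> Y" and Z: "0 \<le> Z"
        and XY: "\<forall>d>0. X \<le> (1 + d) powr p * Y + (1 + 1/d) powr p * Z"
        and YX: "\<forall>d>0. Y \<le> (1 + d) powr p * X + (1 + 1/d) powr p * Z"
      define W where "W = X + Y"
      have W: "0 \<le> W" "X powr q \<le> W powr q" "Y powr q \<le> W powr q"
        using X Y q by (auto simp: W_def intro!: powr_mono2)
      have "\<theta> * X powr q \<le> \<theta> * W powr q" "\<theta> * Y powr q \<le> \<theta> * W powr q"
        using W \<theta> by (auto intro: mult_left_mono)
      then have "\<bar>X powr q - Y powr q\<bar> \<le> \<theta> * W powr q + L * Z powr q"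
        using half[OF X Y Z XY] half[OF Y X Z YX] by linarith
      then have "\<bar>X powr q - Y powr q\<bar> powr p \<le> (\<theta> * W powr q + L * Z powr q) powr p"
        using p by (intro powr_mono2) auto
      also have "\<dots> \<le> 2 powr p * (\<theta> * W powr q) powr p + 2 powr p * (L * Z powr q) powr p"
        using powr_add_le[of "\<theta> * W powr q" "L * Z powr q" 1 p] \<theta> L p by simp
      also have "\<dots> = (2 * \<theta>) powr p * W + C * Z"
        using \<theta> L W Z by (simp add: powr_mult powr_powr pq C_def mult.assoc)
      also have "\<dots> \<le> \<eta> * W + C * Z"
        using d(2) W by (intro add_right_mono mult_right_mono) (auto simp: \<theta>_def)
      finally show "\<bar>X powr (1/p) - Y powr (1/p)\<bar> powr p \<le> \<eta> * (X + Y) + C * Z"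
        by (simp add: q_def W_def)
    qed
  qed
qed

lemma nn_integral_affine:
  assumes [measurable]: "f \<in> borel_measurable M" "g \<in> borel_measurable M"
  shows "(\<integral>\<^sup>+x. K * (f x * d + g x) \<partial>M) = K * ((\<integral>\<^sup>+x. f x \<partial>M) * d + (\<integral>\<^sup>+x. g x \<partial>M))"
  by (simp add: nn_integral_cmult nn_integral_add nn_integral_multc)

lemma nn_integral_combination:
  assumes [measurable]: "f \<in> borel_measurable M" "g \<in> borel_measurable M" "h \<in> borel_measurable M"
  shows "(\<integral>\<^sup>+x. K * (f x + g x) + L * h x \<partial>M) = K * ((\<integral>\<^sup>+x. f x \<partial>M) + (\<integral>\<^sup>+x. g x \<partial>M)) + L * (\<integral>\<^sup>+x. h x \<partial>M)"
  by (simp add: nn_integral_cmult nn_integral_add)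

context half_plane_measure
begin

lemma cone_integral_triangle:
  assumes p: "0 < p" and d: "0 < d" and [measurable]: "f \<in> borel_measurable \<mu>" "g \<in> borel_measurable \<mu>"
  shows "cone_integral p \<mu> f \<tau> \<le> ennreal ((1 + d) powr p) * cone_integral p \<mu> g \<tau>
      + ennreal ((1 + 1/d) powr p) * cone_integral p \<mu> (\<lambda>s. f s - g s) \<tau>"
proof -
  have [measurable]: "(\<lambda>s. indicator (stolz_cone \<tau>) s :: ennreal) \<in> borel_measurable \<mu>"
    using measurable_compose[OF measurable_Pair1'[of \<tau> line_measure \<mu>] stolz_cone_measurable] by simp
  let ?w = "\<lambda>s. indicator (stolz_cone \<tau>) s :: ennreal"
  have "cone_integral p \<mu> f \<tau> \<le> (\<integral>\<^sup>+s. ennreal ((1 + d) powr p) * (ennreal (norm (g s) powr p / Re s) * ?w s)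
      + ennreal ((1 + 1/d) powr p) * (ennreal (norm (f s - g s) powr p / Re s) * ?w s) \<partial>\<mu>)"
    unfolding cone_integral_def
  proof (rule nn_integral_mono)
    fix s assume "s \<in> space \<mu>"
    then have s: "0 < Re s" by (simp add: space_mu half_plane_def)
    have "norm (f s) powr p \<le> (norm (g s) + norm (f s - g s)) powr p"
      using p norm_triangle_sub[of "f s" "g s"] by (intro powr_mono2) auto
    also have "\<dots> \<le> (1 + d) powr p * norm (g s) powr p + (1 + 1/d) powr p * norm (f s - g s) powr p"
      using p d by (intro powr_add_le) auto
    finally have "norm (f s) powr p / Re s \<le> (1 + d) powr p * (norm (g s) powr p / Re s) + (1 + 1/d) powr p * (norm (f s - g s) powr p / Re s)"
      using s by (simp add: field_simps)
    then have "ennreal (norm (f s) powr p / Re s) \<le> ennreal ((1 + d) powr p) * ennreal (norm (g s) powr p / Re s)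
       + ennreal ((1 + 1/d) powr p) * ennreal (norm (f s - g s) powr p / Re s)"
      using s by (simp add: ennreal_mult'[symmetric] ennreal_plus[symmetric] ennreal_leI del: ennreal_plus)
    from mult_right_mono[OF this, of "?w s"]
    show "ennreal (norm (f s) powr p / Re s) * ?w s \<le> ennreal ((1 + d) powr p) * (ennreal (norm (g s) powr p / Re s) * ?w s)
      + ennreal ((1 + 1/d) powr p) * (ennreal (norm (f s - g s) powr p / Re s) * ?w s)"
      by (simp add: ring_distribs mult.assoc)
  qed
  also have "\<dots> = ennreal ((1 + d) powr p) * cone_integral p \<mu> g \<tau>
      + ennreal ((1 + 1/d) powr p) * cone_integral p \<mu> (\<lambda>s. f s - g s) \<tau>"
    unfolding cone_integral_def by (subst nn_integral_add) (auto simp: nn_integral_cmult)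
  finally show ?thesis .
qed

definition weighted_mean :: "real \<Rightarrow> ((nat \<Rightarrow> complex) \<Rightarrow> complex \<Rightarrow> complex) \<Rightarrow> ennreal" where
  "weighted_mean p h = (\<integral>\<^sup>+s. ennreal (weight s) * torus_mean p (\<lambda>\<omega>. h \<omega> s) \<partial>\<mu>)"

lemma cone_integral_AE_finite:
  assumes h: "jointly_measurable h" and fin: "weighted_mean p h < \<infinity>"
  shows "AE x in torus \<Otimes>\<^sub>M line_measure. cone_integral p \<mu> (h (fst x)) (snd x) \<noteq> \<infinity>"
proof (rule nn_integral_PInf_AE)
  show "(\<lambda>x. cone_integral p \<mu> (h (fst x)) (snd x)) \<in> borel_measurable (torus \<Otimes>\<^sub>M line_measure)"
    using cone_integral_measurable[OF h] by (simp add: case_prod_beta')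
  show "(\<integral>\<^sup>+x. cone_integral p \<mu> (h (fst x)) (snd x) \<partial>(torus \<Otimes>\<^sub>M line_measure)) \<noteq> \<infinity>"
    using fin unfolding nn_integral_cone_integral[OF h] weighted_mean_def by simp
qed

text \<open>
  Lifts \<open>root_difference\<close> from single cones to the target space.
\<close>

lemma area_difference:
  assumes p: "0 < p" and \<eta>: "0 < \<eta>" and C: "0 \<le> C"
    and root: "\<forall>X\<ge>0. \<forall>Y\<ge>0. \<forall>Z\<ge>0. (\<forall>d>0. X \<le> (1 + d) powr p * Y + (1 + 1/d) powr p * Z) \<longrightarrow>
        (\<forall>d>0. Y \<le> (1 + d) powr p * X + (1 + 1/d) powr p * Z) \<longrightarrow>
        \<bar>X powr (1/p) - Y powr (1/p)\<bar> powr p \<le> \<eta> * (X + Y) + C * Z"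
    and h: "jointly_measurable h" and k: "jointly_measurable k"
    and F: "area_version p F h"
    and G: "area_version p G k"
    and fin: "weighted_mean p h < \<infinity>" "weighted_mean p k < \<infinity>" "weighted_mean p (\<lambda>\<omega> s. h \<omega> s - k \<omega> s) < \<infinity>"
  shows "real_mean p (\<lambda>x. real_fun F x - real_fun G x) strip_measure
    \<le> ennreal \<eta> * (weighted_mean p h + weighted_mean p k) + ennreal C * weighted_mean p (\<lambda>\<omega> s. h \<omega> s - k \<omega> s)"
proof -
  let ?N = "torus \<Otimes>\<^sub>M line_measure"
  let ?c = "\<lambda>h x. cone_integral p \<mu> (h (fst x)) (snd x)"
  let ?hk = "\<lambda>\<omega> s. h \<omega> s - k \<omega> s"
  have hk: "jointly_measurable ?hk"
    using borel_measurable_diff[OF h k] by (simp add: case_prod_beta')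
  have meas: "(\<lambda>x. ?c f x) \<in> borel_measurable ?N" if "jointly_measurable f" for f
    using cone_integral_measurable[OF that] by (simp add: case_prod_beta')
  note [measurable] = meas[OF h] meas[OF k] meas[OF hk]
  have wm: "(\<integral>\<^sup>+x. ?c f x \<partial>?N) = weighted_mean p f" if "jointly_measurable f" for f
    unfolding weighted_mean_def by (rule nn_integral_cone_integral[OF that])
  have "real_mean p (\<lambda>x. real_fun F x - real_fun G x) strip_measure = (\<integral>\<^sup>+x. ennreal (\<bar>real_fun F x - real_fun G x\<bar> powr p) \<partial>?N)"
    by (simp add: real_mean_def strip_measure_eq nn_integral_completion)
  also have "\<dots> \<le> (\<integral>\<^sup>+x. ennreal \<eta> * (?c h x + ?c k x) + ennreal C * ?c ?hk x \<partial>?N)"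
  proof (rule nn_integral_mono_AE)
    show "AE x in ?N. ennreal (\<bar>real_fun F x - real_fun G x\<bar> powr p) \<le> ennreal \<eta> * (?c h x + ?c k x) + ennreal C * ?c ?hk x"
      using AE_pair_fst[OF F sigma_finite_line_measure] AE_pair_fst[OF G sigma_finite_line_measure]
        cone_integral_AE_finite[OF h fin(1)] cone_integral_AE_finite[OF k fin(2)] cone_integral_AE_finite[OF hk fin(3)] AE_space
    proof eventually_elim
      case (elim x)
      have \<omega>: "fst x \<in> space torus" using elim(6) by (auto simp: space_pair_measure)
      have hx: "h (fst x) \<in> borel_measurable \<mu>" and kx: "k (fst x) \<in> borel_measurable \<mu>"
        using measurable_compose[OF measurable_Pair1'[OF \<omega>] h] measurable_compose[OF measurable_Pair1'[OF \<omega>] k] by simp_all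
      obtain X where X: "?c h x = ennreal X" "0 \<le> X" using elim(3) by (cases "?c h x") auto
      obtain Y where Y: "?c k x = ennreal Y" "0 \<le> Y" using elim(4) by (cases "?c k x") auto
      obtain Z where Z: "?c ?hk x = ennreal Z" "0 \<le> Z" using elim(5) by (cases "?c ?hk x") auto
      have Z': "cone_integral p \<mu> (\<lambda>s. k (fst x) s - h (fst x) s) (snd x) = ennreal Z"
        using Z(1) by (simp add: cone_integral_def norm_minus_commute)
      have XY: "X \<le> (1 + d) powr p * Y + (1 + 1/d) powr p * Z" if d: "0 < d" for d
        using cone_integral_triangle[OF p d hx kx, of "snd x"] X Y Z
        by (simp add: ennreal_mult'[symmetric] ennreal_plus[symmetric] ennreal_le_iff del: ennreal_plus)
      have YX: "Y \<le> (1 + d) powr p * X + (1 + 1/d) powr p * Z" if d: "0 < d" for d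
        using cone_integral_triangle[OF p d kx hx, of "snd x"] X Y Z Z'
        by (simp add: ennreal_mult'[symmetric] ennreal_plus[symmetric] ennreal_le_iff del: ennreal_plus)
      have "\<bar>X powr (1/p) - Y powr (1/p)\<bar> powr p \<le> \<eta> * (X + Y) + C * Z"
        using root X(2) Y(2) Z(2) XY YX by blast
      moreover have "real_fun F x = X powr (1/p)" "real_fun G x = Y powr (1/p)"
      proof -
        have "F (fst x, snd x) = enn2ereal (epowr (?c h x) (1 / p))" "G (fst x, snd x) = enn2ereal (epowr (?c k x) (1 / p))"
          using elim(1,2) by blast+
        then show "real_fun F x = X powr (1/p)" "real_fun G x = Y powr (1/p)" using X Y by (simp_all add: epowr_ennreal)
      qed
      ultimately have "ennreal (\<bar>real_fun F x - real_fun G x\<bar> powr p) \<le> ennreal (\<eta> * (X + Y) + C * Z)"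
        by (simp add: ennreal_leI)
      also have "\<dots> = ennreal \<eta> * (?c h x + ?c k x) + ennreal C * ?c ?hk x"
        unfolding X(1) Y(1) Z(1) using X Y Z \<eta> C
        by (simp add: ennreal_mult'[symmetric] ennreal_plus[symmetric] del: ennreal_plus)
      finally show ?case .
    qed
  qed
  also have "\<dots> = ennreal \<eta> * ((\<integral>\<^sup>+x. ?c h x \<partial>?N) + (\<integral>\<^sup>+x. ?c k x \<partial>?N)) + ennreal C * (\<integral>\<^sup>+x. ?c ?hk x \<partial>?N)"
    by (rule nn_integral_combination) measurable
  also have "\<dots> = ennreal \<eta> * (weighted_mean p h + weighted_mean p k) + ennreal C * weighted_mean p ?hk"
    by (simp only: wm[OF h] wm[OF k] wm[OF hk])
  finally show ?thesis .
qed

text \<open>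
  \<open>H\<close> is a jointly measurable version of the vertical limits of \<open>a\<close>, and \<open>Q\<close> is a polynomial near \<open>a\<close>.
\<close>

definition approximant ::
  "real \<Rightarrow> nat \<Rightarrow> (nat \<Rightarrow> complex) \<Rightarrow> real \<Rightarrow> ((nat \<Rightarrow> complex) \<Rightarrow> complex \<Rightarrow> complex) \<Rightarrow> (nat \<Rightarrow> complex) \<Rightarrow> bool" where
  "approximant p m a e H Q \<longleftrightarrow>
    jointly_measurable H \<and>
    (area_version p (area_op \<mu> p a) H) \<and>
    Q \<in> dirichlet_polys \<and> (\<forall>n<m. Q n = 0) \<and> hmean p Q \<le> hardy_norm p a powr p + 1 \<and>
    (\<forall>s\<in>half_plane. torus_mean p (\<lambda>\<omega>. H \<omega> s)
       \<le> ennreal (real m powr (- p * Re s)) * ennreal (hardy_norm p a powr p)) \<and>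
    (\<forall>s\<in>half_plane. torus_mean p (\<lambda>\<omega>. H \<omega> s - bohr_lift (shift s Q) \<omega>)
       \<le> ennreal (real m powr (- p * Re s)) * ennreal e)"

lemma approximantD:
  assumes "approximant p m a e H Q"
  shows "jointly_measurable H"
    "area_version p (area_op \<mu> p a) H"
    "Q \<in> dirichlet_polys" "n < m \<Longrightarrow> Q n = 0" "hmean p Q \<le> hardy_norm p a powr p + 1"
    "s \<in> half_plane \<Longrightarrow> torus_mean p (\<lambda>\<omega>. H \<omega> s)
       \<le> ennreal (real m powr (- p * Re s)) * ennreal (hardy_norm p a powr p)"
    "s \<in> half_plane \<Longrightarrow> torus_mean p (\<lambda>\<omega>. H \<omega> s - bohr_lift (shift s Q) \<omega>)
       \<le> ennreal (real m powr (- p * Re s)) * ennreal e"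
  using assms unfolding approximant_def by simp_all

lemma hardy_polynomial_approximation:
  assumes p: "0 < p" and m: "0 < m" and a: "a \<in> hardy_from p m" and e: "0 < e"
  shows "\<exists>H Q. approximant p m a e H Q"
proof -
  have a': "a \<in> hardy p" "\<And>n. n < m \<Longrightarrow> a n = 0" using a by (auto simp: hardy_from_def)
  obtain P H where P: "approximates p P a" "\<forall>k. \<forall>n<m. P k n = 0"
    and H: "jointly_measurable H"
    and ae: "area_version p (area_op \<mu> p a) H"
    and est: "\<forall>Q e s. Q \<in> dirichlet_polys \<longrightarrow> (\<forall>n<m. Q n = 0) \<longrightarrow> (\<lambda>k. hmean p (\<lambda>n. P k n - Q n)) \<longlonglongrightarrow> e \<longrightarrow>
        s \<in> half_plane \<longrightarrow> torus_mean p (\<lambda>\<omega>. H \<omega> s - bohr_lift (shift s Q) \<omega>)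
           \<le> ennreal (real m powr (- p * Re s) * e)"
    by (rule hardy_representation[OF p m a'])
  have P': "hcauchy p P" using P(1) by (simp add: approximates_iff[OF p])
  note poly = hcauchyD(1)[OF P']
  have z: "(\<lambda>n::nat. 0::complex) \<in> dirichlet_polys" by (simp add: dirichlet_polys_def)
  have lim: "(\<lambda>k. hmean p (P k)) \<longlonglongrightarrow> hardy_norm p a powr p" by (rule hardy_norm_limit(1)[OF p P(1)])
  have H_le: "torus_mean p (\<lambda>\<omega>. H \<omega> s) \<le> ennreal (real m powr (- p * Re s)) * ennreal (hardy_norm p a powr p)"
    if s: "s \<in> half_plane" for s
  proof -
    have "(\<lambda>k. hmean p (\<lambda>n. P k n - 0)) \<longlonglongrightarrow> hardy_norm p a powr p" using lim by simp
    with est z s have "torus_mean p (\<lambda>\<omega>. H \<omega> s - bohr_lift (shift s (\<lambda>n. 0)) \<omega>)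
           \<le> ennreal (real m powr (- p * Re s) * hardy_norm p a powr p)" by blast
    then show ?thesis by (simp add: bohr_lift_shift[OF z] ennreal_mult'')
  qed
  obtain K where K: "\<And>j k. K \<le> j \<Longrightarrow> K \<le> k \<Longrightarrow> hmean p (\<lambda>n. P j n - P k n) < e"
    using hcauchyD(2)[OF P' e] by blast
  have "\<forall>\<^sub>F k in sequentially. K \<le> k \<and> hmean p (P k) < hardy_norm p a powr p + 1"
    using order_tendstoD(2)[OF lim, of "hardy_norm p a powr p + 1"] eventually_ge_at_top[of K] by (simp add: eventually_conj)
  then obtain j where j: "K \<le> j" "hmean p (P j) < hardy_norm p a powr p + 1" by (auto simp: eventually_sequentially)
  have cz: "hcauchy p (\<lambda>k. P j)" unfolding hcauchy_def using poly hmean_le[OF p, of "\<lambda>n. 0"] p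
    by (auto intro: le_less_trans)
  obtain l where l: "(\<lambda>k. hmean p (\<lambda>n. P k n - P j n)) \<longlonglongrightarrow> l"
    using hcauchy_hmean_convergent[OF hcauchy_diff[OF p P' cz] p] by (auto simp: convergent_def)
  have "l \<le> e" by (rule LIMSEQ_le_const2[OF l]) (use K j in \<open>auto intro!: exI[of _ K] less_imp_le\<close>)
  have Q_le: "torus_mean p (\<lambda>\<omega>. H \<omega> s - bohr_lift (shift s (P j)) \<omega>) \<le> ennreal (real m powr (- p * Re s)) * ennreal e"
    if s: "s \<in> half_plane" for s
  proof -
    have "torus_mean p (\<lambda>\<omega>. H \<omega> s - bohr_lift (shift s (P j)) \<omega>)
           \<le> ennreal (real m powr (- p * Re s) * l)" using est poly P(2) l s by blast
    also have "\<dots> \<le> ennreal (real m powr (- p * Re s) * e)"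
      using \<open>l \<le> e\<close> by (intro ennreal_leI mult_left_mono) auto
    also have "\<dots> = ennreal (real m powr (- p * Re s)) * ennreal e" by (simp add: ennreal_mult')
    finally show ?thesis .
  qed
  have "approximant p m a e H (P j)"
    unfolding approximant_def using H ae poly[of j] P(2) j(2) H_le Q_le by (simp add: less_imp_le)
  then show ?thesis by blast
qed

lemma nn_integral_powr_add3:
  fixes f g h :: "(nat \<Rightarrow> complex) \<Rightarrow> complex"
  assumes p: "0 < p" and [measurable]: "f \<in> borel_measurable torus" "g \<in> borel_measurable torus" "h \<in> borel_measurable torus"
  shows "torus_mean p (\<lambda>\<omega>. f \<omega> + g \<omega> + h \<omega>)
    \<le> ennreal (3 powr p) * (torus_mean p f + torus_mean p g
       + torus_mean p h)"
proof -
  have pt: "norm (x + y + z) powr p \<le> 3 powr p * (norm x powr p + norm y powr p + norm z powr p)" for x y z :: complex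
  proof -
    define M where "M = max (norm x) (max (norm y) (norm z))"
    have "norm (x + y + z) \<le> norm x + norm y + norm z"
      by (meson add_mono_thms_linordered_semiring(3) norm_triangle_le norm_triangle_ineq order_trans)
    also have "\<dots> \<le> 3 * M" unfolding M_def by linarith
    finally have "norm (x + y + z) powr p \<le> (3 * M) powr p" using p by (intro powr_mono2) auto
    also have "\<dots> = 3 powr p * M powr p" by (simp add: powr_mult M_def)
    also have "M powr p \<le> norm x powr p + norm y powr p + norm z powr p"
    proof -
      have "M = norm x \<or> M = norm y \<or> M = norm z" unfolding M_def by linarith
      then show ?thesis
        by (elim disjE; simp add: add_increasing add_increasing2)
    qed
    finally show ?thesis by simp
  qed
  have "torus_mean p (\<lambda>\<omega>. f \<omega> + g \<omega> + h \<omega>)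
     \<le> (\<integral>\<^sup>+\<omega>. ennreal (3 powr p) * (ennreal (norm (f \<omega>) powr p) + ennreal (norm (g \<omega>) powr p) + ennreal (norm (h \<omega>) powr p)) \<partial>torus)"
    using pt by (intro nn_integral_mono)
      (simp add: ennreal_mult'[symmetric] ennreal_plus[symmetric] ennreal_leI del: ennreal_plus)
  also have "\<dots> = ennreal (3 powr p) * (torus_mean p f + torus_mean p g
       + torus_mean p h)"
    by (simp add: nn_integral_cmult nn_integral_add)
  finally show ?thesis .
qed

text \<open>
  If the sequence were not Cauchy, differences of its members would give a bounded sequence with coefficients tending
  to \<open>0\<close> and weighted means bounded below, against compactness of translations and dominated convergence.
\<close>

lemma polynomial_weighted_mean_cauchy:
  assumes p: "0 < p" and m: "0 < m" and fin: "weight_moment \<mu> p m < \<infinity>"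
    and R: "\<And>k. R k \<in> dirichlet_polys" "\<And>k n. n < m \<Longrightarrow> R k n = 0" "\<And>k. hmean p (R k) \<le> B"
    and conv: "\<And>n. convergent (\<lambda>k. R k n)" and e: "0 < e"
  shows "\<exists>N. \<forall>i\<ge>N. \<forall>j\<ge>N. (\<integral>\<^sup>+s. ennreal (weight s) * ennreal (hmean p (shift (of_real (Re s)) (\<lambda>n. R i n - R j n))) \<partial>\<mu>) < ennreal e"
proof (rule ccontr)
  let ?E = "\<lambda>g. \<integral>\<^sup>+s. ennreal (weight s) * ennreal (hmean p (shift (of_real (Re s)) g)) \<partial>\<mu>"
  assume not_thesis: "\<not> ?thesis"
  define D where "D i j = ?E (\<lambda>n. R i n - R j n)" for i j
  have no: "\<not> (\<exists>N. \<forall>i\<ge>N. \<forall>j\<ge>N. D i j < ennreal e)" using not_thesis unfolding D_def .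
  have "\<exists>i j. N \<le> i \<and> N \<le> j \<and> ennreal e \<le> D i j" for N using no by (meson not_less)
  then have "\<exists>I J. \<forall>N. N \<le> I N \<and> N \<le> J N \<and> ennreal e \<le> D (I N) (J N)" by metis
  then obtain I J where IJ: "\<And>N. N \<le> I N" "\<And>N. N \<le> J N" "\<And>N. ennreal e \<le> ?E (\<lambda>n. R (I N) n - R (J N) n)"
    unfolding D_def by blast
  define g where "g N n = R (I N) n - R (J N) n" for N n
  have g: "g N \<in> dirichlet_polys" for N unfolding g_def[abs_def] by (intro dirichlet_polys_diff R)
  have gm: "g N n = 0" if "n < m" for N n using R(2)[OF that] by (simp add: g_def)
  define B' where "B' = 2 powr p * B + 2 powr p * B"
  have gB: "hmean p (g N) \<le> B'" for N
  proof -
    have "hmean p (g N) \<le> 2 powr p * hmean p (R (I N)) + 2 powr p * hmean p (\<lambda>n. - R (J N) n)"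
      using hmean_add_le[OF p zero_less_one R(1)[of "I N"] dirichlet_polys_mult[OF R(1)[of "J N"], of "\<lambda>_. -1"]]
      by (simp add: g_def[abs_def])
    also have "\<dots> \<le> B'" unfolding B'_def hmean_uminus using R(3) by (intro add_mono mult_left_mono) auto
    finally show ?thesis .
  qed
  have B': "0 \<le> B'" using gB hmean_nonneg order_trans by blast
  have g0: "(\<lambda>N. g N n) \<longlonglongrightarrow> 0" for n
  proof -
    obtain l where l: "(\<lambda>k. R k n) \<longlonglongrightarrow> l" using conv[of n] by (auto simp: convergent_def)
    have "filterlim I at_top sequentially" "filterlim J at_top sequentially"
      by (rule filterlim_at_top_mono[OF filterlim_ident], use IJ in simp)+
    then have "(\<lambda>N. R (I N) n) \<longlonglongrightarrow> l" "(\<lambda>N. R (J N) n) \<longlonglongrightarrow> l"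
      using filterlim_compose[OF l] by auto
    from tendsto_diff[OF this] show ?thesis by (simp add: g_def)
  qed
  have [measurable]: "weight \<in> borel_measurable \<mu>" by (rule weight_measurable[OF sets_mu])
  have meas [measurable]: "(\<lambda>s. hmean p (shift (of_real (Re s)) (g N))) \<in> borel_measurable \<mu>" for N
    using measurable_compose[OF Re_Im_measurable(1) borel_measurable_continuous_onI[OF continuous_on_hmean_shift[OF g p]]] by simp
  have "(\<lambda>N. ?E (g N)) \<longlonglongrightarrow> (\<integral>\<^sup>+s. 0 \<partial>\<mu>)"
  proof (rule nn_integral_dominated_convergence[where w = "\<lambda>s. ennreal (weight s) * ennreal (real m powr (- p * Re s)) * ennreal B'"])
    show "(\<lambda>s. ennreal (weight s) * ennreal (real m powr (- p * Re s)) * ennreal B') \<in> borel_measurable \<mu>" by measurable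
    show "(\<integral>\<^sup>+s. ennreal (weight s) * ennreal (real m powr (- p * Re s)) * ennreal B' \<partial>\<mu>) < \<infinity>"
      using fin by (simp add: nn_integral_multc weight_moment_eq ennreal_mult_less_top)
    show "AE s in \<mu>. ennreal (weight s) * ennreal (hmean p (shift (of_real (Re s)) (g N)))
       \<le> ennreal (weight s) * ennreal (real m powr (- p * Re s)) * ennreal B'" for N
    proof (rule AE_I2)
      fix s assume "s \<in> space \<mu>"
      then have s: "0 \<le> Re s" by (simp add: space_mu half_plane_def)
      have "hmean p (shift (of_real (Re s)) (g N)) \<le> real m powr (- p * Re s) * hmean p (g N)"
        by (rule hmean_shift_decay[OF g p m gm s])
      also have "\<dots> \<le> real m powr (- p * Re s) * B'" using gB by (intro mult_left_mono) auto
      finally have "ennreal (hmean p (shift (of_real (Re s)) (g N))) \<le> ennreal (real m powr (- p * Re s)) * ennreal B'"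
        by (simp add: ennreal_mult'[symmetric] ennreal_leI)
      then show "ennreal (weight s) * ennreal (hmean p (shift (of_real (Re s)) (g N)))
       \<le> ennreal (weight s) * ennreal (real m powr (- p * Re s)) * ennreal B'"
        by (simp add: mult.assoc mult_left_mono)
    qed
    show "AE s in \<mu>. (\<lambda>N. ennreal (weight s) * ennreal (hmean p (shift (of_real (Re s)) (g N)))) \<longlonglongrightarrow> 0"
    proof (rule AE_I2)
      fix s assume "s \<in> space \<mu>"
      then have s: "0 < Re s" by (simp add: space_mu half_plane_def)
      have "(\<lambda>N. ennreal (weight s) * ennreal (hmean p (shift (of_real (Re s)) (g N)))) \<longlonglongrightarrow> ennreal (weight s) * ennreal 0"
        by (intro tendsto_mult_ennreal tendsto_const tendsto_ennrealI hmean_shift_tendsto_zero[OF p g gB g0 s]) auto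
      then show "(\<lambda>N. ennreal (weight s) * ennreal (hmean p (shift (of_real (Re s)) (g N)))) \<longlonglongrightarrow> 0" by simp
    qed
  qed measurable
  then have "(\<lambda>N. ?E (g N)) \<longlonglongrightarrow> 0" by simp
  from order_tendstoD(2)[OF this, of "ennreal e"] e
  obtain N where "?E (g N) < ennreal e" by (auto simp: eventually_sequentially)
  then show False using IJ(3)[of N] by (simp add: g_def[abs_def])
qed

text \<open>
  Given images of a bounded sequence, replace its members by nearby polynomials, choose a subsequence with
  convergent coefficients (they are uniformly \<open>O(n\<^sup>2)\<close>), and estimate differences of vertical limits by the two approximation
  errors and the difference of the polynomials.
\<close>

theorem area_op_compact:
  assumes p: "0 < p" and m: "0 < m" and fin: "weight_moment \<mu> p m < \<infinity>"
  shows "area_compact \<mu> p p (hardy_from p m)"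
  unfolding area_compact_def
proof (intro allI impI conjI)
  fix B assume B: "B \<subseteq> hardy_from p m" and "\<exists>M. \<forall>a\<in>B. hardy_norm p a \<le> M"
  then obtain M where M: "\<And>a. a \<in> B \<Longrightarrow> hardy_norm p a \<le> M" by blast
  define c where "c = enn2real (weight_moment \<mu> p m)"
  have c: "weight_moment \<mu> p m = ennreal c" "0 \<le> c" using fin by (auto simp: c_def)
  have "area_bound \<mu> p p (hardy_from p m) (c powr (1 / p))"
    using area_bound_iff[OF p sets_mu m fin] by (simp add: c_def)
  then have L: "area_op \<mu> p a \<in> Lpi p" if "a \<in> hardy_from p m" for a using that by (auto simp: area_bound_def)
  then show "area_op \<mu> p ` B \<subseteq> Lpi p" using B by blast
  then show "compactin (Lpi_topology p) (Lpi_topology p closure_of (area_op \<mu> p ` B))"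
  proof (rule Lpi_compactin_closure[OF p])
    fix F :: "nat \<Rightarrow> _" assume "\<And>n. F n \<in> area_op \<mu> p ` B"
    then have "\<forall>n. \<exists>a\<in>B. F n = area_op \<mu> p a" by blast
    then obtain a where a: "\<And>n. a n \<in> B" "\<And>n. F n = area_op \<mu> p (a n)" by metis
    have aX: "a n \<in> hardy_from p m" for n using a(1) B by blast
    define A where "A = M powr p"
    have nA: "hardy_norm p (a n) powr p \<le> A" for n
    proof -
      obtain P where "approximates p P (a n)" using aX[of n] by (auto simp: hardy_from_def hardy_def)
      from hardy_norm_limit(2)[OF p this] M[OF a(1)[of n]] show ?thesis
        unfolding A_def using p by (intro powr_mono2) auto
    qed
    have A0: "0 \<le> A" by (simp add: A_def)
    have "\<exists>H Q. approximant p m (a k) (1 / real (Suc k)) H Q" for k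
      by (rule hardy_polynomial_approximation[OF p m aX]) simp
    then obtain H Q where HQ: "\<And>k. approximant p m (a k) (1 / real (Suc k)) (H k) (Q k)" by metis
    note H = approximantD(1)[OF HQ] and ae = approximantD(2)[OF HQ] and Q = approximantD(3,4)[OF HQ]
      and QB = approximantD(5)[OF HQ] and H_le = approximantD(6)[OF HQ] and HQ_le = approximantD(7)[OF HQ]
    have QA: "hmean p (Q k) \<le> A + 1" for k using QB[of k] nA[of k] by linarith
    \<comment> \<open>Dividing by \<open>n\<^sup>2\<close> makes the coefficients uniformly bounded in \<open>n\<close>; at \<open>n = 0\<close> they vanish.\<close>
    obtain r where r: "strict_mono r" and conv: "\<And>n. \<exists>l. (\<lambda>k. Q (r k) n / (of_nat n)\<^sup>2) \<longlonglongrightarrow> l"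
    proof (rule function_convergent_subsequence[of "UNIV :: nat set" "\<lambda>k n. Q k n / (of_nat n)\<^sup>2" "(2 * (A + 1)) powr (1 / p)"])
      show "norm (Q k n / (of_nat n)\<^sup>2) \<le> (2 * (A + 1)) powr (1 / p)" for k n
      proof (cases "n = 0")
        case False
        have "norm (Q k n) \<le> real n ^ 2 * (2 * hmean p (Q k)) powr (1 / p)" by (rule coefficient_bound_square[OF Q(1) p])
        also have "\<dots> \<le> real n ^ 2 * (2 * (A + 1)) powr (1 / p)"
          using QA[of k] p hmean_nonneg by (intro mult_left_mono powr_mono2) auto
        finally show ?thesis using False by (simp add: norm_divide norm_power field_simps)
      qed simp
    qed auto
    define R where "R k = Q (r k)" for k
    have R: "R k \<in> dirichlet_polys" "n < m \<Longrightarrow> R k n = 0" "hmean p (R k) \<le> A + 1" for k n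
      using Q QA by (auto simp: R_def)
    have Rconv: "convergent (\<lambda>k. R k n)" for n
    proof (cases "n = 0")
      case True
      then show ?thesis using dirichlet_polysD(2)[OF R(1)] by (simp add: convergent_const)
    next
      case False
      obtain l where "(\<lambda>k. Q (r k) n / (of_nat n)\<^sup>2) \<longlonglongrightarrow> l" using conv by blast
      then have "(\<lambda>k. Q (r k) n / (of_nat n)\<^sup>2 * (of_nat n)\<^sup>2) \<longlonglongrightarrow> l * (of_nat n)\<^sup>2" by (intro tendsto_intros)
      then show ?thesis using False by (auto simp: convergent_def R_def)
    qed
    define E where "E i j = (\<integral>\<^sup>+s. ennreal (weight s) * ennreal (hmean p (shift (of_real (Re s)) (\<lambda>n. R i n - R j n))) \<partial>\<mu>)" for i j
    have wH: "weighted_mean p (H k) \<le> ennreal (c * A)" for k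
    proof -
      have "weighted_mean p (H k) \<le> weight_moment \<mu> p m * ennreal (hardy_norm p (a k) powr p)"
        unfolding weighted_mean_def by (rule nn_integral_weight_le[OF H_le])
      also have "\<dots> \<le> ennreal c * ennreal A" unfolding c(1) using nA by (intro mult_left_mono ennreal_leI) auto
      also have "\<dots> = ennreal (c * A)" using c by (simp add: ennreal_mult')
      finally show ?thesis .
    qed
    have wD: "weighted_mean p (\<lambda>\<omega> s. H (r i) \<omega> s - H (r j) \<omega> s)
        \<le> ennreal (3 powr p) * (ennreal (c * (1 / real (Suc (r i)) + 1 / real (Suc (r j)))) + E i j)" for i j
    proof -
      let ?w = "\<lambda>s. ennreal (real m powr (- p * Re s))"
      let ?D = "\<lambda>n. R i n - R j n"
      have D: "?D \<in> dirichlet_polys" by (intro dirichlet_polys_diff R)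
      have [measurable]: "weight \<in> borel_measurable \<mu>" by (rule weight_measurable[OF sets_mu])
      have [measurable]: "(\<lambda>s. hmean p (shift (of_real (Re s)) ?D)) \<in> borel_measurable \<mu>"
        using measurable_compose[OF Re_Im_measurable(1) borel_measurable_continuous_onI[OF continuous_on_hmean_shift[OF D p]]] by simp
      have "weighted_mean p (\<lambda>\<omega> s. H (r i) \<omega> s - H (r j) \<omega> s)
         \<le> (\<integral>\<^sup>+s. ennreal (3 powr p) * (ennreal (weight s) * ?w s * ennreal (1 / real (Suc (r i)) + 1 / real (Suc (r j)))
              + ennreal (weight s) * ennreal (hmean p (shift (of_real (Re s)) ?D))) \<partial>\<mu>)"
        unfolding weighted_mean_def
      proof (rule nn_integral_mono)
        fix s assume s: "s \<in> space \<mu>"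
        then have sh: "s \<in> half_plane" by (simp add: space_mu)
        have [measurable]: "(\<lambda>\<omega>. H k \<omega> s) \<in> borel_measurable torus" for k
          using measurable_compose[OF measurable_Pair2'[OF s] H[of k]] by simp
        let ?b = "\<lambda>k \<omega>. bohr_lift (shift s (R k)) \<omega>"
        have "torus_mean p (\<lambda>\<omega>. H (r i) \<omega> s - H (r j) \<omega> s)
            = torus_mean p (\<lambda>\<omega>. (H (r i) \<omega> s - ?b i \<omega>) + (?b i \<omega> - ?b j \<omega>) + (?b j \<omega> - H (r j) \<omega> s))"
          by simp
        also have "\<dots> \<le> ennreal (3 powr p) * (torus_mean p (\<lambda>\<omega>. H (r i) \<omega> s - ?b i \<omega>)
             + torus_mean p (\<lambda>\<omega>. ?b i \<omega> - ?b j \<omega>) + torus_mean p (\<lambda>\<omega>. ?b j \<omega> - H (r j) \<omega> s))"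
          by (rule nn_integral_powr_add3[OF p]) measurable
        also have "torus_mean p (\<lambda>\<omega>. ?b i \<omega> - ?b j \<omega>) = ennreal (hmean p (shift (of_real (Re s)) ?D))"
          using nn_integral_bohr_lift[OF p, of "shift s ?D"] hmean_shift_Re[OF D p, of s]
          by (simp add: shift_diff bohr_lift_diff shift_polys R)
        also have "ennreal (3 powr p) * (torus_mean p (\<lambda>\<omega>. H (r i) \<omega> s - ?b i \<omega>)
             + ennreal (hmean p (shift (of_real (Re s)) ?D)) + torus_mean p (\<lambda>\<omega>. ?b j \<omega> - H (r j) \<omega> s))
            \<le> ennreal (3 powr p) * (?w s * ennreal (1 / real (Suc (r i))) + ennreal (hmean p (shift (of_real (Re s)) ?D)) + ?w s * ennreal (1 / real (Suc (r j))))"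
          using HQ_le[OF sh, of "r i"] HQ_le[OF sh, of "r j"]
          by (intro mult_left_mono add_mono) (auto simp: R_def norm_minus_commute)
        also have "\<dots> = ennreal (3 powr p) * (?w s * ennreal (1 / real (Suc (r i)) + 1 / real (Suc (r j))) + ennreal (hmean p (shift (of_real (Re s)) ?D)))"
          by (subst ennreal_plus) (auto simp: ring_distribs add_ac)
        finally have "ennreal (weight s) * torus_mean p (\<lambda>\<omega>. H (r i) \<omega> s - H (r j) \<omega> s)
           \<le> ennreal (weight s) * (ennreal (3 powr p) * (?w s * ennreal (1 / real (Suc (r i)) + 1 / real (Suc (r j))) + ennreal (hmean p (shift (of_real (Re s)) ?D))))"
          by (rule mult_left_mono) simp
        then show "ennreal (weight s) * torus_mean p (\<lambda>\<omega>. H (r i) \<omega> s - H (r j) \<omega> s)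
           \<le> ennreal (3 powr p) * (ennreal (weight s) * ?w s * ennreal (1 / real (Suc (r i)) + 1 / real (Suc (r j)))
              + ennreal (weight s) * ennreal (hmean p (shift (of_real (Re s)) ?D)))"
          by (simp add: ring_distribs mult_ac)
      qed
      also have "\<dots> = ennreal (3 powr p) * (weight_moment \<mu> p m * ennreal (1 / real (Suc (r i)) + 1 / real (Suc (r j))) + E i j)"
        unfolding E_def weight_moment_eq
        by (rule nn_integral_affine) measurable
      also have "weight_moment \<mu> p m * ennreal (1 / real (Suc (r i)) + 1 / real (Suc (r j))) = ennreal (c * (1 / real (Suc (r i)) + 1 / real (Suc (r j))))"
        unfolding c(1) using c(2) by (simp add: ennreal_mult')
      finally show ?thesis .
    qed
    have "\<exists>N. \<forall>i\<ge>N. \<forall>j\<ge>N. real_mean p (\<lambda>x. real_fun (F (r i)) x - real_fun (F (r j)) x) strip_measure < ennreal e" if e: "0 < e" for e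
    proof -
      \<comment> \<open>The budget: less than \<open>e / 2\<close> for the multiple of the weighted means, at most \<open>e / 4\<close> for the difference; adding \<open>1\<close> avoids division by \<open>0\<close>.\<close>
      define \<eta> where "\<eta> = e / (4 * (c * A + 1))"
      have cA: "0 \<le> c * A" using c A0 by simp
      have \<eta>: "0 < \<eta>" using e cA by (simp add: \<eta>_def)
      have \<eta>2: "\<eta> * (c * A + c * A) < e / 2"
      proof -
        have "\<eta> * (c * A + c * A) < \<eta> * (2 * (c * A + 1))" using \<eta> by (intro mult_strict_left_mono) auto
        also have "\<dots> = e / 2" using cA by (simp add: \<eta>_def field_simps add_nonneg_eq_0_iff)
        finally show ?thesis .
      qed
      obtain C where C: "0 \<le> C" and root: "\<forall>X\<ge>0. \<forall>Y\<ge>0. \<forall>Z\<ge>0. (\<forall>d>0. X \<le> (1 + d) powr p * Y + (1 + 1/d) powr p * Z) \<longrightarrow>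
        (\<forall>d>0. Y \<le> (1 + d) powr p * X + (1 + 1/d) powr p * Z) \<longrightarrow>
        \<bar>X powr (1/p) - Y powr (1/p)\<bar> powr p \<le> \<eta> * (X + Y) + C * Z"
        by (rule root_difference[OF p \<eta>])
      define t where "t = e / (8 * (C * 3 powr p + 1))"
      have C3: "0 \<le> C * 3 powr p" using C by simp
      have t: "0 < t" using e C3 by (simp add: t_def)
      have t2: "C * (3 powr p * (t + t)) \<le> e / 4"
      proof -
        have "C * (3 powr p * (t + t)) = (C * 3 powr p) * (2 * t)" by simp
        also have "\<dots> \<le> (C * 3 powr p + 1) * (2 * t)" using t by (intro mult_right_mono) auto
        also have "\<dots> = e / 4" using C3 by (simp add: t_def field_simps add_nonneg_eq_0_iff)
        finally show ?thesis .
      qed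
      obtain N1 where N1: "\<And>i j. N1 \<le> i \<Longrightarrow> N1 \<le> j \<Longrightarrow> E i j < ennreal t"
        using polynomial_weighted_mean_cauchy[OF p m fin R Rconv t] unfolding E_def by blast
      have "(\<lambda>k. c * (1 / real (Suc (r k)))) \<longlonglongrightarrow> c * 0"
        using LIMSEQ_subseq_LIMSEQ[OF LIMSEQ_inverse_real_of_nat r] by (intro tendsto_intros) (simp add: o_def inverse_eq_divide)
      from order_tendstoD(2)[OF this, of "t / 2"] t
      obtain N2 where N2: "\<And>k. N2 \<le> k \<Longrightarrow> c * (1 / real (Suc (r k))) < t / 2" by (auto simp: eventually_sequentially)
      have "real_mean p (\<lambda>x. real_fun (F (r i)) x - real_fun (F (r j)) x) strip_measure < ennreal e" if i: "max N1 N2 \<le> i" and j: "max N1 N2 \<le> j" for i j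
      proof -
        have wt: "weighted_mean p (\<lambda>\<omega> s. H (r i) \<omega> s - H (r j) \<omega> s) \<le> ennreal (3 powr p * (t + t))"
        proof -
          have "c * (1 / real (Suc (r i)) + 1 / real (Suc (r j))) \<le> t"
            unfolding distrib_left using N2[of i] N2[of j] i j by linarith
          then have "ennreal (3 powr p) * (ennreal (c * (1 / real (Suc (r i)) + 1 / real (Suc (r j)))) + E i j)
             \<le> ennreal (3 powr p) * (ennreal t + ennreal t)"
            using N1[of i j] i j by (intro mult_left_mono add_mono ennreal_leI) auto
          also have "\<dots> = ennreal (3 powr p * (t + t))"
            using t by (simp add: ennreal_mult'[symmetric] ennreal_plus[symmetric] del: ennreal_plus)
          finally show ?thesis using wD[of i j] by (rule order_trans[rotated])
        qed
        have "real_mean p (\<lambda>x. real_fun (F (r i)) x - real_fun (F (r j)) x) strip_measure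
          \<le> ennreal \<eta> * (weighted_mean p (H (r i)) + weighted_mean p (H (r j))) + ennreal C * weighted_mean p (\<lambda>\<omega> s. H (r i) \<omega> s - H (r j) \<omega> s)"
          unfolding a(2)
        proof (rule area_difference[OF p \<eta> C root H H ae ae])
          show "weighted_mean p (H k) < \<infinity>" "weighted_mean p (H k) < \<infinity>" for k
            using wH[of k] by (auto intro: le_less_trans)
          show "weighted_mean p (\<lambda>\<omega> s. H (r i) \<omega> s - H (r j) \<omega> s) < \<infinity>"
            using wt by (rule le_less_trans) simp
        qed
        also have "\<dots> \<le> ennreal \<eta> * (ennreal (c * A) + ennreal (c * A)) + ennreal C * ennreal (3 powr p * (t + t))"
          using wH wt by (intro add_mono mult_left_mono) auto
        also have "\<dots> = ennreal (\<eta> * (c * A + c * A) + C * (3 powr p * (t + t)))"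
        proof -
          have comb: "ennreal \<eta> * (ennreal u + ennreal u) + ennreal C * ennreal v = ennreal (\<eta> * (u + u) + C * v)"
            if "0 \<le> u" "0 \<le> v" for u v
            using that \<eta> C by (simp add: ennreal_mult'[symmetric] ennreal_plus[symmetric] del: ennreal_plus)
          show ?thesis by (rule comb[OF cA]) (use t in simp)
        qed
        also have "\<dots> < ennreal e"
          using \<eta>2 t2 e by (intro ennreal_lessI) auto
        finally show ?thesis .
      qed
      then show ?thesis by blast
    qed
    then show "\<exists>r::nat \<Rightarrow> nat. strict_mono r \<and> (\<forall>e>0. \<exists>N. \<forall>i\<ge>N. \<forall>j\<ge>N. real_mean p (\<lambda>x. real_fun (F (r i)) x - real_fun (F (r j)) x) strip_measure < ennreal e)"
      using r by (intro exI[of _ r]) simp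
  qed
qed

end

theorem area_operator_characterization:
  assumes p: "0 < p" and sets: "sets \<mu> = sets (restrict_space borel half_plane)" and m: "0 < m"
  shows "area_bounded \<mu> p p (hardy_from p m) \<longleftrightarrow> weight_moment \<mu> p m < \<infinity>"
    and "area_compact \<mu> p p (hardy_from p m) \<longleftrightarrow> weight_moment \<mu> p m < \<infinity>"
proof -
  have fin: "weight_moment \<mu> p m < \<infinity>" if "area_op \<mu> p (monomial m) \<in> Lpi p"
    by (rule moment_finite_of_Lpi[OF p sets m that])
  show "area_bounded \<mu> p p (hardy_from p m) \<longleftrightarrow> weight_moment \<mu> p m < \<infinity>"
  proof
    assume "area_bounded \<mu> p p (hardy_from p m)"
    then show "weight_moment \<mu> p m < \<infinity>"
      using monomial_hardy_from(1)[OF p m] by (intro fin) (auto simp: area_bounded_def area_bound_def)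
  next
    assume "weight_moment \<mu> p m < \<infinity>"
    from area_bound_iff[OF p sets m this] show "area_bounded \<mu> p p (hardy_from p m)"
      unfolding area_bounded_def by blast
  qed
  show "area_compact \<mu> p p (hardy_from p m) \<longleftrightarrow> weight_moment \<mu> p m < \<infinity>"
  proof
    assume "area_compact \<mu> p p (hardy_from p m)"
    then have "area_op \<mu> p ` {monomial m} \<subseteq> Lpi p"
      unfolding area_compact_def using monomial_hardy_from(1)[OF p m] by blast
    then show "weight_moment \<mu> p m < \<infinity>" by (intro fin) simp
  next
    assume f: "weight_moment \<mu> p m < \<infinity>"
    interpret half_plane_measure \<mu>
      using sigma_finite_of_moment[OF sets m f] sets by (simp add: half_plane_measure_def half_plane_measure_axioms_def)
    show "area_compact \<mu> p p (hardy_from p m)" by (rule area_op_compact[OF p m f])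
  qed
qed

theorem theorem4p1:
  fixes p :: real and \<mu> :: "complex measure"
  assumes "0 < p"
    and "sets \<mu> = sets (restrict_space borel half_plane)"
  shows
    "((area_bounded \<mu> p p (hardy p) \<longleftrightarrow> area_compact \<mu> p p (hardy p)) \<and>
      (area_compact \<mu> p p (hardy p) \<longleftrightarrow> weight_moment \<mu> p 1 < \<infinity>) \<and>
      (area_bounded \<mu> p p (hardy p) \<longrightarrow>
         ennreal (area_opnorm \<mu> p p (hardy p) powr p) = weight_moment \<mu> p 1)) \<and>
     ((area_bounded \<mu> p p (hardy0 p) \<longleftrightarrow> area_compact \<mu> p p (hardy0 p)) \<and>
      (area_compact \<mu> p p (hardy0 p) \<longleftrightarrow> weight_moment \<mu> p 2 < \<infinity>) \<and>
      (area_bounded \<mu> p p (hardy0 p) \<longrightarrow>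
         ennreal (area_opnorm \<mu> p p (hardy0 p) powr p) = weight_moment \<mu> p 2))"
proof -
  have two: "0 < (2::nat)" by simp
  show ?thesis
    unfolding hardy_eq hardy0_eq area_operator_characterization[OF assms zero_less_one] area_operator_characterization[OF assms two]
    using area_opnorm_eq[OF assms zero_less_one] area_opnorm_eq[OF assms two] by blast
qed

end
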